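(* Let $F:\mathbb{R}^{n_0}\to\mathbb{R}$ be a supertransversal, generic ReLU neural network which is injective on the vertices of its canonical polyhedral complex $\mathcal{C}(F)$ and whose only flat cells are vertices. For each vertex $v$ of $\mathcal{C}(F)$, let $V(v)$ be an acyclic discrete vector field on the lower star $\mathrm{star}^-(v)$ obtained by the local pairing construction (described in the context). Then $V=\bigcup_{v} V(v)$, the union being over all vertices $v$ of $\mathcal{C}(F)$, is a discrete gradient vector field on $\mathcal{C}(F)^-_*$ that is relatively perfect with respect to $F$, with $\{*\}$ a critical $0$-cell.
   Context: **Networks.** A ReLU neural network of architecture $(n_0,\dots,n_m,1)$ is a function $F=G\circ F_m\circ\cdots\circ F_1:\mathbb{R}^{n_0}\to\mathbb{R}$, where $F_k=\mathrm{ReLU}\circ A_k$, each $A_k:\mathbb{R}^{n_{k-1}}\to\mathbb{R}^{n_k}$ is affine, $G:\mathbb{R}^{n_m}\to\mathbb{R}$ is affine, and $\mathrm{ReLU}$ is $x\mapsto\max\{0,x\}$ coordinatewise. Put $F_{(k)}=F_k\circ\cdots\circ F_1$ and $F_{(0)}=\mathrm{id}$. Let $\pi_j$ be the $j$th coordinate projection and $H_{kj}=\{x\in\mathbb{R}^{n_{k-1}}:\pi_j A_k(x)=0\}$. **Canonical polyhedral complex.** Polyhedra are closed finite intersections of half-spaces, possibly unbounded. Let $R^{(k)}$ be the polyhedral complex of the arrangement $\{H_{kj}\}_j$ in $\mathbb{R}^{n_{k-1}}$. Set $\mathcal{C}(F_{(1)})=R^{(1)}$, $\mathcal{C}(F_{(k)})=\{C\cap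 F_{(k-1)}^{-1}(R): C\in\mathcal{C}(F_{(k-1)}),R\in R^{(k)}\}$, and $\mathcal{C}(F)=\mathcal{C}(F_{(m)})$. It decomposes $\mathbb{R}^{n_0}$ and $F$ is affine on each cell. **Generic, supertransversal.** $F$ is generic if for each $k$ the hyperplanes $H_{kj}$ ($1\le j\le n_k$) are in general position (any $r$ of them meet in codimension $r$, or in the empty set if $r>n_{k-1}$). $F$ is supertransversal if for each $k$, each $C\in\mathcal{C}(F_{(k-1)})$ and each set $J$ of indices, the restriction of $F_{(k-1)}$ to the relative interior of $C$ is transverse to $\bigcap_{j\in J}H_{kj}$. **Sign sequences.** $s_{ij}(C)\in\{-1,0,1\}$ is the sign of $\pi_j\circ A_i\circ F_{(i-1)}$ on the relative interior of $C$. For $F$ supertransversal and generic, a $k$-cell has exactly $n_0-k$ zero entries, and the cells containing a cell $C$ are obtained by replacing zero entries of $s(C)$ by $\pm1$ arbitrarily. So each vertex $v$ has $n_0$ zero entries and $2n_0$ incident edges $e_i^{\pm}$ ($1\le i\le n_0$), where $e_i^\pm$ is obtained by replacing the $i$th zero entry by $\pm1$. The cells containing $v$ correspond bijectively to the subsets of $\{e_i^\pm\}$ containing no pair $\{e_i^+,e_i^-\}$ (a cell corresponds to the set of its edges at $v$, with $\{v\}$ corresponding to $\emptyset$); the dimension is the size of the subset and face relation is inclusion. **Flat cells, orientations, criticality.** A cell is flat if $F$ is constant on it. The $\nabla F$-orientation orients each edge on which $F$ is nonconstant in the direction of increase of $F$. A vertex $v$ is PL critical iff for every $i$ the edges $e_i^+,e_i^-$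 are both oriented toward $v$ or both oriented away from $v$; its index is then the number of $i$ for which both are oriented toward $v$. Otherwise $v$ is PL regular. (For the networks considered here this is equivalent to the general definition of PL critical/regular points and may be taken as the definition.) **Lower star.** $\mathrm{star}^-(v)=\{C\in\mathcal{C}(F): v\in C,\ F(x)\le F(v)\ \forall x\in C\}$. Under the bijection sending a cell containing $v$ to the set of its edges at $v$, it corresponds to the subsets of $\{e_i^\pm\}$ (containing no pair $\{e_i^+,e_i^-\}$) consisting of edges oriented toward $v$. **Local pairing construction.** Identify each cell of $\mathrm{star}^-(v)$ with the set $S\subseteq\{e_i^\pm: 1\le i\le n_0\}$ of its edges at $v$ (so $S$ contains no pair $\{e_i^+,e_i^-\}$, all edges in $S$ are oriented toward $v$, the cell $\{v\}$ is identified with $\emptyset$, the dimension of the cell is $|S|$, and the face relation is inclusion). (i) If $v$ is PL regular: choose $i$ such that exactly one of $e_i^+,e_i^-$ lies in $\mathrm{star}^-(v)$, call it $e$; $V(v)$ consists of all pairs $(S,S\cup\{e\})$ with $S\in\mathrm{star}^-(v)$, $e\notin S$. (ii) If $v$ is PL critical of index $k$: order the $k$ coordinate directions whose two edges lie in $\mathrm{star}^-(v)$ as $1,\dots,k$, and for each choose one of the two edges, denoted $v_i$, the other being $v_i^{op}$. For $i=1,\dots,k$ successively, for each $S\in\mathrm{star}^-(v)$ with $v_i,v_i^{op}\notin S$ add the pair $(S,S\cup\{v_i\})$ if $S$ has not yet been paired. $V(v)$ is the resulting set of pairs. **The complex $\mathcal{C}(F)^-_*$.** $\mathcal{C}(F)^-$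 is the subcomplex of cells $C\in\mathcal{C}(F)$ on which $F$ is bounded above. $\mathcal{C}(F)^-_*$ is its one-point compactification, a regular CW complex with no unbounded cells: its cells are those of $\mathcal{C}(F)^-$ (unbounded cells acquiring $*$ in their closure) together with the $0$-cell $\{*\}$, with $F( * )=-\infty$. **Discrete gradient vector fields.** A discrete vector field on a regular CW complex is a collection $V$ of pairs $(C,D)$ of cells with $C$ a face of $D$, $\dim C=\dim D-1$, each cell in at most one pair. A $V$-path is a sequence $C_0,D_0,C_1,D_1,\dots,C_r,D_r$ with $(C_i,D_i)\in V$ and $D_i>C_{i+1}\ne C_i$. $V$ is acyclic, equivalently a discrete gradient vector field (of a discrete Morse function), if there are no nontrivial closed $V$-paths. Unpaired cells are critical. **Relative perfectness.** For $\ell$ a value of $F$ on a vertex of $\mathcal{C}(F)^-_*$ (including $\ell=-\infty$), let $\mathcal{C}_\ell$ be the subcomplex of cells $C$ with $\max_C F\le\ell$, and let $\ell'$ be the greatest vertex value strictly less than $\ell$ (with $\mathcal{C}_{\ell'}=\emptyset$ if there is none). $V$ is relatively perfect with respect to $F$ if for all such $\ell$ and all $i$, the number of critical $i$-cells of $V$ in $\mathcal{C}_\ell\setminus\mathcal{C}_{\ell'}$ equals $\operatorname{rank}H_i(|\mathcal{C}_\ell|,|\mathcal{C}_{\ell'}|)$. *)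

theory Defs
  imports "HOL-Analysis.Analysis" "HOL-Homology.Homology"
begin

text \<open>
  The widths of the layers of one network differ, so every space \<open>R^(n_k)\<close> is realised
  as the coordinate subspace \<open>layer_space \<Phi> k\<close> of a common \<open>real^'d\<close>, spanned by the
  coordinates in \<open>neurons \<Phi> k\<close>; thus \<open>n_k = card (neurons \<Phi> k)\<close>, and layer \<open>0\<close> is the
  input.  As \<open>'d\<close> is an arbitrary finite type, every architecture arises.
  The affine maps \<open>A_k\<close> (\<open>1 \<le> k \<le> m\<close>) and \<open>G\<close> are only relevant on the respective
  subspaces.
\<close>

record ('d :: finite) relu_net =
  depth :: nat
  neurons :: "nat \<Rightarrow> 'd set"
  aff_layer :: "nat \<Rightarrow> real^'d \<Rightarrow> real^'d"
  out_layer :: "real^'d \<Rightarrow> real"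

definition layer_space :: "'d::finite relu_net \<Rightarrow> nat \<Rightarrow> (real^'d) set" where
  "layer_space \<Phi> k = {x. \<forall>i. i \<notin> neurons \<Phi> k \<longrightarrow> x $ i = 0}"

definition affine_map_on :: "'a::real_vector set \<Rightarrow> ('a \<Rightarrow> 'b::real_vector) \<Rightarrow> bool" where
  "affine_map_on S f \<longleftrightarrow> (\<exists>L c. linear L \<and> (\<forall>x\<in>S. f x = L x + c))"

definition relu_network :: "'d::finite relu_net \<Rightarrow> bool" where
  "relu_network \<Phi> \<longleftrightarrow>
     (\<forall>k\<in>{1..depth \<Phi>}. affine_map_on (layer_space \<Phi> (k - 1)) (aff_layer \<Phi> k) \<and>
        aff_layer \<Phi> k ` layer_space \<Phi> (k - 1) \<subseteq> layer_space \<Phi> k) \<and>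
     affine_map_on (layer_space \<Phi> (depth \<Phi>)) (out_layer \<Phi>)"

definition relu :: "real^'d \<Rightarrow> real^'d::finite" where
  "relu x = (\<chi> i. max 0 (x $ i))"

primrec hidden :: "'d::finite relu_net \<Rightarrow> nat \<Rightarrow> real^'d \<Rightarrow> real^'d" where
  "hidden \<Phi> 0 = id"
| "hidden \<Phi> (Suc k) = relu \<circ> aff_layer \<Phi> (Suc k) \<circ> hidden \<Phi> k"

definition net_fun :: "'d::finite relu_net \<Rightarrow> real^'d \<Rightarrow> real" where
  "net_fun \<Phi> = out_layer \<Phi> \<circ> hidden \<Phi> (depth \<Phi>)"

definition neuron_hyperplane :: "'d::finite relu_net \<Rightarrow> nat \<Rightarrow> 'd \<Rightarrow> (real^'d) set" where
  "neuron_hyperplane \<Phi> k j = {x \<in> layer_space \<Phi> (k - 1). aff_layer \<Phi> k x $ j = 0}"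

text \<open>The intersection over the empty family is the whole space.\<close>

definition hyperplane_meet :: "'d::finite relu_net \<Rightarrow> nat \<Rightarrow> 'd set \<Rightarrow> (real^'d) set" where
  "hyperplane_meet \<Phi> k J = layer_space \<Phi> (k - 1) \<inter> (\<Inter>j\<in>J. neuron_hyperplane \<Phi> k j)"

text \<open>
  The closed cells of a hyperplane arrangement are the closures of the classes of points
  lying on the same side of every hyperplane.
\<close>

definition arrangement_complex :: "'d::finite relu_net \<Rightarrow> nat \<Rightarrow> (real^'d) set set" where
  "arrangement_complex \<Phi> k =
     {closure {y \<in> layer_space \<Phi> (k - 1).
         \<forall>j\<in>neurons \<Phi> k. sgn (aff_layer \<Phi> k y $ j) = sgn (aff_layer \<Phi> k z $ j)}
      | z. z \<in> layer_space \<Phi> (k - 1)}"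

text \<open>
  Starting from the trivial complex \<open>{R^(n_0)}\<close> for \<open>F_(0) = id\<close>, level \<open>1\<close> is the complex
  of the first arrangement.  The empty set does not count as a cell.
\<close>

primrec partial_cells :: "'d::finite relu_net \<Rightarrow> nat \<Rightarrow> (real^'d) set set" where
  "partial_cells \<Phi> 0 = {layer_space \<Phi> 0}"
| "partial_cells \<Phi> (Suc k) =
     {C \<inter> hidden \<Phi> k -` R | C R. C \<in> partial_cells \<Phi> k \<and> R \<in> arrangement_complex \<Phi> (Suc k)}
     - {{}}"

definition cells :: "'d::finite relu_net \<Rightarrow> (real^'d) set set" where
  "cells \<Phi> = partial_cells \<Phi> (depth \<Phi>)"

definition vertices :: "'d::finite relu_net \<Rightarrow> (real^'d) set" where
  "vertices \<Phi> = {v. {v} \<in> cells \<Phi>}"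

definition flat :: "'d::finite relu_net \<Rightarrow> (real^'d) set \<Rightarrow> bool" where
  "flat \<Phi> C \<longleftrightarrow> (\<exists>c. \<forall>x\<in>C. net_fun \<Phi> x = c)"

definition generic :: "'d::finite relu_net \<Rightarrow> bool" where
  "generic \<Phi> \<longleftrightarrow> (\<forall>k\<in>{1..depth \<Phi>}. \<forall>J \<subseteq> neurons \<Phi> k.
     if card J \<le> card (neurons \<Phi> (k - 1))
     then aff_dim (hyperplane_meet \<Phi> k J) = int (card (neurons \<Phi> (k - 1))) - int (card J)
     else hyperplane_meet \<Phi> k J = {})"

text \<open>
  For a nonempty relatively open subset of an affine subspace (the only kind of manifold
  occurring here) this is the tangent space at each of its points.
\<close>

definition tangent :: "'a::real_vector set \<Rightarrow> 'a set" where
  "tangent S = span {y - x | x y. x \<in> S \<and> y \<in> S}"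

text \<open>
  The map \<open>f\<close> goes from \<open>M\<close> to the linear space \<open>E\<close>, and \<open>N \<subseteq> E\<close>.  The derivative is that
  of the restriction of \<open>f\<close> to \<open>M\<close>; it is determined on \<open>tangent M\<close> only.
\<close>

definition transverse_on ::
    "('a::real_normed_vector \<Rightarrow> 'b::real_normed_vector) \<Rightarrow> 'a set \<Rightarrow> 'b set \<Rightarrow> 'b set \<Rightarrow> bool" where
  "transverse_on f M N E \<longleftrightarrow> (\<forall>x\<in>M. f x \<in> N \<longrightarrow>
     (\<exists>D. (f has_derivative D) (at x within M) \<and>
          {D u + w | u w. u \<in> tangent M \<and> w \<in> tangent N} = E))"

definition supertransversal :: "'d::finite relu_net \<Rightarrow> bool" where
  "supertransversal \<Phi> \<longleftrightarrow>
     (\<forall>k\<in>{1..depth \<Phi>}. \<forall>C\<in>partial_cells \<Phi> (k - 1). \<forall>J \<subseteq> neurons \<Phi> k.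
        transverse_on (hidden \<Phi> (k - 1)) (rel_interior C)
          (hyperplane_meet \<Phi> k J) (layer_space \<Phi> (k - 1)))"

definition entries :: "'d::finite relu_net \<Rightarrow> (nat \<times> 'd) set" where
  "entries \<Phi> = (SIGMA i:{1..depth \<Phi>}. neurons \<Phi> i)"

definition sign_seq :: "'d::finite relu_net \<Rightarrow> (real^'d) set \<Rightarrow> nat \<times> 'd \<Rightarrow> real" where
  "sign_seq \<Phi> C = (\<lambda>(i, j). if (i, j) \<in> entries \<Phi>
     then (THE s. \<forall>x\<in>rel_interior C. sgn (aff_layer \<Phi> i (hidden \<Phi> (i - 1) x) $ j) = s)
     else 0)"

definition directions :: "'d::finite relu_net \<Rightarrow> real^'d \<Rightarrow> (nat \<times> 'd) set" where
  "directions \<Phi> v = {p \<in> entries \<Phi>. sign_seq \<Phi> {v} p = 0}"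

text \<open>
  For \<open>p \<in> directions \<Phi> v\<close> the sign sequences on the right belong to exactly one cell if
  \<open>\<Phi>\<close> is generic and supertransversal.  The edges \<open>e_p^+\<close> and \<open>e_p^-\<close> at \<open>v\<close> are
  \<open>edge \<Phi> v p 1\<close> and \<open>edge \<Phi> v p (-1)\<close>.
\<close>

definition edge :: "'d::finite relu_net \<Rightarrow> real^'d \<Rightarrow> nat \<times> 'd \<Rightarrow> real \<Rightarrow> (real^'d) set" where
  "edge \<Phi> v p s = (THE E. E \<in> cells \<Phi> \<and> sign_seq \<Phi> E = (sign_seq \<Phi> {v})(p := s))"

definition edges_at :: "'d::finite relu_net \<Rightarrow> real^'d \<Rightarrow> (real^'d) set \<Rightarrow> (real^'d) set set" where
  "edges_at \<Phi> v C = {E. \<exists>p\<in>directions \<Phi> v. \<exists>s\<in>{-1, 1}. E = edge \<Phi> v p s \<and> E \<subseteq> C}"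

definition oriented_toward :: "'d::finite relu_net \<Rightarrow> (real^'d) set \<Rightarrow> real^'d \<Rightarrow> bool" where
  "oriented_toward \<Phi> E v \<longleftrightarrow> (\<forall>x\<in>E - {v}. net_fun \<Phi> x < net_fun \<Phi> v)"

definition oriented_away :: "'d::finite relu_net \<Rightarrow> (real^'d) set \<Rightarrow> real^'d \<Rightarrow> bool" where
  "oriented_away \<Phi> E v \<longleftrightarrow> (\<forall>x\<in>E - {v}. net_fun \<Phi> v < net_fun \<Phi> x)"

definition pl_critical :: "'d::finite relu_net \<Rightarrow> real^'d \<Rightarrow> bool" where
  "pl_critical \<Phi> v \<longleftrightarrow> (\<forall>p\<in>directions \<Phi> v.
     oriented_toward \<Phi> (edge \<Phi> v p 1) v \<and> oriented_toward \<Phi> (edge \<Phi> v p (-1)) v \<or>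
     oriented_away \<Phi> (edge \<Phi> v p 1) v \<and> oriented_away \<Phi> (edge \<Phi> v p (-1)) v)"

definition lower_star :: "'d::finite relu_net \<Rightarrow> real^'d \<Rightarrow> (real^'d) set set" where
  "lower_star \<Phi> v = {C \<in> cells \<Phi>. v \<in> C \<and> (\<forall>x\<in>C. net_fun \<Phi> x \<le> net_fun \<Phi> v)}"

text \<open>
  A regular CW complex, or a part of one, is represented by the set \<open>K\<close> of its closed cells
  and their dimensions; the face relation is inclusion of closed cells.
\<close>

definition discrete_vector_field ::
    "'a set set \<Rightarrow> ('a set \<Rightarrow> int) \<Rightarrow> ('a set \<times> 'a set) set \<Rightarrow> bool" where
  "discrete_vector_field K d V \<longleftrightarrow>
     V \<subseteq> K \<times> K \<and>
     (\<forall>(C, D)\<in>V. C \<subset> D \<and> d C = d D - 1) \<and>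
     (\<forall>P\<in>V. \<forall>Q\<in>V. P \<noteq> Q \<longrightarrow> {fst P, snd P} \<inter> {fst Q, snd Q} = {})"

definition V_path ::
    "('a set \<times> 'a set) set \<Rightarrow> nat \<Rightarrow> (nat \<Rightarrow> 'a set) \<Rightarrow> (nat \<Rightarrow> 'a set) \<Rightarrow> bool" where
  "V_path V r C D \<longleftrightarrow> (\<forall>i\<le>r. (C i, D i) \<in> V) \<and>
     (\<forall>i<r. C (Suc i) \<subset> D i \<and> C (Suc i) \<noteq> C i)"

definition acyclic_field :: "('a set \<times> 'a set) set \<Rightarrow> bool" where
  "acyclic_field V \<longleftrightarrow> \<not> (\<exists>r C D. 0 < r \<and> V_path V r C D \<and> C r = C 0)"

definition discrete_gradient_field ::
    "'a set set \<Rightarrow> ('a set \<Rightarrow> int) \<Rightarrow> ('a set \<times> 'a set) set \<Rightarrow> bool" where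
  "discrete_gradient_field K d V \<longleftrightarrow> discrete_vector_field K d V \<and> acyclic_field V"

definition paired :: "('a set \<times> 'a set) set \<Rightarrow> 'a set \<Rightarrow> bool" where
  "paired V C \<longleftrightarrow> (\<exists>P\<in>V. C = fst P \<or> C = snd P)"

definition critical_cells ::
    "'a set set \<Rightarrow> ('a set \<Rightarrow> int) \<Rightarrow> ('a set \<times> 'a set) set \<Rightarrow> nat \<Rightarrow> 'a set set" where
  "critical_cells K d V i = {C \<in> K. d C = int i \<and> \<not> paired V C}"

definition insert_pairs ::
    "'d::finite relu_net \<Rightarrow> real^'d \<Rightarrow> (real^'d) set \<Rightarrow> ((real^'d) set \<times> (real^'d) set) set" where
  "insert_pairs \<Phi> v e = {(C, D). C \<in> lower_star \<Phi> v \<and> D \<in> lower_star \<Phi> v \<and>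
     e \<notin> edges_at \<Phi> v C \<and> edges_at \<Phi> v D = insert e (edges_at \<Phi> v C)}"

definition regular_pairing ::
    "'d::finite relu_net \<Rightarrow> real^'d \<Rightarrow> ((real^'d) set \<times> (real^'d) set) set \<Rightarrow> bool" where
  "regular_pairing \<Phi> v W \<longleftrightarrow> (\<exists>p\<in>directions \<Phi> v. \<exists>s\<in>{-1, 1}.
     edge \<Phi> v p s \<in> lower_star \<Phi> v \<and> edge \<Phi> v p (- s) \<notin> lower_star \<Phi> v \<and>
     W = insert_pairs \<Phi> v (edge \<Phi> v p s))"

text \<open>
  The list enumerates directions, \<open>\<sigma>\<close> chooses in each direction \<open>p\<close> the edge
  \<open>edge \<Phi> v p (\<sigma> p)\<close>, and \<open>W\<close> collects the pairs formed so far.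
\<close>

primrec pair_along ::
    "'d::finite relu_net \<Rightarrow> real^'d \<Rightarrow> (nat \<times> 'd \<Rightarrow> real) \<Rightarrow> (nat \<times> 'd) list \<Rightarrow>
     ((real^'d) set \<times> (real^'d) set) set \<Rightarrow> ((real^'d) set \<times> (real^'d) set) set" where
  "pair_along \<Phi> v \<sigma> [] W = W"
| "pair_along \<Phi> v \<sigma> (p # ps) W = pair_along \<Phi> v \<sigma> ps
     (W \<union> {(C, D) \<in> insert_pairs \<Phi> v (edge \<Phi> v p (\<sigma> p)).
             edge \<Phi> v p (- \<sigma> p) \<notin> edges_at \<Phi> v C \<and> \<not> paired W C})"

definition critical_pairing ::
    "'d::finite relu_net \<Rightarrow> real^'d \<Rightarrow> ((real^'d) set \<times> (real^'d) set) set \<Rightarrow> bool" where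
  "critical_pairing \<Phi> v W \<longleftrightarrow> (\<exists>ps \<sigma>. distinct ps \<and>
     set ps = {p \<in> directions \<Phi> v.
       edge \<Phi> v p 1 \<in> lower_star \<Phi> v \<and> edge \<Phi> v p (-1) \<in> lower_star \<Phi> v} \<and>
     (\<forall>p. \<sigma> p \<in> {-1, 1}) \<and> W = pair_along \<Phi> v \<sigma> ps {})"

definition local_pairing ::
    "'d::finite relu_net \<Rightarrow> real^'d \<Rightarrow> ((real^'d) set \<times> (real^'d) set) set \<Rightarrow> bool" where
  "local_pairing \<Phi> v W \<longleftrightarrow>
     (if pl_critical \<Phi> v then critical_pairing \<Phi> v W else regular_pairing \<Phi> v W)"

definition lower_cells :: "'d::finite relu_net \<Rightarrow> (real^'d) set set" where
  "lower_cells \<Phi> = {C \<in> cells \<Phi>. bdd_above (net_fun \<Phi> ` C)}"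

text \<open>The point at infinity is \<open>None\<close>.\<close>

definition compactification :: "'d::finite relu_net \<Rightarrow> (real^'d) option topology" where
  "compactification \<Phi> = Alexandroff_compactification (top_of_set (\<Union>(lower_cells \<Phi>)))"

definition compact_cell :: "(real^'d::finite) set \<Rightarrow> (real^'d) option set" where
  "compact_cell C = (if bounded C then Some ` C else insert None (Some ` C))"

definition compact_cells :: "'d::finite relu_net \<Rightarrow> (real^'d) option set set" where
  "compact_cells \<Phi> = insert {None} (compact_cell ` lower_cells \<Phi>)"

definition compact_dim :: "(real^'d::finite) option set \<Rightarrow> int" where
  "compact_dim X = (if X = {None} then 0 else aff_dim (Some -` X))"

definition compact_fun :: "'d::finite relu_net \<Rightarrow> (real^'d) option \<Rightarrow> ereal" where
  "compact_fun \<Phi> z = (case z of None \<Rightarrow> - \<infinity> | Some x \<Rightarrow> ereal (net_fun \<Phi> x))"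

text \<open>
  The homology groups of the library have integer coefficients, hence the rank is that of
  an abelian group; it takes values in \<open>enat\<close> so that finiteness is not presupposed.
\<close>

definition int_independent :: "('a, 'b) monoid_scheme \<Rightarrow> 'a set \<Rightarrow> bool" where
  "int_independent G B \<longleftrightarrow> B \<subseteq> carrier G \<and>
     (\<forall>c :: 'a \<Rightarrow> int. finprod G (\<lambda>b. b [^]\<^bsub>G\<^esub> c b) B = \<one>\<^bsub>G\<^esub> \<longrightarrow> (\<forall>b\<in>B. c b = 0))"

definition group_rank :: "('a, 'b) monoid_scheme \<Rightarrow> enat" where
  "group_rank G = (SUP B\<in>{B. finite B \<and> int_independent G B}. enat (card B))"

definition levels :: "'d::finite relu_net \<Rightarrow> ereal set" where
  "levels \<Phi> = {compact_fun \<Phi> z | z. {z} \<in> compact_cells \<Phi>}"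

definition sublevel :: "'d::finite relu_net \<Rightarrow> ereal \<Rightarrow> (real^'d) option set set" where
  "sublevel \<Phi> l = {X \<in> compact_cells \<Phi>. \<forall>z\<in>X. compact_fun \<Phi> z \<le> l}"

definition previous_sublevel :: "'d::finite relu_net \<Rightarrow> ereal \<Rightarrow> (real^'d) option set set" where
  "previous_sublevel \<Phi> l =
     (if \<exists>l'\<in>levels \<Phi>. l' < l then sublevel \<Phi> (Max {l' \<in> levels \<Phi>. l' < l}) else {})"

definition relatively_perfect ::
    "'d::finite relu_net \<Rightarrow> ((real^'d) option set \<times> (real^'d) option set) set \<Rightarrow> bool" where
  "relatively_perfect \<Phi> V \<longleftrightarrow> (\<forall>l\<in>levels \<Phi>. \<forall>i.
     enat (card (critical_cells (compact_cells \<Phi>) compact_dim V i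
                   \<inter> (sublevel \<Phi> l - previous_sublevel \<Phi> l))) =
     group_rank (relative_homology_group (int i)
       (subtopology (compactification \<Phi>) (\<Union>(sublevel \<Phi> l)))
       (\<Union>(previous_sublevel \<Phi> l))))"

end

theory Submission
  imports Defs
begin

text \<open>
  Near a vertex \<open>v\<close> the only nonlinearities of the network are the neurons that vanish at \<open>v\<close>.
  By genericity and supertransversality their pre-activations are local coordinates: they are a
  triangular piecewise linear change of coordinates away from independent affine functions.  In
  these coordinates the cells at \<open>v\<close> are the faces of the coordinate orthants, and \<open>F\<close> is a sum of
  functions of one coordinate each, so that a cell at \<open>v\<close> is descending iff all its edges are.

  Passing a level \<open>F v\<close> adds exactly the lower star of \<open>v\<close>, because by flatness \<open>F\<close> has a unique
  maximum, at a vertex, on every cell of the complex.  Pushing points of the lower star radially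
  away from \<open>v\<close>, to infinity if necessary, retracts the punctured sublevel complex onto the
  previous one; excision then identifies the relative homology with the local homology at the apex
  of a product of lines, half-lines and points.  This vanishes if a half-line occurs, and otherwise
  is that of a disc relative to its boundary sphere; the local pairings leave unpaired no cell or
  exactly one cell of the same dimension.  Since the maximum of \<open>F\<close> does not
  increase along gradient paths, a closed path would lie in a single lower star.
\<close>

section \<open>Homology of pairs and ranks\<close>

text \<open>The obstacle is infinity. A descending ray in an unbounded cell of the lower star need
  not meet the previous sublevel complex in a finite point, so the radial push must send it to
  \<open>None\<close> and must stay continuous there. Everything is therefore transported into
  Euclidean space by an explicit embedding, in which scaling about the vertex becomes a rational map
  that extends to rays without exit.

  The exit time of a ray is read off the neurons that do not vanish at the vertex \<open>v\<close>.
  Along the ray their pre-activations are affine once the activation pattern is frozen, and the cell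
  of a point of the star contains \<open>v\<close> exactly as long as none of them vanishes. So the
  exit is the first zero of finitely many affine functions.

  Homology is compared directly with the germ of the sublevel set at \<open>v\<close>, without a
  cellular chain complex. There the signs of the vanishing neurons describe both the combinatorics
  of the pairings and the shape of the cone. Genericity makes the functionals within one layer
  independent; supertransversality makes them independent of those of the earlier layers.\<close>

lemma punctured_pair_homology:
  fixes X A N :: "'a::euclidean_space set"
  assumes "A \<subseteq> X" "p \<in> X" "p \<notin> A"
    and r: "continuous_map (top_of_set (X - {p})) (top_of_set A) r"
    and hom: "homotopic_with (\<lambda>k. k ` A \<subseteq> A) (top_of_set (X - {p})) (top_of_set (X - {p})) r id"
    and N: "N \<subseteq> X" "openin (top_of_set X) U" "p \<in> U" "U \<subseteq> N"
  shows "relative_homology_group n (top_of_set X) A \<cong> relative_homology_group n (top_of_set N) (N - {p})"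
proof -
  let ?X = "top_of_set X"
  let ?S = "X - {p}"
  have AS: "A \<subseteq> ?S" using assms by auto
  have sub: "subtopology ?X ?S = top_of_set ?S"
    by (simp add: subtopology_subtopology inf.absorb2)
  \<comment> \<open>The homotopy from \<open>r\<close> to the identity runs through maps preserving
    \<open>A\<close>, so the punctured space has no homology relative to \<open>A\<close>.\<close>
  have triv: "trivial_group (relative_homology_group i (subtopology ?X ?S) A)" for i
  proof (rule trivial_relative_homology_group_alt)
    show "continuous_map (subtopology ?X ?S) (subtopology (subtopology ?X ?S) A) r"
      using r AS by (simp add: subtopology_subtopology inf.absorb2 sub)
    show "homotopic_with (\<lambda>k. k ` A \<subseteq> A) (subtopology ?X ?S) (subtopology ?X ?S) r id"
      using hom by (simp add: sub)
  qed
  \<comment> \<open>Exactness for the triple \<open>A\<close>, \<open>?S\<close>, \<open>X\<close>: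
    both outer terms vanish by \<open>triv\<close>.\<close>
  have "hom_induced n ?X A ?X ?S id \<in> iso (relative_homology_group n ?X A) (relative_homology_group n ?X ?S)"
  proof (rule very_short_exact_sequence)
    show "exact_seq
         ([relative_homology_group(n - 1) (subtopology ?X ?S) A, relative_homology_group n ?X ?S, relative_homology_group n ?X A, relative_homology_group n (subtopology ?X ?S) A],
          [hom_relboundary n ?X ?S A, hom_induced n ?X A ?X ?S id, hom_induced n (subtopology ?X ?S) A ?X A id])"
      using homology_exactness_triple_1 [OF AS] homology_exactness_triple_3 [OF AS]
      by fastforce
  qed (rule triv)+
  then have 1: "relative_homology_group n ?X A \<cong> relative_homology_group n ?X ?S"
    by (rule is_isoI)
  have pN: "p \<in> N" using N by auto
  \<comment> \<open>This is the hypothesis of excision for removing \<open>X - N\<close>, which is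
    contained in the relatively closed set \<open>X - U\<close> and hence stays away from
    \<open>p\<close>.\<close>
  have "?X closure_of (X - N) \<subseteq> ?X interior_of ?S"
  proof -
    have "closedin ?X (X - U)" using N(2) by (simp add: closedin_diff)
    then have "?X closure_of (X - N) \<subseteq> X - U"
      using \<open>U \<subseteq> N\<close> by (intro closure_of_minimal) auto
    moreover have "openin ?X ?S"
      by (simp add: openin_delete t1_space_subtopology)
    then have "?X interior_of ?S = ?S" by (simp add: interior_of_openin)
    ultimately show ?thesis using \<open>p \<in> U\<close> by auto
  qed
  then have "hom_induced n (subtopology ?X (X - (X - N))) (?S - (X - N)) (subtopology ?X X) ?S id
    \<in> iso (relative_homology_group n (subtopology ?X (X - (X - N))) (?S - (X - N)))
          (relative_homology_group n (subtopology ?X X) ?S)"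
    by (intro homology_excision_axiom) auto
  moreover have "X - (X - N) = N" "?S - (X - N) = N - {p}" using N pN by auto
  moreover have "subtopology ?X N = top_of_set N" using N by (simp add: subtopology_subtopology inf.absorb2)
  moreover have "subtopology ?X X = top_of_set X" by (simp add: subtopology_subtopology)
  ultimately have "relative_homology_group n (top_of_set N) (N - {p}) \<cong> relative_homology_group n ?X ?S"
    by (simp add: is_isoI)
  then have "relative_homology_group n ?X ?S \<cong> relative_homology_group n (top_of_set N) (N - {p})"
    by (simp add: group.iso_sym)
  with 1 show ?thesis by (rule iso_trans)
qed

lemma relative_homology_homeomorphism:
  assumes "homeomorphism S T f g" "x \<in> S"
  shows "relative_homology_group n (top_of_set S) (S - {x}) \<cong> relative_homology_group n (top_of_set T) (T - {f x})"
proof -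
  have "homeomorphic_map (top_of_set S) (top_of_set T) f"
    using assms(1) homeomorphic_map_maps homeomorphic_maps_iff_homeomorphism by blast
  moreover have "f ` (S - {x}) = T - {f x}"
    using assms unfolding homeomorphism_def by (auto, metis)
  ultimately show ?thesis
    by (intro is_isoI[OF homeomorphic_map_relative_homology_iso]) auto
qed

text \<open>Convex and starlike sets are contractible, so both members of the pair have the homology
  of a point. This serves the regular vertices, where the cone has a half-line factor.\<close>

lemma trivial_homology_starlike_complement:
  fixes S :: "'a::real_normed_vector set"
  assumes "convex S" "starlike (S - {x})"
  shows "trivial_group (relative_homology_group n (top_of_set S) (S - {x}))"
proof -
  have "S - {x} \<noteq> {}" using assms(2) by (auto simp: starlike_def)
  then show ?thesis
    using assms by (intro trivial_relative_homology_group_contractible_spaces)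
      (auto simp: subtopology_subtopology inf.absorb2 convex_imp_contractible starlike_imp_contractible)
qed

text \<open>The disc is contractible, so its relative homology is the reduced homology of the
  punctured disc one degree lower, and the punctured disc is homotopy equivalent to the unit sphere
  of \<open>T\<close>. Dimension 0 is treated apart: there the complement is empty and the pair is a
  point.\<close>

lemma homology_punctured_disc:
  fixes T :: "'a::euclidean_space set"
  assumes T: "subspace T" and "0 < d"
  defines "N \<equiv> T \<inter> cball 0 d"
  shows "if n = int (dim T) then relative_homology_group n (top_of_set N) (N - {0}) \<cong> integer_group
         else trivial_group (relative_homology_group n (top_of_set N) (N - {0}))"
proof (cases "dim T = 0")
  case True
  then have "T = {0}" using T subspace_0 by (auto simp: dim_eq_0)
  then have N: "N = {0}" using \<open>0 < d\<close> by (auto simp: N_def)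
  then have "topspace (top_of_set N) = {0}" by simp
  then have "homology_group 0 (top_of_set N) \<cong> integer_group"
    "n \<noteq> 0 \<Longrightarrow> trivial_group (homology_group n (top_of_set N))"
    by (blast intro: homology_coefficients homology_dimension_axiom)+
  moreover have 0: "int (dim T) = 0" "N - {0} = {}" using True N by simp_all
  ultimately show ?thesis unfolding 0 by simp
next
  case False
  obtain B where B: "B \<subseteq> T" "independent B" "span B = T" "card B = dim T"
           and orth: "pairwise orthogonal B" and 1: "\<And>x. x \<in> B \<Longrightarrow> norm x = 1"
    using orthonormal_basis_subspace[OF T] by (smt (verit))
  obtain f g where fg: "homeomorphic_maps (nsphere (dim T - 1)) (top_of_set (sphere 0 1 \<inter> T)) f g"
    using homeomorphic_maps_nsphere_euclidean_sphere[OF B(2) orth B(4) False 1] B(3) by metis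
  let ?P = "N - {0}" and ?S = "sphere 0 1 \<inter> T"
  have "?P homotopy_eqv ?S"
    unfolding homotopy_equivalent_space_def
  proof (intro exI conjI)
    show "continuous_map (top_of_set ?P) (top_of_set ?S) (\<lambda>x. x /\<^sub>R norm x)"
      using T by (auto simp: N_def subspace_mul intro!: continuous_intros)
    show "continuous_map (top_of_set ?S) (top_of_set ?P) (\<lambda>x. d *\<^sub>R x)"
      using T \<open>0 < d\<close> by (auto simp: N_def subspace_mul intro!: continuous_intros)
    have "homotopic_with_canon (\<lambda>x. True) ?P ?P ((\<lambda>x. d *\<^sub>R x) \<circ> (\<lambda>x. x /\<^sub>R norm x)) id"
    proof (rule homotopic_with_linear)
      show "continuous_on ?P ((\<lambda>x. d *\<^sub>R x) \<circ> (\<lambda>x. x /\<^sub>R norm x))"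
        by (auto simp: o_def intro!: continuous_intros)
      fix x assume x: "x \<in> ?P"
      \<comment> \<open>The linear homotopy multiplies each point by a positive factor that keeps
        the norm at most \<open>d\<close>, so it moves within a ray and never reaches 0.\<close>
      have *: "((1 - t) * (d / norm x) + t) *\<^sub>R x \<in> ?P" if "t \<in> {0..1}" for t
      proof -
        have x': "0 < norm x" "norm x \<le> d" "x \<in> T" using x by (auto simp: N_def)
        have eq: "((1 - t) * (d / norm x) + t) * norm x = (1 - t) * d + t * norm x"
          using x' by (simp add: field_simps)
        also have "\<dots> \<le> (1 - t) * d + t * d"
          using x' that by (intro add_mono mult_left_mono) auto
        finally have le: "((1 - t) * (d / norm x) + t) * norm x \<le> d" by (simp add: algebra_simps)
        have "0 \<le> (1 - t) * d" "0 \<le> t * norm x" using that \<open>0 < d\<close> by auto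
        moreover have "0 < (1 - t) * d \<or> 0 < t * norm x"
        proof (cases "t = 1")
          case False
          then have "0 < 1 - t" using that by auto
          then show ?thesis using \<open>0 < d\<close> by simp
        qed (use x' in simp)
        ultimately have pos: "0 < ((1 - t) * (d / norm x) + t) * norm x" using eq by linarith
        then have "0 < (1 - t) * (d / norm x) + t" using x' zero_less_mult_pos2 by blast
        with le x' T show ?thesis by (auto simp: N_def subspace_mul)
      qed
      have "(1 - t) *\<^sub>R ((\<lambda>x. d *\<^sub>R x) \<circ> (\<lambda>x. x /\<^sub>R norm x)) x + t *\<^sub>R id x
            = ((1 - t) * (d / norm x) + t) *\<^sub>R x" for t
        by (simp add: algebra_simps divide_inverse)
      with * show "closed_segment (((\<lambda>x. d *\<^sub>R x) \<circ> (\<lambda>x. x /\<^sub>R norm x)) x) (id x) \<subseteq> ?P"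
        unfolding closed_segment_def by auto
    qed auto
    then show "homotopic_with (\<lambda>x. True) (top_of_set ?P) (top_of_set ?P) ((\<lambda>x. d *\<^sub>R x) \<circ> (\<lambda>x. x /\<^sub>R norm x)) id" .
    show "homotopic_with (\<lambda>x. True) (top_of_set ?S) (top_of_set ?S) ((\<lambda>x. x /\<^sub>R norm x) \<circ> (\<lambda>x. d *\<^sub>R x)) id"
      using \<open>0 < d\<close> by (intro homotopic_with_equal) (auto intro!: continuous_intros)
  qed
  moreover have "top_of_set ?S homeomorphic_space nsphere (dim T - 1)"
    using fg homeomorphic_maps_sym unfolding homeomorphic_space_def by blast
  ultimately have "top_of_set ?P homotopy_equivalent_space nsphere (dim T - 1)"
    using homeomorphic_imp_homotopy_equivalent_space homotopy_eqv_trans by blast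
  then have iso1: "reduced_homology_group i (top_of_set ?P) \<cong> reduced_homology_group i (nsphere (dim T - 1))" for i
    by (rule homotopy_equivalent_space_imp_isomorphic_reduced_homology_groups)
  have "B \<noteq> {}" using B(4) False by auto
  then obtain b where "b \<in> T" "norm b = 1" using B 1 by blast
  then have "d *\<^sub>R b \<in> ?P" using T \<open>0 < d\<close> by (auto simp: N_def subspace_mul)
  moreover have "convex N" by (simp add: N_def convex_Int subspace_imp_convex T)
  ultimately have "relative_homology_group n (top_of_set N) ?P
      \<cong> reduced_homology_group (n - 1) (subtopology (top_of_set N) ?P)"
    by (intro isomorphic_group_relative_homology_of_contractible) (auto simp: convex_imp_contractible)
  then have "relative_homology_group n (top_of_set N) ?P \<cong> reduced_homology_group (n - 1) (top_of_set ?P)"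
    by (simp add: subtopology_subtopology inf.absorb2)
  with iso1 have iso: "relative_homology_group n (top_of_set N) ?P \<cong> reduced_homology_group (n - 1) (nsphere (dim T - 1))"
    by (blast intro: iso_trans)
  \<comment> \<open>As \<open>dim T\<close> is positive, the truncated subtraction is exact and the
    shift of degree matches the dimension of the sphere.\<close>
  have eq: "n - 1 = int (dim T - 1) \<longleftrightarrow> n = int (dim T)" using False by linarith
  show ?thesis
  proof (cases "n = int (dim T)")
    case True
    then show ?thesis using iso eq reduced_homology_group_nsphere(1) iso_trans by metis
  next
    case neq: False
    then have "trivial_group (reduced_homology_group (n - 1) (nsphere (dim T - 1)))"
      using eq reduced_homology_group_nsphere(2) by blast
    with neq iso show ?thesis
      by (simp add: isomorphic_group_triviality)
  qed
qed

section \<open>Ranks of the trivial group and of the integers\<close>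

lemma group_rank_trivial:
  assumes "comm_group G" "trivial_group G"
  shows "group_rank G = 0"
proof -
  interpret comm_group G by fact
  have "B = {}" if "int_independent G B" for B
  proof (rule ccontr)
    assume "B \<noteq> {}"
    moreover have "B \<subseteq> {\<one>\<^bsub>G\<^esub>}"
      using that assms(2) by (auto simp: int_independent_def trivial_group_def)
    ultimately have "B = {\<one>\<^bsub>G\<^esub>}" by auto
    \<comment> \<open>Exponent 1 on the identity is a nontrivial relation, so the identity cannot be
      a member of an independent family.\<close>
    then have "finprod G (\<lambda>b. b [^]\<^bsub>G\<^esub> (1::int)) B = \<one>\<^bsub>G\<^esub>"
      by simp
    then have "\<forall>b\<in>B. (1::int) = 0" 
      using that[unfolded int_independent_def, THEN conjunct2, THEN spec[of _ "\<lambda>_. 1"]] by blast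
    with \<open>B \<noteq> {}\<close> show False by auto
  qed
  then have "group_rank G \<le> 0"
    unfolding group_rank_def by (intro SUP_least) (auto simp: zero_enat_def)
  then show ?thesis by simp
qed

text \<open>Two elements \<open>b\<close> and \<open>b'\<close> satisfy the relation with exponents
  \<open>h b'\<close> and \<open>- h b\<close>. If both exponents vanish, injectivity of
  \<open>h\<close> forces \<open>b = b'\<close>. A preimage of 1 is independent by itself.\<close>

lemma group_rank_integer:
  assumes "comm_group G" "G \<cong> integer_group"
  shows "group_rank G = 1"
proof -
  interpret comm_group G by fact
  obtain h where h: "h \<in> iso G integer_group" using assms(2) by (auto simp: is_iso_def)
  then have hom: "h \<in> hom G integer_group" and inj: "inj_on h (carrier G)" and surj: "h ` carrier G = UNIV"
    by (auto simp: iso_def bij_betw_def)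
  have pow: "h (b [^]\<^bsub>G\<^esub> (k::int)) = k * h b" if "b \<in> carrier G" for b k
    using hom_int_pow[OF hom that is_group group_integer_group, of k] by simp
  have one: "h \<one>\<^bsub>G\<^esub> = 0" using hom_one[OF hom is_group group_integer_group] by simp
  have le: "card B \<le> 1" if B: "finite B" "int_independent G B" for B
  proof (rule ccontr)
    assume "\<not> card B \<le> 1"
    then obtain b b' where bb: "b \<in> B" "b' \<in> B" "b \<noteq> b'"
      using card_le_Suc0_iff_eq[OF B(1)] by auto
    have BG: "B \<subseteq> carrier G" using B by (simp add: int_independent_def)
    define c where "c = (\<lambda>x. if x = b then h b' else if x = b' then - h b else 0)"
    have "finprod G (\<lambda>x. x [^]\<^bsub>G\<^esub> c x) B = finprod G (\<lambda>x. x [^]\<^bsub>G\<^esub> c x) {b, b'}"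
      using B(1) bb BG by (intro finprod_mono_neutral_cong_left[symmetric]) (auto simp: c_def)
    also have "\<dots> = b [^]\<^bsub>G\<^esub> h b' \<otimes>\<^bsub>G\<^esub> b' [^]\<^bsub>G\<^esub> (- h b)"
      using bb BG by (subst finprod_insert) (auto simp: c_def)
    finally have eq: "finprod G (\<lambda>x. x [^]\<^bsub>G\<^esub> c x) B = b [^]\<^bsub>G\<^esub> h b' \<otimes>\<^bsub>G\<^esub> b' [^]\<^bsub>G\<^esub> (- h b)" .
    have bG: "b \<in> carrier G" "b' \<in> carrier G" using bb BG by auto
    have "h (b [^]\<^bsub>G\<^esub> h b' \<otimes>\<^bsub>G\<^esub> b' [^]\<^bsub>G\<^esub> (- h b)) = h b' * h b + (- h b) * h b'"
      using hom_mult[OF hom int_pow_closed[OF bG(1)] int_pow_closed[OF bG(2)]] pow bG by simp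
    then have "h (finprod G (\<lambda>x. x [^]\<^bsub>G\<^esub> c x) B) = h \<one>\<^bsub>G\<^esub>"
      using eq one by simp
    then have "finprod G (\<lambda>x. x [^]\<^bsub>G\<^esub> c x) B = \<one>\<^bsub>G\<^esub>"
      using inj eq bG by (simp add: inj_on_def)
    then have "\<forall>x\<in>B. c x = 0" using B(2) unfolding int_independent_def by blast
    then have "c b = 0" "c b' = 0" using bb by auto
    then have "h b = h b'" using bb by (simp add: c_def)
    then show False using inj bG bb by (auto simp: inj_on_def)
  qed
  obtain g where g: "g \<in> carrier G" "h g = 1" using surj by (metis UNIV_I imageE)
  have "int_independent G {g}"
    unfolding int_independent_def
  proof (intro conjI allI impI)
    fix c :: "_ \<Rightarrow> int"
    assume "finprod G (\<lambda>b. b [^]\<^bsub>G\<^esub> c b) {g} = \<one>\<^bsub>G\<^esub>"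
    then have "g [^]\<^bsub>G\<^esub> c g = \<one>\<^bsub>G\<^esub>" using g by simp
    then show "\<forall>b\<in>{g}. c b = 0" using pow[OF g(1), of "c g"] one g by simp
  qed (use g in auto)
  then have "enat (card {g}) \<le> group_rank G"
    unfolding group_rank_def by (intro SUP_upper) auto
  moreover have "group_rank G \<le> 1"
    unfolding group_rank_def using le by (intro SUP_least) (auto simp: one_enat_def)
  ultimately show ?thesis by (simp add: one_enat_def)
qed

section \<open>The one-point compactification\<close>

text \<open>
  The one-point compactification embeds into Euclidean space by inverse stereographic
  projection centred at \<open>v\<close>; the point at infinity becomes the origin.
\<close>

definition sphere_embedding :: "'a::euclidean_space \<Rightarrow> 'a option \<Rightarrow> 'a \<times> real" where
  "sphere_embedding v z = (case z of None \<Rightarrow> (0, 0)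
     | Some x \<Rightarrow> ((x - v) /\<^sub>R (1 + (norm (x - v))\<^sup>2), 1 / (1 + (norm (x - v))\<^sup>2)))"

lemma one_plus_norm_sq_pos: "0 < 1 + (norm (x::'a::real_normed_vector))\<^sup>2"
  by (simp add: add_pos_nonneg)

lemma sphere_embedding_None [simp]: "sphere_embedding v None = (0, 0)"
  by (simp add: sphere_embedding_def)

lemma sphere_embedding_v [simp]: "sphere_embedding v (Some v) = (0, 1)"
  by (simp add: sphere_embedding_def)

lemma sphere_embedding_Some_pos: "0 < snd (sphere_embedding v (Some x))"
  using one_plus_norm_sq_pos[of "x - v"] by (simp add: sphere_embedding_def)

lemma sphere_embedding_inverse:
  "v + fst (sphere_embedding v (Some x)) /\<^sub>R snd (sphere_embedding v (Some x)) = x"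
  using one_plus_norm_sq_pos[of "x - v"] by (simp add: sphere_embedding_def)

lemma inj_sphere_embedding: "inj (sphere_embedding v)"
proof (rule injI)
  fix y z assume eq: "sphere_embedding v y = sphere_embedding v z"
  then have s: "snd (sphere_embedding v y) = snd (sphere_embedding v z)" by simp
  have none: "x = None" if "snd (sphere_embedding v x) = 0" for x
    using that sphere_embedding_Some_pos[of v] by (cases x) (simp, metis less_irrefl)
  show "y = z"
  proof (cases y)
    case None
    then show ?thesis using none[of z] s by simp
  next
    case (Some a)
    then obtain b where b: "z = Some b" using s sphere_embedding_Some_pos[of v a] by (cases z) auto
    have "a = v + fst (sphere_embedding v (Some a)) /\<^sub>R snd (sphere_embedding v (Some a))"
      by (rule sphere_embedding_inverse[symmetric])
    also have "\<dots> = b" unfolding eq[unfolded Some b] by (rule sphere_embedding_inverse)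
    finally show ?thesis using Some b by (simp only:)
  qed
qed

lemma sphere_embedding_1_iff: "snd (sphere_embedding v z) = 1 \<longleftrightarrow> z = Some v"
proof (cases z)
  case (Some x)
  then show ?thesis using one_plus_norm_sq_pos[of "x - v"] by (auto simp: sphere_embedding_def field_simps)
qed simp

lemma sphere_embedding_snd_le: "snd (sphere_embedding v z) \<in> {0..1}"
proof (cases z)
  case (Some x)
  then show ?thesis using one_plus_norm_sq_pos[of "x - v"] by (auto simp: sphere_embedding_def field_simps)
qed simp

text \<open>The image lies on the sphere of radius 1/2 about \<open>(0, 1/2)\<close>, so the second
  coordinate alone measures the distance to the image of infinity.\<close>

lemma norm_sphere_embedding: "(norm (sphere_embedding v z))\<^sup>2 = snd (sphere_embedding v z)"
proof (cases z)
  case (Some x)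
  let ?r = "1 + (norm (x - v))\<^sup>2"
  have r: "0 < ?r" by (rule one_plus_norm_sq_pos)
  have "(norm (sphere_embedding v z))\<^sup>2 = (norm ((x - v) /\<^sub>R ?r))\<^sup>2 + (norm (1 / ?r))\<^sup>2"
    unfolding Some sphere_embedding_def by (simp add: norm_prod_def)
  also have "\<dots> = ((norm (x - v))\<^sup>2 + 1) / ?r\<^sup>2"
    using r by (simp add: power_divide divide_inverse power_mult_distrib power_inverse distrib_right)
  also have "\<dots> = 1 / ?r" using r by (simp add: power2_eq_square add.commute)
  finally show ?thesis unfolding Some sphere_embedding_def by simp
qed simp

lemma continuous_sphere_embedding_Some: "continuous_on S (\<lambda>x. sphere_embedding v (Some x))"
proof -
  have "continuous_on S (\<lambda>x. ((x - v) /\<^sub>R (1 + (norm (x - v))\<^sup>2), 1 / (1 + (norm (x - v))\<^sup>2)))"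
    by (intro continuous_intros) (use one_plus_norm_sq_pos in \<open>force simp: less_le\<close>)+
  then show ?thesis by (simp add: sphere_embedding_def)
qed

lemma continuous_map_sphere_embedding:
  assumes "closed Y"
  shows "continuous_map (Alexandroff_compactification (top_of_set Y)) euclidean (sphere_embedding v)"
  unfolding continuous_map_def
proof (intro conjI allI impI)
  let ?f = "sphere_embedding v" and ?X = "Alexandroff_compactification (top_of_set Y)"
  fix U :: "('a \<times> real) set" assume "openin euclidean U"
  then have U: "open U" by simp
  have cont: "continuous_on Y (\<lambda>x. ?f (Some x))" by (rule continuous_sphere_embedding_Some)
  show "openin ?X {x \<in> topspace ?X. ?f x \<in> U}"
  proof (cases "(0, 0) \<in> U")
    case False
    have "{x \<in> topspace ?X. ?f x \<in> U} = Some ` {x \<in> Y. ?f (Some x) \<in> U}"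
      using False by (auto simp: image_iff)
    moreover have "openin (top_of_set Y) {x \<in> Y. ?f (Some x) \<in> U}"
      using continuous_openin_preimage_gen[OF cont U] by (simp add: vimage_def Int_def)
    ultimately show ?thesis by simp
  next
    case True
    \<comment> \<open>The points sent outside \<open>U\<close>. Distance at least \<open>e\<close>
      from the origin bounds \<open>norm (x - v)\<close> by \<open>1 / e\<close>, so the set is
      compact and its complement is a neighbourhood of infinity.\<close>
    define C where "C = {x \<in> Y. ?f (Some x) \<in> - U}"
    obtain e where e: "0 < e" "ball (0, 0) e \<subseteq> U" using U True openE by blast
    have "closed C"
      using continuous_closed_preimage[OF cont assms, of "- U"] U by (simp add: C_def vimage_def Int_def closed_Compl)
    moreover have "norm (x - v) \<le> 1 / e" if "x \<in> C" for x
    proof -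
      have "?f (Some x) \<notin> ball (0, 0) e" using that e by (auto simp: C_def)
      then have "e \<le> norm (?f (Some x))" by (simp add: dist_norm norm_minus_commute flip: zero_prod_def)
      then have "e\<^sup>2 \<le> 1 / (1 + (norm (x - v))\<^sup>2)"
        using norm_sphere_embedding[of v "Some x"] e(1) power_mono[of e "norm (?f (Some x))" 2]
        by (simp add: sphere_embedding_def)
      then have "e\<^sup>2 * (1 + (norm (x - v))\<^sup>2) \<le> 1"
        using one_plus_norm_sq_pos[of "x - v"] by (simp add: pos_le_divide_eq)
      then have "(e * norm (x - v))\<^sup>2 \<le> 1" using e(1) by (simp add: power_mult_distrib algebra_simps) (smt (verit) zero_le_power2)
      then have "e * norm (x - v) \<le> 1" using e(1) by (simp add: abs_square_le_1)
      then show ?thesis using e(1) by (simp add: pos_le_divide_eq mult.commute)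
    qed
    then have "bounded C"
      by (intro boundedI[of C "norm v + 1 / e"]) (smt (verit) norm_triangle_sub)
    ultimately have C: "compact C" by (simp add: compact_eq_bounded_closed)
    have CY: "C \<subseteq> Y" by (auto simp: C_def)
    have "compactin (top_of_set Y) C" "closedin (top_of_set Y) C"
      using C CY \<open>closed C\<close> by (auto simp: compactin_subtopology closed_subset)
    moreover have "{x \<in> topspace ?X. ?f x \<in> U} = insert None (Some ` (topspace (top_of_set Y) - C))"
      using True by (auto simp: C_def image_iff)
    ultimately show ?thesis unfolding openin_Alexandroff_compactification by blast
  qed
qed auto

text \<open>A closed set together with infinity is closed in the compactification of the whole
  space, hence compact, and so is its continuous image.\<close>

lemma closed_sphere_embedding_image:
  assumes "closed C"
  shows "closed (sphere_embedding v ` insert None (Some ` C))"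
proof -
  let ?X = "Alexandroff_compactification (top_of_set (UNIV :: 'a set))"
  have "insert None (Some ` C) = topspace ?X - Some ` (- C)" by (auto simp: image_iff split: option.splits)
  moreover have "openin (top_of_set UNIV) (- C)" using assms by (simp add: open_Compl)
  ultimately have "closedin ?X (insert None (Some ` C))" unfolding closedin_Alexandroff_compactification by blast
  then have "compactin ?X (insert None (Some ` C))" by (intro closedin_compact_space compact_space_Alexandroff_compactification)
  then have "compactin euclidean (sphere_embedding v ` insert None (Some ` C))"
    by (rule image_compactin[OF _ continuous_map_sphere_embedding[OF closed_UNIV]])
  then show ?thesis by (simp add: compact_imp_closed)
qed

text \<open>A continuous injection of a compact space into a Hausdorff space is an embedding; it is
  then restricted to \<open>S\<close>.\<close>

lemma homeomorphic_sphere_embedding: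
  assumes "closed Y" "S \<subseteq> insert None (Some ` Y)"
  shows "homeomorphic_map (subtopology (Alexandroff_compactification (top_of_set Y)) S)
     (top_of_set (sphere_embedding v ` S)) (sphere_embedding v)"
proof -
  let ?X = "Alexandroff_compactification (top_of_set Y)"
  have "embedding_map ?X euclidean (sphere_embedding v)"
    by (rule continuous_imp_embedding_map[OF continuous_map_sphere_embedding[OF assms(1)]])
      (simp, simp, rule inj_on_subset[OF inj_sphere_embedding subset_UNIV])
  then have "homeomorphic_map ?X (top_of_set (sphere_embedding v ` topspace ?X)) (sphere_embedding v)"
    unfolding embedding_map_def .
  then have "homeomorphic_map (subtopology ?X S) (subtopology (top_of_set (sphere_embedding v ` topspace ?X)) (sphere_embedding v ` S)) (sphere_embedding v)"
  proof (rule homeomorphic_map_subtopologies)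
    have S: "S \<subseteq> topspace ?X" using assms(2) by simp
    show "sphere_embedding v ` (topspace ?X \<inter> S)
        = topspace (top_of_set (sphere_embedding v ` topspace ?X)) \<inter> sphere_embedding v ` S"
      unfolding inf.absorb2[OF S] topspace_euclidean_subtopology inf.absorb2[OF image_mono[OF S]] ..
  qed
  moreover have "sphere_embedding v ` S \<subseteq> sphere_embedding v ` topspace ?X" using assms(2) by (intro image_mono) simp
  ultimately show ?thesis by (simp add: subtopology_subtopology inf.absorb2)
qed

text \<open>
  Under the embedding, scaling \<open>x - v\<close> by \<open>1 / d\<close> becomes the map below, which extends
  continuously to \<open>d = 0\<close> and to the point at infinity.
\<close>

definition radial_push :: "real \<Rightarrow> 'a::euclidean_space \<times> real \<Rightarrow> 'a \<times> real" where
  "radial_push d z = (d *\<^sub>R fst z /\<^sub>R (1 - snd z + snd z * d\<^sup>2), snd z * d\<^sup>2 / (1 - snd z + snd z * d\<^sup>2))"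

lemma radial_push_1 [simp]: "radial_push 1 z = z"
  by (simp add: radial_push_def)

lemma radial_push_origin [simp]: "radial_push d (0, 0) = (0, 0)"
  by (simp add: radial_push_def)

lemma radial_push_0 [simp]: "radial_push 0 z = (0, 0)"
  by (simp add: radial_push_def)

text \<open>With \<open>n\<close> the squared norm of \<open>x - v\<close>, the denominator in
  \<open>radial_push\<close> equals \<open>(n + d\<^sup>2) / (1 + n)\<close>. The factor
  \<open>1 + n\<close> cancels and leaves the embedding of the scaled vector. This is where the
  formula for the push comes from.\<close>

lemma radial_push_Some:
  assumes "d \<noteq> 0"
  shows "radial_push d (sphere_embedding v (Some x)) = sphere_embedding v (Some (v + (x - v) /\<^sub>R d))"
proof -
  define w where "w = x - v"
  define n where "n = (norm w)\<^sup>2"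
  have n: "0 < 1 + n" by (simp add: n_def one_plus_norm_sq_pos)
  have d: "0 < d\<^sup>2" using assms by simp
  have n0: "0 \<le> n" by (simp add: n_def)
  have D: "1 - 1 / (1 + n) + 1 / (1 + n) * d\<^sup>2 = (n + d\<^sup>2) / (1 + n)" 
    using n by (simp add: eq_divide_eq distrib_right left_diff_distrib)
  have N: "(norm (w /\<^sub>R d))\<^sup>2 = n / d\<^sup>2" using assms by (simp add: n_def power_mult_distrib power_inverse divide_inverse mult.commute)
  have M: "1 + n / d\<^sup>2 = (n + d\<^sup>2) / d\<^sup>2" using d by (simp add: field_simps)
  have nd: "n + d\<^sup>2 \<noteq> 0" using d n0 by linarith
  have cancel: "a * inverse k * inverse (e / k) = a * inverse e" "1 / k * b / (e / k) = 1 / (e / b)"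
    if "k \<noteq> 0" for a b k e :: real using that by (simp_all add: field_simps)
  have "inverse d * inverse (e / d\<^sup>2) = d * inverse e" for e
    using assms by (simp add: field_simps power2_eq_square)
  then have c: "d * inverse (1 + n) * inverse ((n + d\<^sup>2) / (1 + n)) = inverse d * inverse ((n + d\<^sup>2) / d\<^sup>2)"
    using cancel(1)[of "1 + n" d] n by simp
  have "radial_push d (sphere_embedding v (Some x)) =
     ((d * inverse (1 + n) * inverse ((n + d\<^sup>2) / (1 + n))) *\<^sub>R w, 1 / (1 + n) * d\<^sup>2 / ((n + d\<^sup>2) / (1 + n)))"
    unfolding radial_push_def sphere_embedding_def option.case fst_conv snd_conv w_def[symmetric] n_def[symmetric] D
    by (simp add: mult.commute mult.left_commute)
  also have "\<dots> = ((inverse d * inverse ((n + d\<^sup>2) / d\<^sup>2)) *\<^sub>R w, 1 / ((n + d\<^sup>2) / d\<^sup>2))"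
    unfolding c using cancel(2)[of "1 + n"] n by simp
  also have "\<dots> = sphere_embedding v (Some (v + (x - v) /\<^sub>R d))"
    unfolding sphere_embedding_def option.case w_def[symmetric] add_diff_cancel_left' N M
    by (simp add: mult.commute)
  finally show ?thesis .
qed

text \<open>Away from the origin the denominator is positive, because the second coordinate is below
  1. At the origin, the image of infinity, the factor \<open>d\<close> may have no limit, which is
  why its continuity is assumed only off that point. There the bound
  \<open>(norm a + b) / (1 - b)\<close> for the push of \<open>(a, b)\<close>, valid for every
  \<open>d\<close> between 0 and 1, forces the limit 0.\<close>

lemma continuous_radial_push:
  fixes S :: "(real \<times> 'a::euclidean_space \<times> real) set" and d :: "real \<times> 'a \<times> real \<Rightarrow> real"
  assumes "\<And>t z. (t, z) \<in> S \<Longrightarrow> snd z \<in> {0..<1}" "\<And>p. p \<in> S \<Longrightarrow> d p \<in> {0..1}"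
    and zero: "\<And>t z. (t, z) \<in> S \<Longrightarrow> snd z = 0 \<Longrightarrow> z = (0, 0)"
    and cont: "continuous_on {p \<in> S. 0 < snd (snd p)} d"
  shows "continuous_on S (\<lambda>p. radial_push (d p) (snd p))"
  unfolding continuous_on_eq_continuous_within
proof
  let ?G = "\<lambda>p. radial_push (d p) (snd p)"
  fix p assume p: "p \<in> S"
  obtain t z where tz: "p = (t, z)" by (cases p)
  show "continuous (at p within S) ?G"
  proof (cases "0 < snd z")
    case True
    let ?S = "{p \<in> S. 0 < snd (snd p)}"
    have "1 - snd (snd q) + snd (snd q) * (d q)\<^sup>2 \<noteq> 0" if "q \<in> ?S" for q
    proof -
      have "snd (snd q) < 1" "0 < snd (snd q)" using assms(1)[of "fst q" "snd q"] that by auto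
      then have "0 < 1 - snd (snd q) + snd (snd q) * (d q)\<^sup>2" by (intro add_pos_nonneg) auto
      then show ?thesis by simp
    qed
    then have "continuous_on ?S ?G"
      unfolding radial_push_def by (intro continuous_intros cont) auto
    then have "continuous (at p within ?S) ?G"
      using p True tz by (intro continuous_on_eq_continuous_within[THEN iffD1, THEN bspec]) auto
    moreover have "at p within S = at p within ?S"
    proof (rule at_within_nhd)
      show "open {q :: real \<times> 'a \<times> real. 0 < snd (snd q)}"
        by (intro open_Collect_less continuous_intros)
    qed (use p True tz in auto)
    ultimately show ?thesis by simp
  next
    case False
    have tzS: "(t, z) \<in> S" using p unfolding tz .
    have "snd z = 0" using assms(1)[OF tzS] False by simp
    then have z: "z = (0, 0)" by (rule zero[OF tzS])
    have "((\<lambda>q. (norm (fst (snd q)) + snd (snd q)) / (1 - snd (snd q))) \<longlongrightarrow>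
        (norm (fst (snd p)) + snd (snd p)) / (1 - snd (snd p))) (at p within S)"
      by (intro tendsto_intros) (auto simp: tz z)
    then have lim: "((\<lambda>q. (norm (fst (snd q)) + snd (snd q)) / (1 - snd (snd q))) \<longlongrightarrow> 0) (at p within S)"
      by (simp add: tz z)
    have "norm (?G q) \<le> (norm (fst (snd q)) + snd (snd q)) / (1 - snd (snd q))" if q: "q \<in> S" for q
    proof -
      let ?a = "fst (snd q)" and ?b = "snd (snd q)"
      have b: "0 \<le> ?b" "?b < 1" and d: "0 \<le> d q" "d q \<le> 1" using assms(1)[of "fst q" "snd q"] assms(2)[OF q] q by auto
      define D where "D = 1 - ?b + ?b * (d q)\<^sup>2"
      have D: "0 < 1 - ?b" "1 - ?b \<le> D" using b by (simp_all add: D_def)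
      then have "0 < D" by linarith
      have dd: "(d q)\<^sup>2 \<le> 1" using d by (simp add: power_le_one)
      have "norm (?G q) \<le> norm (d q *\<^sub>R ?a /\<^sub>R D) + norm (?b * (d q)\<^sup>2 / D)"
        unfolding radial_push_def D_def by (rule norm_Pair_le)
      also have "\<dots> = (d q * norm ?a + ?b * (d q)\<^sup>2) / D"
        using b d \<open>0 < D\<close> by (simp add: divide_inverse algebra_simps abs_mult)
      also have "\<dots> \<le> (norm ?a + ?b) / (1 - ?b)"
        using D b d dd by (intro frac_le add_mono) (auto simp: mult_left_le mult_left_le_one_le)
      finally show ?thesis .
    qed
    then have "(?G \<longlongrightarrow> 0) (at p within S)"
      by (intro Lim_null_comparison[OF _ lim]) (auto simp: eventually_at_filter)
    moreover have "?G p = 0" by (simp add: tz z zero_prod_def)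
    ultimately show ?thesis by (simp add: continuous_within)
  qed
qed

text \<open>
  Radial projection away from \<open>v\<close>: \<open>1 / \<kappa> x\<close> is the factor by which \<open>x - v\<close> has to be scaled
  to leave the cone \<open>K\<close>; rays with \<open>\<kappa> x = 0\<close> end at infinity.
\<close>

lemma conical_pair_homology:
  fixes Y X A K N :: "'a::euclidean_space set"
  assumes Y: "closed Y" "X \<subseteq> Y" and A: "closed A" and K: "closed K" and X: "X = A \<union> K"
    and v: "v \<in> K" "v \<notin> A"
    and cont: "continuous_on (K - {v}) \<kappa>"
    and \<kappa>01: "\<And>x. x \<in> K - {v} \<Longrightarrow> \<kappa> x \<in> {0..1}"
    and \<kappa>A: "\<And>x. x \<in> K - {v} \<Longrightarrow> x \<in> A \<longleftrightarrow> \<kappa> x = 1"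
    and ray: "\<And>x d. x \<in> K - {v} \<Longrightarrow> \<kappa> x \<le> d \<Longrightarrow> 0 < d \<Longrightarrow> d \<le> 1 \<Longrightarrow> v + (x - v) /\<^sub>R d \<in> K"
    and exit: "\<And>x. x \<in> K - {v} \<Longrightarrow> 0 < \<kappa> x \<Longrightarrow> v + (x - v) /\<^sub>R \<kappa> x \<in> A"
    and N: "N \<subseteq> K" "open U" "v \<in> U" "U \<inter> X \<subseteq> N"
  shows "relative_homology_group n
       (subtopology (Alexandroff_compactification (top_of_set Y)) (insert None (Some ` X))) (insert None (Some ` A))
     \<cong> relative_homology_group n (top_of_set N) (N - {v})"
proof -
  let ?j = "sphere_embedding v"
  let ?T = "subtopology (Alexandroff_compactification (top_of_set Y)) (insert None (Some ` X))"
  define X' A' K' where "X' = ?j ` insert None (Some ` X)" and "A' = ?j ` insert None (Some ` A)"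
    and "K' = ?j ` insert None (Some ` K)"
  define p :: "'a \<times> real" where "p = (0, 1)"
  have pj: "p = ?j (Some v)" by (simp add: p_def)
  have j_eq: "?j y = ?j z \<longleftrightarrow> y = z" for y z by (rule inj_eq[OF inj_sphere_embedding])
  have mem: "?j z \<in> ?j ` S \<longleftrightarrow> z \<in> S" for z S
    by (rule inj_image_mem_iff[OF inj_sphere_embedding])
  have XAK: "X' = A' \<union> K'" unfolding X'_def A'_def K'_def X by blast
  have pA: "p \<notin> A'" unfolding A'_def pj mem using v by auto
  have pX: "p \<in> X'" unfolding X'_def pj mem using v X by auto
  have vN: "v \<in> N" using N v X by blast
  have closed': "closed A'" "closed K'" unfolding A'_def K'_def by (intro closed_sphere_embedding_image A K)+
  have K'_cases: "(z = (0, 0)) \<or> (\<exists>x\<in>K - {v}. z = ?j (Some x))" if z: "z \<in> K' - {p}" for z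
  proof -
    obtain y where y: "z = ?j y" "y \<in> insert None (Some ` K)" using z unfolding K'_def by blast
    have "y \<noteq> Some v" using z unfolding y(1) pj by blast
    then show ?thesis using y by (cases y) auto
  qed

  \<comment> \<open>The value 1 at the image of infinity agrees with the value of
    \<open>\<kappa>\<close> on \<open>A\<close>: there is no push. Elsewhere the argument inverts
    the embedding.\<close>
  define \<kappa>' where "\<kappa>' z = (if snd z = 0 then 1 else \<kappa> (v + fst z /\<^sub>R snd z))" for z :: "'a \<times> real"
  have \<kappa>'_Some: "\<kappa>' (?j (Some x)) = \<kappa> x" for x
    using sphere_embedding_Some_pos[of v x] sphere_embedding_inverse[of v x] by (simp add: \<kappa>'_def)
  have \<kappa>'_None: "\<kappa>' (0, 0) = 1" by (simp add: \<kappa>'_def)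
  have \<kappa>'01: "\<kappa>' z \<in> {0..1}" if "z \<in> K' - {p}" for z
    using K'_cases[OF that] \<kappa>01 \<kappa>'_Some \<kappa>'_None by auto
  \<comment> \<open>The divisor runs from 1, no push, at time 0 to the exit value at time 1.\<close>
  define e where "e q = (1 - fst q) + fst q * \<kappa>' (snd q)" for q
  define H where "H q = (if snd q \<in> A' then snd q else radial_push (e q) (snd q))" for q
  let ?S1 = "{0..1::real} \<times> A'" and ?S2 = "{0..1::real} \<times> (K' - {p})"
  have e01: "e q \<in> {0..1}" if "q \<in> ?S2" for q
  proof -
    have k: "0 \<le> \<kappa>' (snd q)" "\<kappa>' (snd q) \<le> 1" and t: "0 \<le> fst q" "fst q \<le> 1"
      using \<kappa>'01[of "snd q"] that by (auto simp: mem_Times_iff)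
    have "0 \<le> fst q * \<kappa>' (snd q)" "fst q * \<kappa>' (snd q) \<le> fst q * 1"
      using k t by (auto intro!: mult_left_mono mult_nonneg_nonneg simp del: mult_1_right)
    then show ?thesis using t by (simp add: e_def)
  qed
  have cont_push: "continuous_on ?S2 (\<lambda>q. radial_push (e q) (snd q))"
  proof (rule continuous_radial_push[OF _ e01])
    fix t z assume tz: "(t, z) \<in> ?S2"
    then have z: "z \<in> K' - {p}" by blast
    obtain y where y: "z = ?j y" using z unfolding K'_def by blast
    have "y \<noteq> Some v" using z unfolding y pj by blast
    then have "snd z \<noteq> 1" unfolding y sphere_embedding_1_iff .
    then show "snd z \<in> {0..<1}" using sphere_embedding_snd_le[of v y] unfolding y by simp
    show "z = (0, 0)" if "snd z = 0"
    proof (cases y)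
      case (Some x)
      then show ?thesis using sphere_embedding_Some_pos[of v x] that y by simp
    qed (simp add: y)
  next
    let ?P = "{q \<in> ?S2. 0 < snd (snd q)}"
    let ?g = "\<lambda>q::real \<times> 'a \<times> real. v + fst (snd q) /\<^sub>R snd (snd q)"
    have "continuous_on ?P ?g" by (intro continuous_intros) auto
    moreover have "?g q \<in> K - {v}" if "q \<in> ?P" for q
    proof -
      have "snd q \<in> K' - {p}" "snd q \<noteq> (0, 0)" using that by (auto simp: mem_Times_iff)
      then obtain x where "x \<in> K - {v}" "snd q = ?j (Some x)" using K'_cases by blast
      then show ?thesis using sphere_embedding_inverse[of v x] by simp
    qed
    then have "?g ` ?P \<subseteq> K - {v}" by (rule image_subsetI)
    ultimately have "continuous_on ?P (\<lambda>q. \<kappa> (?g q))"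
      by (rule continuous_on_compose2[OF cont])
    then have "continuous_on ?P (\<lambda>q. (1 - fst q) + fst q * \<kappa> (?g q))"
      by (intro continuous_intros)
    then show "continuous_on ?P e"
      by (rule continuous_on_eq) (simp add: e_def \<kappa>'_def)
  qed
  have S12: "?S1 \<union> ?S2 = {0..1} \<times> (X' - {p})" using XAK pA by blast
  have "continuous_on (?S1 \<union> ?S2) (\<lambda>q. if snd q \<in> A' then snd q else radial_push (e q) (snd q))"
  proof (rule continuous_on_cases_local)
    show "closedin (top_of_set (?S1 \<union> ?S2)) ?S1"
      by (intro closed_subset closed_Times closed') auto
    have "?S2 = (?S1 \<union> ?S2) \<inter> ({0..1} \<times> K')" using pA by blast
    moreover have "closedin (top_of_set (?S1 \<union> ?S2)) ((?S1 \<union> ?S2) \<inter> ({0..1} \<times> K'))"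
      by (intro closedin_closed_Int closed_Times closed') auto
    ultimately show "closedin (top_of_set (?S1 \<union> ?S2)) ?S2" by (simp only:)
    show "continuous_on ?S1 snd" by (intro continuous_intros)
    \<comment> \<open>On the overlap of the two relatively closed pieces the divisor is 1, so
      pushing and standing still agree.\<close>
    fix q assume "q \<in> ?S1 \<and> \<not> snd q \<in> A' \<or> q \<in> ?S2 \<and> snd q \<in> A'"
    then have q: "snd q \<in> K' - {p}" "snd q \<in> A'" by (auto simp: mem_Times_iff)
    have "\<kappa>' (snd q) = 1"
    proof (cases "snd q = (0, 0)")
      case False
      then obtain x where x: "x \<in> K - {v}" "snd q = ?j (Some x)" using K'_cases[OF q(1)] by blast
      then have "x \<in> A" using q(2) unfolding x(2) A'_def mem by blast
      then show ?thesis using \<kappa>A[OF x(1)] x(2) \<kappa>'_Some by simp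
    qed (simp add: \<kappa>'_None)
    then show "snd q = radial_push (e q) (snd q)" by (simp add: e_def)
  qed (rule cont_push)
  then have contH: "continuous_on ({0..1} \<times> (X' - {p})) H" unfolding S12 H_def[abs_def] .
  have push_in: "H (t, z) \<in> X' - {p}" "H (1, z) \<in> A'" if t: "t \<in> {0..1}" and z: "z \<in> X' - {p}" for t z
  proof -
    have "H (t, z) \<in> X' - {p} \<and> H (1, z) \<in> A'"
    proof (cases "z \<in> A'")
      case True
      then show ?thesis using z by (simp add: H_def)
    next
      case False
      then have zK: "z \<in> K' - {p}" using z XAK by blast
      have "z \<noteq> (0, 0)" using False by (auto simp: A'_def)
      then obtain x where x: "x \<in> K - {v}" "z = ?j (Some x)" using K'_cases[OF zK] by blast
      have k: "\<kappa>' z = \<kappa> x" unfolding x(2) by (rule \<kappa>'_Some)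
      have origin: "(0, 0) \<in> A'" "(0, 0) \<in> X' - {p}" using XAK by (auto simp: A'_def p_def)
      have e: "e (t, z) = 1 - t + t * \<kappa> x" "e (1, z) = \<kappa> x" by (simp_all add: e_def k)
      \<comment> \<open>Until time 1 the divisor does not fall below \<open>\<kappa> x\<close>, so
        the moving point has not left the cone.\<close>
      have "(1 - t) * \<kappa> x \<le> (1 - t) * 1" using t \<kappa>01[OF x(1)] by (intro mult_left_mono) auto
      then have le: "\<kappa> x \<le> e (t, z)" unfolding e by (simp add: algebra_simps)
      have e1: "e (t, z) \<in> {0..1}" using e01[of "(t, z)"] t zK by auto
      have "radial_push (e (t, z)) z \<in> X' - {p}"
      proof (cases "e (t, z) = 0")
        case True
        then show ?thesis using origin by simp
      next
        case False
        then have "v + (x - v) /\<^sub>R e (t, z) \<in> K" using ray[OF x(1) le] e1 by simp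
        moreover have "v + (x - v) /\<^sub>R e (t, z) \<noteq> v" using x(1) False by simp
        ultimately have "?j (Some (v + (x - v) /\<^sub>R e (t, z))) \<in> K' - {p}"
          unfolding K'_def pj Diff_iff mem singleton_iff j_eq by blast
        then show ?thesis unfolding x(2)[symmetric] using radial_push_Some[OF False, of v x] x(2) XAK by auto
      qed
      moreover have "radial_push (\<kappa> x) z \<in> A'"
      proof (cases "\<kappa> x = 0")
        case True
        then show ?thesis using origin by simp
      next
        case nz: False
        then have "v + (x - v) /\<^sub>R \<kappa> x \<in> A" using exit[OF x(1)] \<kappa>01[OF x(1)] by simp
        then show ?thesis unfolding x(2) radial_push_Some[OF nz] A'_def mem by blast
      qed
      ultimately show ?thesis using False e(2) by (simp add: H_def)
    qed
    then show "H (t, z) \<in> X' - {p}" "H (1, z) \<in> A'" by blast+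
  qed
  have AX: "A' \<subseteq> X' - {p}" using XAK pA by blast
  have "continuous_on (X' - {p}) (H \<circ> Pair 1)"
    by (rule continuous_on_o_Pair[OF contH]) simp
  then have "continuous_on (X' - {p}) (\<lambda>z. H (1, z))" by (simp add: o_def)
  then have r: "continuous_map (top_of_set (X' - {p})) (top_of_set A') (\<lambda>z. H (1, z))"
    using push_in(2)[of 0] by (auto simp: continuous_map_in_subtopology)
  have "homotopic_with (\<lambda>k. k ` A' \<subseteq> A') (top_of_set (X' - {p})) (top_of_set (X' - {p})) id (\<lambda>z. H (1, z))"
    unfolding homotopic_with_def
  proof (intro exI conjI allI ballI)
    show "continuous_map (prod_topology (top_of_set {0..1}) (top_of_set (X' - {p}))) (top_of_set (X' - {p})) H"
    proof -
      have "H q \<in> X' - {p}" if "q \<in> {0..1} \<times> (X' - {p})" for q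
        using push_in(1)[of "fst q" "snd q"] that unfolding mem_Times_iff prod.collapse by blast
      then have "H \<in> {0..1} \<times> (X' - {p}) \<rightarrow> X' - {p}" by (rule Pi_I)
      with contH show ?thesis
        unfolding prod_topology_subtopology_eu continuous_map_subtopology_eu by blast
    qed
    show "H (0, z) = id z" for z by (simp add: H_def e_def)
    show "(\<lambda>z. H (t, z)) ` A' \<subseteq> A'" for t by (auto simp: H_def)
  qed simp
  then have hom: "homotopic_with (\<lambda>k. k ` A' \<subseteq> A') (top_of_set (X' - {p})) (top_of_set (X' - {p})) (\<lambda>z. H (1, z)) id"
    by (rule homotopic_with_symD)
  \<comment> \<open>Infinity is removed as well, so that only finite points of \<open>U\<close>
    remain near \<open>p\<close>.\<close>
  define U' where "U' = X' - ?j ` insert None (Some ` (X - U))"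
  define N' where "N' = (\<lambda>x. ?j (Some x)) ` N"
  have "closed X" using X A K by (simp add: closed_Un)
  then have "closed (?j ` insert None (Some ` (X - U)))" using N by (intro closed_sphere_embedding_image closed_Diff)
  then have opU: "openin (top_of_set X') U'" unfolding U'_def by (simp add: Diff_eq open_Compl openin_open_Int)
  have pU: "p \<in> U'" using pX N(3) unfolding U'_def pj by (simp only: Diff_iff mem) auto
  have UN: "U' \<subseteq> N'"
  proof
    fix z assume z: "z \<in> U'"
    then obtain y where y: "z = ?j y" "y \<in> insert None (Some ` X)" unfolding U'_def X'_def by blast
    have "y \<notin> insert None (Some ` (X - U))" using z unfolding U'_def y(1) Diff_iff mem by blast
    then obtain x where "y = Some x" "x \<in> X \<inter> U" using y(2) by blast
    then show "z \<in> N'" using N(4) y(1) unfolding N'_def by blast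
  qed
  have NX: "N' \<subseteq> X'" unfolding N'_def X'_def using N X by blast
  have 2: "relative_homology_group n (top_of_set X') A' \<cong> relative_homology_group n (top_of_set N') (N' - {p})"
    by (rule punctured_pair_homology[OF _ pX pA r hom NX opU pU UN]) (use AX in blast)
  have "insert None (Some ` X) \<subseteq> insert None (Some ` Y)" using Y(2) by blast
  from homeomorphic_sphere_embedding[OF Y(1) this]
  have h: "homeomorphic_map ?T (top_of_set X') ?j" unfolding X'_def .
  have "insert None (Some ` A) \<subseteq> topspace ?T" using X Y(2) by auto
  then have 1: "relative_homology_group n ?T (insert None (Some ` A)) \<cong> relative_homology_group n (top_of_set X') A'"
    by (rule is_isoI[OF homeomorphic_map_relative_homology_iso[OF h _ A'_def[symmetric]]])
  have "homeomorphism N N' (\<lambda>x. ?j (Some x)) (\<lambda>z. v + fst z /\<^sub>R snd z)"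
  proof (rule homeomorphismI)
    show "continuous_on N (\<lambda>x. ?j (Some x))" by (rule continuous_sphere_embedding_Some)
    have "snd z \<noteq> 0" if z: "z \<in> N'" for z
    proof -
      obtain x where x: "z = ?j (Some x)" using z unfolding N'_def by blast
      show ?thesis using sphere_embedding_Some_pos[of v x] unfolding x by linarith
    qed
    then show "continuous_on N' (\<lambda>z. v + fst z /\<^sub>R snd z)" by (intro continuous_intros) auto
  qed (use sphere_embedding_inverse[of v] in \<open>auto simp: N'_def\<close>)
  from relative_homology_homeomorphism[OF this vN]
  have "relative_homology_group n (top_of_set N) (N - {v}) \<cong> relative_homology_group n (top_of_set N') (N' - {p})"
    unfolding pj .
  then have 3: "relative_homology_group n (top_of_set N') (N' - {p}) \<cong> relative_homology_group n (top_of_set N) (N - {v})"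
    by (simp add: group.iso_sym)
  show ?thesis using 1 2 3 by (meson iso_trans)
qed

section \<open>Cells as sign classes\<close>

lemma sgn_cases: "sgn (x::real) \<in> {-1, 0, 1}" by (auto simp: sgn_if)

lemma subspace_layer_space: "subspace (layer_space \<Phi> k)"
  by (auto simp: layer_space_def subspace_def)

lemma dim_layer_space: "dim (layer_space \<Phi> k) = card (neurons \<Phi> k)"
  unfolding layer_space_def using dim_substandard_cart[of "neurons \<Phi> k", where ?'a=real] by (simp add: dim_vec_eq)

lemma closed_layer_space: "closed (layer_space \<Phi> k)"
  by (simp add: closed_subspace subspace_layer_space)

definition pre_act :: "'d::finite relu_net \<Rightarrow> nat \<times> 'd \<Rightarrow> real^'d \<Rightarrow> real" where
  "pre_act \<Phi> p x = aff_layer \<Phi> (fst p) (hidden \<Phi> (fst p - 1) x) $ snd p"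

definition entries_upto :: "'d::finite relu_net \<Rightarrow> nat \<Rightarrow> (nat \<times> 'd) set" where
  "entries_upto \<Phi> k = (SIGMA i:{1..k}. neurons \<Phi> i)"

text \<open>Indexed by a sign pattern and not by a point, since refinements of cells and the cells
  around a vertex are given as patterns before a point realising them is known. The alternative 0
  makes the set closed.\<close>

definition weak_cell :: "'d::finite relu_net \<Rightarrow> nat \<Rightarrow> (nat \<times> 'd \<Rightarrow> real) \<Rightarrow> (real^'d) set" where
  "weak_cell \<Phi> k \<sigma> =
     {y \<in> layer_space \<Phi> 0. \<forall>p\<in>entries_upto \<Phi> k. sgn (pre_act \<Phi> p y) \<in> {0, \<sigma> p}}"

definition open_cell :: "'d::finite relu_net \<Rightarrow> nat \<Rightarrow> real^'d \<Rightarrow> (real^'d) set" where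
  "open_cell \<Phi> k x =
     {y \<in> layer_space \<Phi> 0. \<forall>p\<in>entries_upto \<Phi> k. sgn (pre_act \<Phi> p y) = sgn (pre_act \<Phi> p x)}"

abbreviation cell_of :: "'d::finite relu_net \<Rightarrow> nat \<Rightarrow> real^'d \<Rightarrow> (real^'d) set" where
  "cell_of \<Phi> k x \<equiv> weak_cell \<Phi> k (\<lambda>p. sgn (pre_act \<Phi> p x))"

definition layer_lin :: "'d::finite relu_net \<Rightarrow> nat \<Rightarrow> real^'d \<Rightarrow> real^'d" where
  "layer_lin \<Phi> k =
     (SOME L. linear L \<and> (\<exists>c. \<forall>x\<in>layer_space \<Phi> (k - 1). aff_layer \<Phi> k x = L x + c))"

definition layer_const :: "'d::finite relu_net \<Rightarrow> nat \<Rightarrow> real^'d" where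
  "layer_const \<Phi> k =
     (SOME c. \<forall>x\<in>layer_space \<Phi> (k - 1). aff_layer \<Phi> k x = layer_lin \<Phi> k x + c)"

text \<open>Freezing the activation pattern to the signs \<open>\<sigma>\<close> makes every layer globally affine.\<close>

primrec frozen_hidden ::
    "'d::finite relu_net \<Rightarrow> (nat \<times> 'd \<Rightarrow> real) \<Rightarrow> nat \<Rightarrow> real^'d \<Rightarrow> real^'d" where
  "frozen_hidden \<Phi> \<sigma> 0 x = x"
| "frozen_hidden \<Phi> \<sigma> (Suc k) x = (\<chi> j. if (Suc k, j) \<in> entries \<Phi> \<and> 0 < \<sigma> (Suc k, j)
     then (layer_lin \<Phi> (Suc k) (frozen_hidden \<Phi> \<sigma> k x) + layer_const \<Phi> (Suc k)) $ j else 0)"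

definition frozen_pre ::
    "'d::finite relu_net \<Rightarrow> (nat \<times> 'd \<Rightarrow> real) \<Rightarrow> nat \<times> 'd \<Rightarrow> real^'d \<Rightarrow> real" where
  "frozen_pre \<Phi> \<sigma> p x =
     (layer_lin \<Phi> (fst p) (frozen_hidden \<Phi> \<sigma> (fst p - 1) x) + layer_const \<Phi> (fst p)) $ snd p"

lemma affine_map_on_UNIV_iff:
  "affine_map_on UNIV f \<longleftrightarrow> (\<exists>L c. linear L \<and> f = (\<lambda>x. L x + c))"
  by (auto simp: affine_map_on_def fun_eq_iff)

lemma affine_map_combine:
  assumes "affine_map_on UNIV f"
  shows "f ((1 - t) *\<^sub>R x + t *\<^sub>R y) = (1 - t) *\<^sub>R f x + t *\<^sub>R f y"
proof -
  obtain L c where L: "linear L" "f = (\<lambda>x. L x + c)" using assms by (auto simp: affine_map_on_UNIV_iff)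
  have "L ((1 - t) *\<^sub>R x + t *\<^sub>R y) = (1 - t) *\<^sub>R L x + t *\<^sub>R L y"
    using L(1) by (simp add: linear_add linear_scale)
  then show ?thesis using L(2) by (simp add: algebra_simps)
qed

locale network =
  fixes \<Phi> :: "'d::finite relu_net"
  assumes relu_network: "relu_network \<Phi>"
begin

abbreviation "L0 \<equiv> layer_space \<Phi> 0"
abbreviation "m \<equiv> depth \<Phi>"
abbreviation "pre \<equiv> pre_act \<Phi>"
abbreviation "E \<equiv> entries_upto \<Phi>"

lemma entries_eq: "entries \<Phi> = E m" by (simp add: entries_def entries_upto_def)

lemma finite_E [simp]: "finite (E k)"
  unfolding entries_upto_def by auto

lemma E_mono: "j \<le> k \<Longrightarrow> E j \<subseteq> E k" unfolding entries_upto_def by auto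

lemma E_Suc: "E (Suc k) = E k \<union> Pair (Suc k) ` neurons \<Phi> (Suc k)"
  unfolding entries_upto_def by (auto simp: le_Suc_eq)

lemma layer_lin:
  assumes "1 \<le> k" "k \<le> m"
  shows "linear (layer_lin \<Phi> k)"
    and "x \<in> layer_space \<Phi> (k - 1) \<Longrightarrow> aff_layer \<Phi> k x = layer_lin \<Phi> k x + layer_const \<Phi> k"
proof -
  have "\<exists>L. linear L \<and> (\<exists>c. \<forall>x\<in>layer_space \<Phi> (k - 1). aff_layer \<Phi> k x = L x + c)"
    using relu_network assms unfolding relu_network_def affine_map_on_def by (meson atLeastAtMost_iff)
  from someI_ex[OF this, folded layer_lin_def] have *: "linear (layer_lin \<Phi> k)"
    "\<exists>c. \<forall>x\<in>layer_space \<Phi> (k - 1). aff_layer \<Phi> k x = layer_lin \<Phi> k x + c"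
    by blast+
  show "linear (layer_lin \<Phi> k)" by fact
  from someI_ex[OF *(2), folded layer_const_def]
  show "x \<in> layer_space \<Phi> (k - 1) \<Longrightarrow> aff_layer \<Phi> k x = layer_lin \<Phi> k x + layer_const \<Phi> k"
    by blast
qed

lemma aff_layer_in:
  assumes "1 \<le> k" "k \<le> m" "x \<in> layer_space \<Phi> (k - 1)"
  shows "aff_layer \<Phi> k x \<in> layer_space \<Phi> k"
  using relu_network assms unfolding relu_network_def by fastforce

lemma relu_in: "x \<in> layer_space \<Phi> k \<Longrightarrow> relu x \<in> layer_space \<Phi> k"
  by (auto simp: layer_space_def relu_def)

lemma hidden_in: "k \<le> m \<Longrightarrow> x \<in> L0 \<Longrightarrow> hidden \<Phi> k x \<in> layer_space \<Phi> k"
proof (induction k)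
  case (Suc k)
  then show ?case using aff_layer_in[of "Suc k" "hidden \<Phi> k x"] by (simp add: relu_in)
qed simp

lemma hidden_nth:
  assumes "Suc k \<le> m"
  shows "hidden \<Phi> (Suc k) x $ j = max 0 (pre (Suc k, j) x)"
  by (simp add: pre_act_def relu_def)

lemma pre_act_eq_lin:
  assumes "p \<in> E m" "x \<in> L0"
  shows "pre p x = (layer_lin \<Phi> (fst p) (hidden \<Phi> (fst p - 1) x) + layer_const \<Phi> (fst p)) $ snd p"
proof -
  have "1 \<le> fst p" "fst p \<le> m" using assms by (auto simp: entries_upto_def)
  then show ?thesis using layer_lin(2)[of "fst p"] hidden_in[of "fst p - 1" x] assms
    by (simp add: pre_act_def)
qed

lemma pre_act_outside:
  assumes "1 \<le> k" "k \<le> m" "x \<in> L0" "j \<notin> neurons \<Phi> k"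
  shows "pre (k, j) x = 0"
proof -
  have "aff_layer \<Phi> k (hidden \<Phi> (k - 1) x) \<in> layer_space \<Phi> k"
    using assms by (intro aff_layer_in hidden_in) auto
  then show ?thesis using assms by (simp add: layer_space_def pre_act_def)
qed

lemma continuous_hidden: "k \<le> m \<Longrightarrow> continuous_on L0 (hidden \<Phi> k)"
proof (induction k)
  case 0
  then show ?case by (simp add: continuous_on_id id_def)
next
  case (Suc k)
  have lin: "linear (layer_lin \<Phi> (Suc k))" using layer_lin(1) Suc.prems by simp
  have IH: "continuous_on L0 (hidden \<Phi> k)" using Suc by simp
  have "continuous_on L0 (\<lambda>x. layer_lin \<Phi> (Suc k) (hidden \<Phi> k x) + layer_const \<Phi> (Suc k))"
    by (intro continuous_intros linear_continuous_on_compose[OF IH lin])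
  then have "continuous_on L0 (\<lambda>x. aff_layer \<Phi> (Suc k) (hidden \<Phi> k x))"
    using layer_lin(2)[of "Suc k"] hidden_in[of k] Suc.prems
    by (subst continuous_on_cong[OF refl]) auto
  then have "continuous_on L0 (\<lambda>x. relu (aff_layer \<Phi> (Suc k) (hidden \<Phi> k x)))"
    unfolding relu_def by (intro continuous_intros)
  then show ?case by (simp add: o_def)
qed

lemma continuous_pre:
  assumes "p \<in> E m"
  shows "continuous_on L0 (pre p)"
proof -
  have lin: "linear (layer_lin \<Phi> (fst p))" and le: "fst p - 1 \<le> m"
    using layer_lin(1) assms by (auto simp: entries_upto_def)
  have "continuous_on L0 (\<lambda>x. (layer_lin \<Phi> (fst p) (hidden \<Phi> (fst p - 1) x) + layer_const \<Phi> (fst p)) $ snd p)"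
    by (intro continuous_intros linear_continuous_on_compose[OF continuous_hidden[OF le] lin])
  then show ?thesis using pre_act_eq_lin[OF assms] by (subst continuous_on_cong[OF refl]) auto
qed

lemma net_fun_affine_in_hidden:
  "\<exists>L c. linear L \<and> (\<forall>x\<in>L0. net_fun \<Phi> x = L (hidden \<Phi> m x) + c)"
proof -
  obtain L c where "linear L" "\<forall>x\<in>layer_space \<Phi> m. out_layer \<Phi> x = L x + c"
    using relu_network unfolding relu_network_def affine_map_on_def by auto
  then show ?thesis using hidden_in[of m] unfolding net_fun_def o_def by blast
qed

section \<open>Frozen layers are affine; closed cells are convex and closed\<close>

lemma affine_frozen_hidden: "k \<le> m \<Longrightarrow> affine_map_on UNIV (frozen_hidden \<Phi> \<sigma> k)"
proof (induction k)
  case 0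
  have "frozen_hidden \<Phi> \<sigma> 0 = (\<lambda>x. id x + 0)" by auto
  then show ?case unfolding affine_map_on_UNIV_iff using linear_id by blast
next
  case (Suc k)
  then obtain L c where L: "linear L" "frozen_hidden \<Phi> \<sigma> k = (\<lambda>x. L x + c)"
    by (auto simp: affine_map_on_UNIV_iff)
  have lin: "linear (layer_lin \<Phi> (Suc k))" using layer_lin(1) Suc.prems by simp
  define P :: "real^'d \<Rightarrow> real^'d" where
    "P = (\<lambda>z. \<chi> j. if (Suc k, j) \<in> entries \<Phi> \<and> 0 < \<sigma> (Suc k, j) then z $ j else 0)"
  have P: "linear P" unfolding P_def by (intro linearI) (auto simp: vec_eq_iff)
  have "frozen_hidden \<Phi> \<sigma> (Suc k) =
      (\<lambda>x. (P \<circ> layer_lin \<Phi> (Suc k) \<circ> L) x + P (layer_lin \<Phi> (Suc k) c + layer_const \<Phi> (Suc k)))"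
    by (rule ext) (simp add: L(2) P_def vec_eq_iff linear_add[OF lin])
  moreover have "linear (P \<circ> layer_lin \<Phi> (Suc k) \<circ> L)"
    using P lin L by (simp add: linear_compose)
  ultimately show ?case unfolding affine_map_on_UNIV_iff by blast
qed

lemma affine_frozen_pre:
  assumes "p \<in> E m"
  shows "affine_map_on UNIV (frozen_pre \<Phi> \<sigma> p)"
proof -
  have p: "1 \<le> fst p" "fst p \<le> m" using assms by (auto simp: entries_upto_def)
  then obtain L c where L: "linear L" "frozen_hidden \<Phi> \<sigma> (fst p - 1) = (\<lambda>x. L x + c)"
    using affine_frozen_hidden[of "fst p - 1" \<sigma>] unfolding affine_map_on_UNIV_iff by (meson diff_le_self le_trans)
  have lin: "linear (layer_lin \<Phi> (fst p))" using layer_lin(1) p by simp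
  have "frozen_pre \<Phi> \<sigma> p = (\<lambda>x. ((\<lambda>z. z $ snd p) \<circ> layer_lin \<Phi> (fst p) \<circ> L) x
      + (layer_lin \<Phi> (fst p) c + layer_const \<Phi> (fst p)) $ snd p)"
    by (rule ext) (simp add: frozen_pre_def L(2)[simplified] linear_add[OF lin])
  moreover have "linear ((\<lambda>z. z $ snd p) \<circ> layer_lin \<Phi> (fst p) \<circ> L)"
    using lin L by (intro linear_compose) (auto intro!: linearI)
  ultimately show ?thesis unfolding affine_map_on_UNIV_iff by blast
qed

text \<open>It suffices that the signs match for the frozen or for the true pre-activations.\<close>

lemma frozen_hidden_eq:
  assumes "k \<le> m" "y \<in> L0"
    and "\<forall>p\<in>E k. sgn (pre p y) \<in> {0, \<sigma> p} \<or> sgn (frozen_pre \<Phi> \<sigma> p y) \<in> {0, \<sigma> p}"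
  shows "frozen_hidden \<Phi> \<sigma> k y = hidden \<Phi> k y"
  using assms
proof (induction k)
  case (Suc k)
  then have IH: "frozen_hidden \<Phi> \<sigma> k y = hidden \<Phi> k y" using E_mono[of k "Suc k"] by auto
  have "frozen_hidden \<Phi> \<sigma> (Suc k) y $ j = hidden \<Phi> (Suc k) y $ j" for j
  proof (cases "j \<in> neurons \<Phi> (Suc k)")
    case True
    then have p: "(Suc k, j) \<in> E (Suc k)" by (auto simp: entries_upto_def)
    then have p': "(Suc k, j) \<in> E m" using E_mono Suc.prems by blast
    have eq: "frozen_pre \<Phi> \<sigma> (Suc k, j) y = pre (Suc k, j) y"
      using IH pre_act_eq_lin[OF p' Suc.prems(2)] by (simp add: frozen_pre_def)
    have "sgn (pre (Suc k, j) y) \<in> {0, \<sigma> (Suc k, j)}" using Suc.prems(3) p eq by auto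
    then have "frozen_hidden \<Phi> \<sigma> (Suc k) y $ j = max 0 (frozen_pre \<Phi> \<sigma> (Suc k, j) y)"
      unfolding eq using eq p' by (auto simp: frozen_pre_def entries_eq sgn_if split: if_splits)
    then show ?thesis using eq hidden_nth Suc.prems by simp
  next
    case False
    then have "pre (Suc k, j) y = 0" using pre_act_outside[of "Suc k"] Suc.prems by simp
    then show ?thesis using False hidden_nth[of k y j] Suc.prems by (simp add: entries_def)
  qed
  then show ?case by (simp add: vec_eq_iff del: frozen_hidden.simps hidden.simps)
qed simp

lemma frozen_pre_eq:
  assumes "k \<le> m" "y \<in> L0" "p \<in> E m" "fst p \<le> Suc k"
    and "\<forall>p\<in>E k. sgn (pre p y) \<in> {0, \<sigma> p} \<or> sgn (frozen_pre \<Phi> \<sigma> p y) \<in> {0, \<sigma> p}"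
  shows "frozen_pre \<Phi> \<sigma> p y = pre p y"
proof -
  have "E (fst p - 1) \<subseteq> E k" using assms by (intro E_mono) auto
  then have "frozen_hidden \<Phi> \<sigma> (fst p - 1) y = hidden \<Phi> (fst p - 1) y"
    using assms by (intro frozen_hidden_eq) auto
  then show ?thesis using assms by (simp add: frozen_pre_def pre_act_eq_lin)
qed

text \<open>Frozen and true pre-activations agree, layer by layer, as soon as either family
  satisfies the sign constraints. So a closed cell is cut out by globally affine functions, although
  the pre-activations themselves are only piecewise affine.\<close>

lemma weak_cell_frozen:
  assumes "k \<le> m"
  shows "weak_cell \<Phi> k \<sigma> = {y \<in> L0. \<forall>p\<in>E k. sgn (frozen_pre \<Phi> \<sigma> p y) \<in> {0, \<sigma> p}}"
proof -
  have p: "p \<in> E m" "fst p \<le> Suc k" if "p \<in> E k" for p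
    using E_mono[OF assms] that by (auto simp: entries_upto_def)
  have "(\<forall>p\<in>E k. sgn (pre p y) \<in> {0, \<sigma> p}) \<longleftrightarrow> (\<forall>p\<in>E k. sgn (frozen_pre \<Phi> \<sigma> p y) \<in> {0, \<sigma> p})"
    (is "?l \<longleftrightarrow> ?r") if "y \<in> L0" for y
  proof -
    have "\<forall>p\<in>E k. frozen_pre \<Phi> \<sigma> p y = pre p y" if "?l \<or> ?r"
    proof
      fix q assume q: "q \<in> E k"
      show "frozen_pre \<Phi> \<sigma> q y = pre q y"
        by (rule frozen_pre_eq[OF assms \<open>y \<in> L0\<close> p(1)[OF q] p(2)[OF q]]) (use that in blast)
    qed
    then show ?thesis by metis
  qed
  then show ?thesis unfolding weak_cell_def by blast
qed

text \<open>Layer \<open>Suc k\<close> is included: its pre-activations depend only on the hidden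
  values of layer \<open>k\<close>, and the pattern up to that layer is fixed on the cell.\<close>

lemma frozen_pre_on_cell:
  assumes "k \<le> m" "y \<in> weak_cell \<Phi> k \<sigma>" "p \<in> E m" "fst p \<le> Suc k"
  shows "frozen_pre \<Phi> \<sigma> p y = pre p y"
  using assms by (intro frozen_pre_eq[of k]) (auto simp: weak_cell_def)

lemma frozen_hidden_on_cell:
  assumes "k \<le> m" "y \<in> weak_cell \<Phi> k \<sigma>"
  shows "frozen_hidden \<Phi> \<sigma> k y = hidden \<Phi> k y"
  using assms by (intro frozen_hidden_eq) (auto simp: weak_cell_def)

lemma E_le: "p \<in> E k \<Longrightarrow> k \<le> m \<Longrightarrow> p \<in> E m \<and> fst p \<le> Suc k"
  using E_mono[of k m] by (auto simp: entries_upto_def)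

lemma sgn_weak_combine:
  fixes a b :: real
  assumes "sgn a \<in> {0, s}" "sgn b \<in> {0, s}" "0 \<le> t" "t \<le> 1"
  shows "sgn ((1 - t) * a + t * b) \<in> {0, s}"
proof -
  consider "s = 1" "0 \<le> a" "0 \<le> b" | "s = -1" "a \<le> 0" "b \<le> 0" | "a = 0" "b = 0"
    using assms(1,2) by (auto simp: sgn_if split: if_splits)
  then show ?thesis
  proof cases
    case 1
    then have "0 \<le> (1 - t) * a + t * b" using assms by simp
    then show ?thesis using 1 by (simp add: sgn_if)
  next
    case 2
    then have "0 \<le> (1 - t) * (- a) + t * (- b)" using assms by (intro add_nonneg_nonneg mult_nonneg_nonneg) auto
    then have "(1 - t) * a + t * b \<le> 0" by simp
    then show ?thesis using 2 by (simp add: sgn_if)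
  qed simp
qed

lemma convex_weak_cell: "k \<le> m \<Longrightarrow> convex (weak_cell \<Phi> k \<sigma>)"
  unfolding convex_alt
proof (intro ballI allI impI)
  fix x y and t :: real
  assume k: "k \<le> m" and xy: "x \<in> weak_cell \<Phi> k \<sigma>" "y \<in> weak_cell \<Phi> k \<sigma>" and t: "0 \<le> t \<and> t \<le> 1"
  have "sgn (frozen_pre \<Phi> \<sigma> p ((1 - t) *\<^sub>R x + t *\<^sub>R y)) \<in> {0, \<sigma> p}" if "p \<in> E k" for p
  proof -
    have "frozen_pre \<Phi> \<sigma> p ((1 - t) *\<^sub>R x + t *\<^sub>R y) = (1 - t) * frozen_pre \<Phi> \<sigma> p x + t * frozen_pre \<Phi> \<sigma> p y"
      using affine_map_combine[OF affine_frozen_pre, of p \<sigma> t x y] E_le[OF that k] by simp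
    moreover have "sgn (frozen_pre \<Phi> \<sigma> p x) \<in> {0, \<sigma> p}" "sgn (frozen_pre \<Phi> \<sigma> p y) \<in> {0, \<sigma> p}"
      using xy that unfolding weak_cell_frozen[OF k] by blast+
    ultimately show ?thesis using t sgn_weak_combine by metis
  qed
  then show "(1 - t) *\<^sub>R x + t *\<^sub>R y \<in> weak_cell \<Phi> k \<sigma>"
    using xy unfolding weak_cell_frozen[OF k]
    by (auto intro!: subspace_add subspace_mul subspace_layer_space)
qed

lemma pre_combine:
  assumes "k \<le> m" "x \<in> weak_cell \<Phi> k \<sigma>" "y \<in> weak_cell \<Phi> k \<sigma>" "0 \<le> t" "t \<le> 1" "p \<in> E m" "fst p \<le> Suc k"
  shows "pre p ((1 - t) *\<^sub>R x + t *\<^sub>R y) = (1 - t) * pre p x + t * pre p y"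
proof -
  have "(1 - t) *\<^sub>R x + t *\<^sub>R y \<in> weak_cell \<Phi> k \<sigma>"
    using convex_weak_cell[OF assms(1), of \<sigma>] assms(2-5) unfolding convex_alt by blast
  then have "pre p ((1 - t) *\<^sub>R x + t *\<^sub>R y) = frozen_pre \<Phi> \<sigma> p ((1 - t) *\<^sub>R x + t *\<^sub>R y)"
    "pre p x = frozen_pre \<Phi> \<sigma> p x" "pre p y = frozen_pre \<Phi> \<sigma> p y"
    using frozen_pre_on_cell[OF assms(1) _ assms(6,7)] assms(2,3) by (blast intro: sym)+
  then show ?thesis
    using affine_map_combine[OF affine_frozen_pre[OF assms(6)], of \<sigma> t x y] by simp
qed

lemma closed_sgn_constraint: "closed {x::real. sgn x \<in> {0, s}}"
proof -
  have "{x::real. sgn x \<in> {0, s}} = (if s = 1 then {0..} else if s = -1 then {..0} else {0})"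
    by (auto simp: sgn_if split: if_splits)
  then show ?thesis by simp
qed

lemma closed_weak_cell:
  assumes k: "k \<le> m" shows "closed (weak_cell \<Phi> k \<sigma>)"
proof -
  have "closed {y \<in> L0. sgn (pre p y) \<in> {0, \<sigma> p}}" if "p \<in> E k" for p
  proof -
    have "closed (L0 \<inter> pre p -` {x. sgn x \<in> {0, \<sigma> p}})"
      using E_le[OF that k] continuous_closed_preimage[OF continuous_pre closed_layer_space closed_sgn_constraint] by blast
    moreover have "L0 \<inter> pre p -` {x. sgn x \<in> {0, \<sigma> p}} = {y \<in> L0. sgn (pre p y) \<in> {0, \<sigma> p}}" by blast
    ultimately show ?thesis by argo
  qed
  then have "closed (L0 \<inter> (\<Inter>p\<in>E k. {y \<in> L0. sgn (pre p y) \<in> {0, \<sigma> p}}))"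
    by (intro closed_Int closed_INT closed_layer_space) blast
  moreover have "weak_cell \<Phi> k \<sigma> = L0 \<inter> (\<Inter>p\<in>E k. {y \<in> L0. sgn (pre p y) \<in> {0, \<sigma> p}})"
    unfolding weak_cell_def by blast
  ultimately show ?thesis by argo
qed

end

section \<open>The complex as a set of sign classes, and relative interiors of its cells\<close>

lemma sgn_strict_combine:
  fixes a b :: real
  assumes "sgn a \<in> {0, s}" "sgn b = s" "0 < t" "t \<le> 1"
  shows "sgn ((1 - t) * a + t * b) = s"
proof -
  consider "s = 1" "0 \<le> a" "0 < b" | "s = -1" "a \<le> 0" "b < 0" | "s = 0" "a = 0" "b = 0"
    using assms(1,2) by (auto simp: sgn_if split: if_splits)
  then show ?thesis
  proof cases
    case 1
    then have "0 \<le> (1 - t) * a" "0 < t * b" using assms by auto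
    then have "0 < (1 - t) * a + t * b" by linarith
    then show ?thesis using 1 by simp
  next
    case 2
    then have "0 \<le> (1 - t) * (- a)" using assms by (intro mult_nonneg_nonneg) auto
    moreover have "0 < t * (- b)" using 2 assms by (intro mult_pos_pos) auto
    ultimately have "(1 - t) * a + t * b < 0" by simp
    then show ?thesis using 2 by simp
  qed simp
qed

lemma eventually_sgn_eq:
  fixes f :: "'a::topological_space \<Rightarrow> real"
  assumes "(f \<longlongrightarrow> l) F" "l \<noteq> 0"
  shows "\<forall>\<^sub>F y in F. sgn (f y) = sgn l"
proof (cases "l > 0")
  case True
  then show ?thesis using order_tendstoD(1)[OF assms(1) True] by (auto elim!: eventually_mono)
next
  case False
  then have "l < 0" using assms by simp
  then show ?thesis using order_tendstoD(2)[OF assms(1) \<open>l < 0\<close>] by (auto elim!: eventually_mono)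
qed

context network
begin

lemma weak_cell_cong:
  assumes "\<And>p. p \<in> E k \<Longrightarrow> \<sigma> p = \<tau> p"
  shows "weak_cell \<Phi> k \<sigma> = weak_cell \<Phi> k \<tau>"
  using assms unfolding weak_cell_def by auto

lemma mem_cell_of: "x \<in> L0 \<Longrightarrow> x \<in> cell_of \<Phi> k x"
  by (simp add: weak_cell_def)

lemma open_cell_sub: "open_cell \<Phi> k x \<subseteq> cell_of \<Phi> k x"
  by (auto simp: weak_cell_def open_cell_def)

lemma mem_open_cell: "x \<in> L0 \<Longrightarrow> x \<in> open_cell \<Phi> k x"
  by (simp add: open_cell_def)

text \<open>Take a point of the cell at which the largest number of neurons is nonzero. The midpoint
  with any other point of the cell is nonzero wherever one of the two is, so maximality makes every
  neuron that is nonzero somewhere on the cell nonzero at the chosen point.\<close>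

lemma weak_cell_eq_cell_of:
  assumes k: "k \<le> m" and ne: "weak_cell \<Phi> k \<sigma> \<noteq> {}"
  shows "\<exists>x\<in>L0. weak_cell \<Phi> k \<sigma> = cell_of \<Phi> k x"
proof -
  let ?W = "weak_cell \<Phi> k \<sigma>"
  define N where "N y = {p \<in> E k. pre p y \<noteq> 0}" for y
  have finN: "finite (N y)" for y by (simp add: N_def)
  obtain w where "w \<in> ?W" using ne by auto
  moreover have "\<forall>y. y \<in> ?W \<longrightarrow> card (N y) < Suc (card (E k))"
    by (auto simp: N_def less_Suc_eq_le intro!: card_mono)
  ultimately obtain x where x: "x \<in> ?W" "\<And>y. y \<in> ?W \<Longrightarrow> card (N y) \<le> card (N x)"
    using ex_has_greatest_nat[of "\<lambda>y. y \<in> ?W" w "\<lambda>y. card (N y)"] by metis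
  have sg: "sgn (pre p y) \<in> {0, \<sigma> p}" if "y \<in> ?W" "p \<in> E k" for y p
    using that unfolding weak_cell_def by blast
  have sub: "N y \<subseteq> N x" if y: "y \<in> ?W" for y
  proof -
    define z where "z = (1 - 1/2) *\<^sub>R x + (1/2::real) *\<^sub>R y"
    have zW: "z \<in> ?W" using convex_weak_cell[OF k, of \<sigma>] x(1) y unfolding z_def convex_alt
      by (metis zero_le_divide_1_iff zero_le_numeral divide_le_eq_1_pos one_le_numeral zero_less_numeral)
    have pz: "pre p z = (1 - 1/2) * pre p x + 1/2 * pre p y" if "p \<in> E k" for p
      unfolding z_def using E_le[OF that k] by (intro pre_combine[OF k x(1) y]) auto
    have "pre p z \<noteq> 0" if "p \<in> E k" "pre p x \<noteq> 0 \<or> pre p y \<noteq> 0" for p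
    proof (cases "pre p y = 0")
      case True
      then show ?thesis using that pz by simp
    next
      case False
      then have "sgn (pre p y) = \<sigma> p" using sg[OF y that(1)] by (simp add: sgn_zero_iff)
      then have "sgn (pre p z) = \<sigma> p"
        unfolding pz[OF that(1)] using sg[OF x(1) that(1)] by (intro sgn_strict_combine) auto
      then show ?thesis using False \<open>sgn (pre p y) = \<sigma> p\<close> by (metis sgn_zero sgn_zero_iff)
    qed
    then have "N x \<subseteq> N z" "N y \<subseteq> N z" by (auto simp: N_def)
    moreover have "N x = N z" using x(2)[OF zW] \<open>N x \<subseteq> N z\<close> finN card_seteq by metis
    ultimately show ?thesis by simp
  qed
  have "?W = cell_of \<Phi> k x"
  proof (intro Set.set_eqI iffI)
    fix y assume y: "y \<in> ?W"
    have "sgn (pre p y) \<in> {0, sgn (pre p x)}" if p: "p \<in> E k" for p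
    proof (cases "pre p y = 0")
      case False
      then have "pre p x \<noteq> 0" using sub[OF y] p by (auto simp: N_def)
      then have "sgn (pre p x) = \<sigma> p" "sgn (pre p y) = \<sigma> p" 
        using sg[OF x(1) p] sg[OF y p] False by (simp_all add: sgn_zero_iff)
      then show ?thesis by simp
    qed simp
    then show "y \<in> cell_of \<Phi> k x" using y by (simp add: weak_cell_def)
  next
    fix y assume y: "y \<in> cell_of \<Phi> k x"
    have "sgn (pre p y) \<in> {0, \<sigma> p}" if p: "p \<in> E k" for p
    proof -
      have "sgn (pre p y) = 0 \<or> sgn (pre p y) = sgn (pre p x)" using y p by (auto simp: weak_cell_def)
      then show ?thesis using sg[OF x(1) p] by (metis insertI1)
    qed
    then show "y \<in> ?W" using y unfolding weak_cell_def by blast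
  qed
  moreover have "x \<in> L0" using x(1) by (simp add: weak_cell_def)
  ultimately show ?thesis by blast
qed

text \<open>The segment from \<open>z\<close> to a weakly constrained point \<open>y\<close> stays
  in the open class except possibly at \<open>y\<close> itself, so \<open>y\<close> is a limit of
  points of that class.\<close>

lemma arrangement_closure:
  assumes k: "Suc k \<le> m" and z: "z \<in> layer_space \<Phi> k"
  shows "closure {y \<in> layer_space \<Phi> k. \<forall>j\<in>neurons \<Phi> (Suc k).
           sgn (aff_layer \<Phi> (Suc k) y $ j) = sgn (aff_layer \<Phi> (Suc k) z $ j)}
       = {y \<in> layer_space \<Phi> k. \<forall>j\<in>neurons \<Phi> (Suc k).
           sgn (aff_layer \<Phi> (Suc k) y $ j) \<in> {0, sgn (aff_layer \<Phi> (Suc k) z $ j)}}"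
    (is "closure ?O = ?C")
proof
  let ?A = "aff_layer \<Phi> (Suc k)"
  have lin: "linear (layer_lin \<Phi> (Suc k))" using k layer_lin(1)[of "Suc k"] by simp
  have eq: "?A y = layer_lin \<Phi> (Suc k) y + layer_const \<Phi> (Suc k)" if "y \<in> layer_space \<Phi> k" for y
    using that k layer_lin(2)[of "Suc k"] by simp
  have "closed ?C"
  proof -
    have "continuous_on (layer_space \<Phi> k) (\<lambda>y. layer_lin \<Phi> (Suc k) y + layer_const \<Phi> (Suc k))"
      by (intro continuous_intros linear_continuous_on linear_conv_bounded_linear[THEN iffD1] lin)
    then have "continuous_on (layer_space \<Phi> k) ?A"
      by (rule continuous_on_eq) (simp add: eq)
    then have "continuous_on (layer_space \<Phi> k) (\<lambda>y. ?A y $ j)" for j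
      by (intro continuous_intros)
    then have "closed (layer_space \<Phi> k \<inter> (\<lambda>y. ?A y $ j) -` {x. sgn x \<in> {0, sgn (?A z $ j)}})" for j
      using continuous_closed_preimage closed_layer_space closed_sgn_constraint by blast
    then have "closed (layer_space \<Phi> k \<inter> (\<Inter>j\<in>neurons \<Phi> (Suc k).
        layer_space \<Phi> k \<inter> (\<lambda>y. ?A y $ j) -` {x. sgn x \<in> {0, sgn (?A z $ j)}}))"
      by (intro closed_Int closed_INT closed_layer_space) blast
    moreover have "?C = layer_space \<Phi> k \<inter> (\<Inter>j\<in>neurons \<Phi> (Suc k).
        layer_space \<Phi> k \<inter> (\<lambda>y. ?A y $ j) -` {x. sgn x \<in> {0, sgn (?A z $ j)}})"
      by blast
    ultimately show ?thesis by argo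
  qed
  moreover have "?O \<subseteq> ?C" by blast
  ultimately show "closure ?O \<subseteq> ?C" by (intro closure_minimal)
  show "?C \<subseteq> closure ?O"
  proof
    fix y assume y: "y \<in> ?C"
    define s where "s n = (1 - 1 / real (Suc n)) *\<^sub>R y + (1 / real (Suc n)) *\<^sub>R z" for n
    have "s n \<in> ?O" for n
    proof -
      have yk: "y \<in> layer_space \<Phi> k" using y by blast
      have sk: "s n \<in> layer_space \<Phi> k"
        unfolding s_def by (intro subspace_add subspace_mul subspace_layer_space yk z)
      have "?A (s n) = (1 - 1 / real (Suc n)) *\<^sub>R ?A y + (1 / real (Suc n)) *\<^sub>R ?A z"
        unfolding eq[OF sk] eq[OF yk] eq[OF z] unfolding s_def
        by (simp only: linear_add[OF lin] linear_scale[OF lin] scaleR_add_right) (simp add: algebra_simps)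
      then have eqj: "?A (s n) $ j = (1 - 1 / real (Suc n)) * ?A y $ j + 1 / real (Suc n) * ?A z $ j" for j
        by simp
      have "sgn (?A (s n) $ j) = sgn (?A z $ j)" if "j \<in> neurons \<Phi> (Suc k)" for j
      proof -
        have "sgn (?A y $ j) \<in> {0, sgn (?A z $ j)}" using y that by blast
        then show ?thesis unfolding eqj by (rule sgn_strict_combine) simp_all
      qed
      then show ?thesis using sk by blast
    qed
    moreover have "s \<longlonglongrightarrow> (1 - 0) *\<^sub>R y + 0 *\<^sub>R z"
      unfolding s_def by (intro tendsto_intros LIMSEQ_Suc lim_1_over_n)
    then have "s \<longlonglongrightarrow> y" by simp
    ultimately show "y \<in> closure ?O" unfolding closure_sequential by blast
  qed
qed

lemma cell_of_Suc:
  assumes "Suc k \<le> m" "z \<in> layer_space \<Phi> k"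
  shows "weak_cell \<Phi> k \<sigma> \<inter> hidden \<Phi> k -` {y \<in> layer_space \<Phi> k. \<forall>j\<in>neurons \<Phi> (Suc k).
           sgn (aff_layer \<Phi> (Suc k) y $ j) \<in> {0, sgn (aff_layer \<Phi> (Suc k) z $ j)}}
       = weak_cell \<Phi> (Suc k) (\<lambda>p. if p \<in> E k then \<sigma> p else sgn (aff_layer \<Phi> (Suc k) z $ snd p))"
proof -
  have "(Suc k, j) \<notin> E k" for j by (auto simp: entries_upto_def)
  moreover have "hidden \<Phi> k y \<in> layer_space \<Phi> k" if "y \<in> L0" for y
    using hidden_in[of k y] that assms by simp
  ultimately show ?thesis
    unfolding weak_cell_def E_Suc by (auto simp: pre_act_def ball_Un)
qed

text \<open>Intersecting with the next arrangement adds the sign constraints of one layer.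
  Conversely a nonempty combination of constraints is the cell of one of its points, although the
  signs that were combined need not occur together. From here on the recursive complex is handled
  through sign patterns of points.\<close>

lemma partial_cells_eq: "k \<le> m \<Longrightarrow> partial_cells \<Phi> k = cell_of \<Phi> k ` L0"
proof (induction k)
  case 0
  have "weak_cell \<Phi> 0 \<sigma> = L0" for \<sigma> by (auto simp: weak_cell_def entries_upto_def)
  moreover have "L0 \<noteq> {}" using subspace_layer_space subspace_0 by blast
  ultimately show ?case by auto
next
  case (Suc k)
  define R where "R z = {y \<in> layer_space \<Phi> k. \<forall>j\<in>neurons \<Phi> (Suc k).
           sgn (aff_layer \<Phi> (Suc k) y $ j) \<in> {0, sgn (aff_layer \<Phi> (Suc k) z $ j)}}" for z
  have arr: "arrangement_complex \<Phi> (Suc k) = R ` layer_space \<Phi> k"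
    unfolding arrangement_complex_def diff_Suc_1 Setcompr_eq_image
    by (rule image_cong[OF refl]) (simp only: R_def arrangement_closure[OF Suc.prems])
  have IH: "partial_cells \<Phi> k = cell_of \<Phi> k ` L0" using Suc by simp
  have pc: "partial_cells \<Phi> (Suc k) = {cell_of \<Phi> k x \<inter> hidden \<Phi> k -` R z | x z. x \<in> L0 \<and> z \<in> layer_space \<Phi> k} - {{}}"
    unfolding partial_cells.simps arr IH by blast
  note cell_Suc = cell_of_Suc[OF Suc.prems, folded R_def]
  show ?case
  proof (intro Set.set_eqI iffI)
    fix C assume "C \<in> partial_cells \<Phi> (Suc k)"
    then obtain x z where C: "C = cell_of \<Phi> k x \<inter> hidden \<Phi> k -` R z" "z \<in> layer_space \<Phi> k" "C \<noteq> {}"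
      unfolding pc by blast
    then show "C \<in> cell_of \<Phi> (Suc k) ` L0"
      using weak_cell_eq_cell_of[OF Suc.prems] unfolding C(1) cell_Suc[OF C(2)] by blast
  next
    fix C assume "C \<in> cell_of \<Phi> (Suc k) ` L0"
    then obtain x where x: "x \<in> L0" "C = cell_of \<Phi> (Suc k) x" by blast
    have z: "hidden \<Phi> k x \<in> layer_space \<Phi> k" using hidden_in[of k x] x Suc.prems by simp
    have "cell_of \<Phi> k x \<inter> hidden \<Phi> k -` R (hidden \<Phi> k x) = C"
      unfolding cell_Suc[OF z] x(2)
      by (rule weak_cell_cong) (auto simp: E_Suc pre_act_def)
    moreover have "C \<noteq> {}" using mem_cell_of x by blast
    ultimately show "C \<in> partial_cells \<Phi> (Suc k)" unfolding pc using x(1) z by blast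
  qed
qed

lemma cells_eq: "cells \<Phi> = cell_of \<Phi> m ` L0"
  by (simp add: cells_def partial_cells_eq)

text \<open>A point of a convex set is relatively interior iff every segment ending there can be
  prolonged inside the set. A neuron vanishing at \<open>z\<close> but not at \<open>x\<close> would
  change sign on the prolongation from \<open>x\<close>. Conversely, the neurons nonzero at
  \<open>z\<close> keep their sign for a while, and those zero at \<open>z\<close> vanish on the
  whole cell.\<close>

lemma rel_interior_cell_of:
  assumes k: "k \<le> m" and x: "x \<in> L0"
  shows "rel_interior (cell_of \<Phi> k x) = open_cell \<Phi> k x"
proof (intro Set.set_eqI iffI)
  let ?f = "\<lambda>x. frozen_pre \<Phi> (\<lambda>p. sgn (pre p x))"
  have conv: "convex (cell_of \<Phi> k w)" for w by (rule convex_weak_cell[OF k])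
  have comb: "?f x p ((1 - e) *\<^sub>R y + e *\<^sub>R w) = (1 - e) * pre p y + e * pre p w"
    if "p \<in> E k" "y \<in> cell_of \<Phi> k x" "w \<in> cell_of \<Phi> k x" for p y w e x
    using affine_map_combine[OF affine_frozen_pre, of p "\<lambda>p. sgn (pre p x)" e y w] that
      frozen_pre_on_cell[OF k, of _ "\<lambda>p. sgn (pre p x)" p] E_le[OF that(1) k] by simp
  fix z
  {
    assume z: "z \<in> rel_interior (cell_of \<Phi> k x)"
    then obtain e where e: "e > 1" "(1 - e) *\<^sub>R x + e *\<^sub>R z \<in> cell_of \<Phi> k x"
      using convex_rel_interior_iff[OF conv, of x z] mem_cell_of[OF x] by blast
    have zc: "z \<in> cell_of \<Phi> k x" using z rel_interior_subset by blast
    have "sgn (pre p z) = sgn (pre p x)" if p: "p \<in> E k" for p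
    proof (rule ccontr)
      assume ne: "sgn (pre p z) \<noteq> sgn (pre p x)"
      then have 0: "pre p z = 0" using zc p by (auto simp: weak_cell_def sgn_zero_iff)
      have "sgn (?f x p ((1 - e) *\<^sub>R x + e *\<^sub>R z)) \<in> {0, sgn (pre p x)}"
        using e(2) p by (simp add: weak_cell_frozen[OF k])
      then have "sgn ((1 - e) * pre p x) \<in> {0, sgn (pre p x)}"
        using comb[OF p mem_cell_of[OF x] zc, of e] 0 by simp
      moreover have "sgn ((1 - e) * pre p x) = - sgn (pre p x)" using e(1) by (simp add: sgn_mult)
      ultimately show False using ne 0 by auto
    qed
    then show "z \<in> open_cell \<Phi> k x" using zc by (simp add: open_cell_def weak_cell_def)
  next
    assume z: "z \<in> open_cell \<Phi> k x"
    then have zL: "z \<in> L0" by (simp add: open_cell_def)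
    have eq: "cell_of \<Phi> k x = cell_of \<Phi> k z"
      using z by (intro weak_cell_cong) (simp add: open_cell_def)
    have "\<exists>e>1. (1 - e) *\<^sub>R y + e *\<^sub>R z \<in> cell_of \<Phi> k z" if y: "y \<in> cell_of \<Phi> k z" for y
    proof -
      have yL: "y \<in> L0" using y by (simp add: weak_cell_def)
      have "\<forall>\<^sub>F e in at_right 1. sgn ((1 - e) * pre p y + e * pre p z) \<in> {0, sgn (pre p z)}" if p: "p \<in> E k" for p
      proof (cases "pre p z = 0")
        case True
        then have "pre p y = 0" using y p by (auto simp: weak_cell_def sgn_zero_iff)
        then show ?thesis using True by simp
      next
        case False
        have "((\<lambda>e. (1 - e) * pre p y + e * pre p z) \<longlongrightarrow> (1 - 1) * pre p y + 1 * pre p z) (at_right 1)"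
          by (intro tendsto_intros)
        then have "((\<lambda>e. (1 - e) * pre p y + e * pre p z) \<longlongrightarrow> pre p z) (at_right 1)" by simp
        from eventually_sgn_eq[OF this False] show ?thesis by (rule eventually_mono) blast
      qed
      then have "\<forall>\<^sub>F e in at_right 1. \<forall>p\<in>E k. sgn ((1 - e) * pre p y + e * pre p z) \<in> {0, sgn (pre p z)}"
        by (simp add: eventually_ball_finite_distrib del: insert_iff)
      then have "\<forall>\<^sub>F e in at_right 1. 1 < e \<and> (\<forall>p\<in>E k. sgn ((1 - e) * pre p y + e * pre p z) \<in> {0, sgn (pre p z)})"
        using eventually_at_right_less[of "1::real"] by (rule eventually_conj[rotated])
      then obtain e where e: "1 < e" "\<forall>p\<in>E k. sgn ((1 - e) * pre p y + e * pre p z) \<in> {0, sgn (pre p z)}"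
        using eventually_happens'[OF trivial_limit_at_right_real] by blast
      have "(1 - e) *\<^sub>R y + e *\<^sub>R z \<in> L0"
        by (intro subspace_add subspace_mul subspace_layer_space yL zL)
      moreover have "\<forall>p\<in>E k. sgn (?f z p ((1 - e) *\<^sub>R y + e *\<^sub>R z)) \<in> {0, sgn (pre p z)}"
        using e(2) comb[OF _ y mem_cell_of[OF zL], of _ e] by metis
      ultimately have "(1 - e) *\<^sub>R y + e *\<^sub>R z \<in> cell_of \<Phi> k z"
        unfolding weak_cell_frozen[OF k] by blast
      then show ?thesis using e(1) by blast
    qed
    then have "z \<in> rel_interior (cell_of \<Phi> k z)"
      using convex_rel_interior_iff[OF conv, of z z] mem_cell_of[OF zL] by blast
    then show "z \<in> rel_interior (cell_of \<Phi> k x)" using eq by simp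
  }
qed

end

section \<open>Local form of the network\<close>

definition zero_set :: "'d::finite relu_net \<Rightarrow> nat \<Rightarrow> real^'d \<Rightarrow> (nat \<times> 'd) set" where
  "zero_set \<Phi> k x = {p \<in> entries_upto \<Phi> k. pre_act \<Phi> p x = 0}"

context network
begin

abbreviation "Z \<equiv> zero_set \<Phi>"

lemma finite_Z [simp]: "finite (Z k x)"
  by (simp add: zero_set_def)

lemma Z_mono: "j \<le> k \<Longrightarrow> Z j x \<subseteq> Z k x"
  using E_mono by (auto simp: zero_set_def)

lemma Z_Suc: "Z (Suc k) x = Z k x \<union> Pair (Suc k) ` {j \<in> neurons \<Phi> (Suc k). pre (Suc k, j) x = 0}"
  by (auto simp: zero_set_def E_Suc)

lemma eventually_sgn_pre:
  assumes "x \<in> L0"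
  shows "\<forall>\<^sub>F y in nhds x. y \<in> L0 \<longrightarrow> (\<forall>p\<in>E m - Z m x. sgn (pre p y) = sgn (pre p x))"
proof -
  have "\<forall>\<^sub>F y in nhds x. y \<in> L0 \<longrightarrow> sgn (pre p y) = sgn (pre p x)" if p: "p \<in> E m - Z m x" for p
  proof -
    have "(pre p \<longlongrightarrow> pre p x) (at x within L0)"
      using continuous_pre p assms by (auto simp: continuous_on_def)
    moreover have "pre p x \<noteq> 0" using p by (auto simp: zero_set_def)
    ultimately have "\<forall>\<^sub>F y in at x within L0. sgn (pre p y) = sgn (pre p x)" by (rule eventually_sgn_eq)
    then show ?thesis unfolding eventually_at_filter by (rule eventually_mono) auto
  qed
  then have "\<forall>\<^sub>F y in nhds x. \<forall>p\<in>E m - Z m x. y \<in> L0 \<longrightarrow> sgn (pre p y) = sgn (pre p x)"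
    by (intro eventually_ball_finite) auto
  then show ?thesis by (rule eventually_mono) auto
qed

text \<open>
  Near \<open>x\<close> the only nonlinearities are the neurons that vanish at \<open>x\<close>, so the network is a
  linear map plus a combination of the rectified activations of these neurons.
\<close>

lemma hidden_local:
  assumes "k \<le> m" "x \<in> L0"
  shows "\<exists>a c. linear a \<and> (\<forall>\<^sub>F y in nhds x. y \<in> L0 \<longrightarrow>
     hidden \<Phi> k y = hidden \<Phi> k x + a (y - x) + (\<Sum>q\<in>Z k x. max 0 (pre q y) *\<^sub>R c q))"
  using assms(1)
proof (induction k)
  case 0
  have "Z 0 x = {}" by (auto simp: zero_set_def entries_upto_def)
  then have "\<forall>\<^sub>F y in nhds x. y \<in> L0 \<longrightarrow> hidden \<Phi> 0 y = hidden \<Phi> 0 x + id (y - x) + (\<Sum>q\<in>Z 0 x. max 0 (pre q y) *\<^sub>R 0)"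
    by simp
  then show ?case using linear_id by (intro exI conjI)
next
  case (Suc k)
  then obtain a c where a: "linear a" and ev: "\<forall>\<^sub>F y in nhds x. y \<in> L0 \<longrightarrow>
     hidden \<Phi> k y = hidden \<Phi> k x + a (y - x) + (\<Sum>q\<in>Z k x. max 0 (pre q y) *\<^sub>R c q)"
    by auto
  have k: "Suc k \<le> m" by fact
  let ?l = "layer_lin \<Phi> (Suc k)"
  have lin: "linear ?l" using k layer_lin(1)[of "Suc k"] by simp
  have preS: "pre (Suc k, j) y = (?l (hidden \<Phi> k y) + layer_const \<Phi> (Suc k)) $ j" if "y \<in> L0" for y j
    using layer_lin(2)[of "Suc k" "hidden \<Phi> k y"] hidden_in[of k y] that k by (simp add: pre_act_def)
  define J where "J = {j \<in> neurons \<Phi> (Suc k). pre (Suc k, j) x = 0}"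
  \<comment> \<open>Neurons positive at \<open>x\<close> pass on the local form of the previous
    layer, and negative ones stay dead near \<open>x\<close>. A vanishing neuron contributes its own
    rectified term, with an axis vector as coefficient in \<open>c'\<close>.\<close>
  define a' where "a' u = (\<chi> j. if 0 < pre (Suc k, j) x then ?l (a u) $ j else 0)" for u
  define c' where "c' q = (if q \<in> Z k x then \<chi> j. if 0 < pre (Suc k, j) x then ?l (c q) $ j else 0
                           else axis (snd q) 1)" for q :: "nat \<times> 'd"
  have "linear a'"
    unfolding a'_def using a lin by (intro linearI) (simp_all add: vec_eq_iff linear_add linear_scale)
  moreover have "\<forall>\<^sub>F y in nhds x. y \<in> L0 \<longrightarrow>
     hidden \<Phi> (Suc k) y = hidden \<Phi> (Suc k) x + a' (y - x) + (\<Sum>q\<in>Z (Suc k) x. max 0 (pre q y) *\<^sub>R c' q)"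
    using ev eventually_sgn_pre[OF \<open>x \<in> L0\<close>]
  proof eventually_elim
    case (elim y)
    show ?case
    proof
    assume y: "y \<in> L0"
    have hy: "hidden \<Phi> k y = hidden \<Phi> k x + a (y - x) + (\<Sum>q\<in>Z k x. max 0 (pre q y) *\<^sub>R c q)"
      using elim y by blast
    have pre_y: "pre (Suc k, j) y = pre (Suc k, j) x + ?l (a (y - x)) $ j + (\<Sum>q\<in>Z k x. max 0 (pre q y) * ?l (c q) $ j)" for j
      unfolding preS[OF y] preS[OF \<open>x \<in> L0\<close>] hy
      by (simp add: linear_add[OF lin] linear_sum[OF lin] linear_scale[OF lin] sum_component)
    have disj: "Z k x \<inter> Pair (Suc k) ` J = {}" by (auto simp: zero_set_def entries_upto_def)
    have notin: "(Suc k, j) \<notin> Z k x" for j by (auto simp: zero_set_def entries_upto_def)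
    have sum2: "(\<Sum>q\<in>Pair (Suc k) ` J. max 0 (pre q y) *\<^sub>R c' q) $ j = (if j \<in> J then max 0 (pre (Suc k, j) y) else 0)" for j
    proof -
      have "(\<Sum>q\<in>Pair (Suc k) ` J. max 0 (pre q y) *\<^sub>R c' q) $ j = (\<Sum>i\<in>J. max 0 (pre (Suc k, i) y) * axis i 1 $ j)"
        by (subst sum.reindex) (auto simp: inj_on_def c'_def notin sum_component)
      also have "\<dots> = (\<Sum>i\<in>J. if j = i then max 0 (pre (Suc k, i) y) else 0)"
        by (intro sum.cong) (auto simp: axis_def)
      also have "\<dots> = (if j \<in> J then max 0 (pre (Suc k, j) y) else 0)"
        using finite_subset[of J "neurons \<Phi> (Suc k)"] by (simp add: J_def)
      finally show ?thesis .
    qed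
    have sum1: "(\<Sum>q\<in>Z k x. max 0 (pre q y) *\<^sub>R c' q) $ j =
        (if 0 < pre (Suc k, j) x then \<Sum>q\<in>Z k x. max 0 (pre q y) * ?l (c q) $ j else 0)" for j
      by (simp add: sum_component c'_def)
    have "(\<Sum>q\<in>Z (Suc k) x. max 0 (pre q y) *\<^sub>R c' q) =
        (\<Sum>q\<in>Z k x. max 0 (pre q y) *\<^sub>R c' q) + (\<Sum>q\<in>Pair (Suc k) ` J. max 0 (pre q y) *\<^sub>R c' q)"
      unfolding Z_Suc J_def[symmetric] by (intro sum.union_disjoint disj) auto
    then have sum: "(\<Sum>q\<in>Z (Suc k) x. max 0 (pre q y) *\<^sub>R c' q) $ j =
       (if 0 < pre (Suc k, j) x then \<Sum>q\<in>Z k x. max 0 (pre q y) * ?l (c q) $ j else 0) +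
       (if j \<in> J then max 0 (pre (Suc k, j) y) else 0)" for j
      using sum1[of j] sum2[of j] by simp
    have "hidden \<Phi> (Suc k) y $ j =
       (hidden \<Phi> (Suc k) x + a' (y - x) + (\<Sum>q\<in>Z (Suc k) x. max 0 (pre q y) *\<^sub>R c' q)) $ j" for j
    proof -
      have sg: "sgn (pre (Suc k, j) y) = sgn (pre (Suc k, j) x)" if "pre (Suc k, j) x \<noteq> 0" "j \<in> neurons \<Phi> (Suc k)"
      proof -
        have "(Suc k, j) \<in> E m" using that k by (auto simp: entries_upto_def)
        then have "(Suc k, j) \<in> E m - Z m x" using that by (simp add: zero_set_def)
        then show ?thesis using elim(2) y by blast
      qed
      have out: "pre (Suc k, j) y = 0" "pre (Suc k, j) x = 0" if "j \<notin> neurons \<Phi> (Suc k)"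
        using that pre_act_outside[of "Suc k"] k y \<open>x \<in> L0\<close> by auto
      have a'j: "a' (y - x) $ j = (if 0 < pre (Suc k, j) x then ?l (a (y - x)) $ j else 0)" by (simp add: a'_def)
      consider "0 < pre (Suc k, j) x" "j \<in> neurons \<Phi> (Suc k)" | "pre (Suc k, j) x < 0" "j \<in> neurons \<Phi> (Suc k)"
        | "pre (Suc k, j) x = 0" "j \<in> neurons \<Phi> (Suc k)" | "j \<notin> neurons \<Phi> (Suc k)" by linarith
      then have "max 0 (pre (Suc k, j) y) = max 0 (pre (Suc k, j) x) + a' (y - x) $ j +
         (\<Sum>q\<in>Z (Suc k) x. max 0 (pre q y) *\<^sub>R c' q) $ j"
      proof cases
        case 1
        then have "sgn (pre (Suc k, j) y) = 1" using sg by simp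
        then have "0 < pre (Suc k, j) y" by (simp only: sgn_1_pos)
        then have "max 0 (pre (Suc k, j) y) = pre (Suc k, j) y" "max 0 (pre (Suc k, j) x) = pre (Suc k, j) x" "j \<notin> J"
          using 1 by (simp_all add: J_def)
        then show ?thesis using 1(1) pre_y[of j] unfolding sum a'j by simp
      next
        case 2
        then have "sgn (pre (Suc k, j) y) = -1" using sg by simp
        then have "pre (Suc k, j) y < 0" by (simp only: sgn_1_neg)
        then show ?thesis using 2 unfolding sum a'j by (simp add: J_def)
      next
        case 3
        then show ?thesis unfolding sum a'j by (simp add: J_def)
      next
        case 4
        then show ?thesis using out unfolding sum a'j by (simp add: J_def)
      qed
      then show ?thesis using hidden_nth[OF k] by (simp del: hidden.simps)
    qed
    then show "hidden \<Phi> (Suc k) y = hidden \<Phi> (Suc k) x + a' (y - x) + (\<Sum>q\<in>Z (Suc k) x. max 0 (pre q y) *\<^sub>R c' q)"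
      by (simp add: vec_eq_iff del: hidden.simps)
    qed
  qed
  ultimately show ?case by blast
qed

text \<open>The rectified corrections to \<open>\<alpha> p\<close> come from strictly earlier
  layers, as the index \<open>fst p - 1\<close> records. This triangular shape is what makes the
  inductions over layers below possible.\<close>

definition local_form :: "real^'d \<Rightarrow> (nat \<times> 'd \<Rightarrow> real^'d \<Rightarrow> real) \<Rightarrow> (nat \<times> 'd \<Rightarrow> nat \<times> 'd \<Rightarrow> real) \<Rightarrow> bool" where
  "local_form x \<alpha> \<gamma> \<longleftrightarrow> (\<forall>p\<in>Z m x. linear (\<alpha> p)) \<and>
     (\<forall>\<^sub>F y in nhds x. y \<in> L0 \<longrightarrow>
        (\<forall>p\<in>Z m x. pre p y = \<alpha> p (y - x) + (\<Sum>q\<in>Z (fst p - 1) x. \<gamma> p q * max 0 (pre q y))))"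

lemma local_form_exists:
  assumes "x \<in> L0"
  shows "\<exists>\<alpha> \<gamma>. local_form x \<alpha> \<gamma>"
proof -
  have "\<exists>ag. linear (fst ag) \<and> (\<forall>\<^sub>F y in nhds x. y \<in> L0 \<longrightarrow>
        pre p y = fst ag (y - x) + (\<Sum>q\<in>Z (fst p - 1) x. snd ag q * max 0 (pre q y)))" if p: "p \<in> Z m x" for p
  proof -
    have pE: "p \<in> E m" "1 \<le> fst p" "fst p - 1 \<le> m" using p by (auto simp: zero_set_def entries_upto_def)
    obtain a c where a: "linear a" and ev: "\<forall>\<^sub>F y in nhds x. y \<in> L0 \<longrightarrow>
       hidden \<Phi> (fst p - 1) y = hidden \<Phi> (fst p - 1) x + a (y - x) + (\<Sum>q\<in>Z (fst p - 1) x. max 0 (pre q y) *\<^sub>R c q)"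
      using hidden_local[OF pE(3) assms] by blast
    let ?l = "layer_lin \<Phi> (fst p)"
    have lin: "linear ?l" using pE layer_lin(1)[of "fst p"] by (auto simp: entries_upto_def)
    let ?\<alpha> = "\<lambda>u. ?l (a u) $ snd p" and ?\<gamma> = "\<lambda>q. ?l (c q) $ snd p"
    have "linear ?\<alpha>" using a lin by (intro linearI) (simp_all add: linear_add linear_scale)
    moreover have "\<forall>\<^sub>F y in nhds x. y \<in> L0 \<longrightarrow> pre p y = ?\<alpha> (y - x) + (\<Sum>q\<in>Z (fst p - 1) x. ?\<gamma> q * max 0 (pre q y))"
      using ev
    proof (rule eventually_mono, intro impI)
      fix y assume h: "y \<in> L0 \<longrightarrow> hidden \<Phi> (fst p - 1) y = hidden \<Phi> (fst p - 1) x + a (y - x) + (\<Sum>q\<in>Z (fst p - 1) x. max 0 (pre q y) *\<^sub>R c q)"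
        and y: "y \<in> L0"
      have "pre p x = 0" using p by (simp add: zero_set_def)
      then have 0: "(?l (hidden \<Phi> (fst p - 1) x) + layer_const \<Phi> (fst p)) $ snd p = 0"
        using pre_act_eq_lin[OF pE(1) assms] by simp
      have hy: "hidden \<Phi> (fst p - 1) y = hidden \<Phi> (fst p - 1) x + a (y - x) + (\<Sum>q\<in>Z (fst p - 1) x. max 0 (pre q y) *\<^sub>R c q)"
        using h y by blast
      have "?l (hidden \<Phi> (fst p - 1) y) = ?l (hidden \<Phi> (fst p - 1) x) + ?l (a (y - x))
          + (\<Sum>q\<in>Z (fst p - 1) x. max 0 (pre q y) *\<^sub>R ?l (c q))"
        unfolding hy linear_add[OF lin] linear_sum[OF lin] linear_scale[OF lin] ..
      then have "?l (hidden \<Phi> (fst p - 1) y) $ snd p = ?l (hidden \<Phi> (fst p - 1) x) $ snd p + ?\<alpha> (y - x)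
          + (\<Sum>q\<in>Z (fst p - 1) x. ?\<gamma> q * max 0 (pre q y))"
        by (simp only: vector_add_component sum_component vector_scaleR_component real_scaleR_def mult.commute)
      with 0 show "pre p y = ?\<alpha> (y - x) + (\<Sum>q\<in>Z (fst p - 1) x. ?\<gamma> q * max 0 (pre q y))"
        unfolding pre_act_eq_lin[OF pE(1) y] vector_add_component by linarith
    qed
    ultimately show ?thesis
      by (intro exI[of _ "(?\<alpha>, ?\<gamma>)"] conjI) (simp_all only: fst_conv snd_conv)
  qed
  then have "\<forall>p\<in>Z m x. \<exists>ag. linear (fst ag) \<and> (\<forall>\<^sub>F y in nhds x. y \<in> L0 \<longrightarrow>
        pre p y = fst ag (y - x) + (\<Sum>q\<in>Z (fst p - 1) x. snd ag q * max 0 (pre q y)))" by (rule ballI)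
  from bchoice[OF this] obtain ag where ag: "\<And>p. p \<in> Z m x \<Longrightarrow> linear (fst (ag p))"
    "\<And>p. p \<in> Z m x \<Longrightarrow> \<forall>\<^sub>F y in nhds x. y \<in> L0 \<longrightarrow>
        pre p y = fst (ag p) (y - x) + (\<Sum>q\<in>Z (fst p - 1) x. snd (ag p) q * max 0 (pre q y))"
    by blast
  have "\<forall>\<^sub>F y in nhds x. \<forall>p\<in>Z m x. y \<in> L0 \<longrightarrow>
        pre p y = fst (ag p) (y - x) + (\<Sum>q\<in>Z (fst p - 1) x. snd (ag p) q * max 0 (pre q y))"
    using ag(2) by (intro eventually_ball_finite) auto
  then have "\<forall>\<^sub>F y in nhds x. y \<in> L0 \<longrightarrow> (\<forall>p\<in>Z m x.
        pre p y = fst (ag p) (y - x) + (\<Sum>q\<in>Z (fst p - 1) x. snd (ag p) q * max 0 (pre q y)))"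
    by (rule eventually_mono) blast
  then have "local_form x (\<lambda>p. fst (ag p)) (\<lambda>p. snd (ag p))"
    unfolding local_form_def using ag(1) by blast
  then show ?thesis by blast
qed

lemma net_fun_local:
  assumes "x \<in> L0"
  shows "\<exists>\<beta> \<delta>. linear \<beta> \<and> (\<forall>\<^sub>F y in nhds x. y \<in> L0 \<longrightarrow>
     net_fun \<Phi> y = net_fun \<Phi> x + \<beta> (y - x) + (\<Sum>q\<in>Z m x. \<delta> q * max 0 (pre q y)))"
proof -
  obtain a c where a: "linear a" and ev: "\<forall>\<^sub>F y in nhds x. y \<in> L0 \<longrightarrow>
       hidden \<Phi> m y = hidden \<Phi> m x + a (y - x) + (\<Sum>q\<in>Z m x. max 0 (pre q y) *\<^sub>R c q)"
    using hidden_local[OF order_refl assms] by blast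
  obtain L b where L: "linear L" and net: "\<forall>x\<in>L0. net_fun \<Phi> x = L (hidden \<Phi> m x) + b"
    using net_fun_affine_in_hidden by blast
  have lin: "linear (\<lambda>u. L (a u))" using linear_compose[OF a L] by (simp add: o_def)
  have ev': "\<forall>\<^sub>F y in nhds x. y \<in> L0 \<longrightarrow>
     net_fun \<Phi> y = net_fun \<Phi> x + L (a (y - x)) + (\<Sum>q\<in>Z m x. L (c q) * max 0 (pre q y))"
    using ev
  proof (rule eventually_mono, intro impI)
    fix y assume h: "y \<in> L0 \<longrightarrow> hidden \<Phi> m y = hidden \<Phi> m x + a (y - x) + (\<Sum>q\<in>Z m x. max 0 (pre q y) *\<^sub>R c q)"
      and y: "y \<in> L0"
    have hy: "hidden \<Phi> m y = hidden \<Phi> m x + a (y - x) + (\<Sum>q\<in>Z m x. max 0 (pre q y) *\<^sub>R c q)"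
      using h y by blast
    have "L (hidden \<Phi> m y) = L (hidden \<Phi> m x) + L (a (y - x)) + (\<Sum>q\<in>Z m x. L (c q) * max 0 (pre q y))"
      unfolding hy linear_add[OF L] linear_sum[OF L] linear_scale[OF L]
      by (simp only: real_scaleR_def mult.commute)
    then show "net_fun \<Phi> y = net_fun \<Phi> x + L (a (y - x)) + (\<Sum>q\<in>Z m x. L (c q) * max 0 (pre q y))"
      using net y assms by simp
  qed
  show ?thesis
    by (rule exI[of _ "\<lambda>u. L (a u)"], rule exI[of _ "\<lambda>q. L (c q)"], rule conjI[OF lin ev'])
qed

end

section \<open>Transversality\<close>

text \<open>Adding a functional lowers the dimension of the common kernel by at most one. It does so
  exactly when the functional is nonzero on the previous kernel, that is, when its value can be
  corrected without disturbing the earlier ones.\<close>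

lemma dim_common_kernel:
  fixes S :: "'a::euclidean_space set" and f :: "'i \<Rightarrow> 'a \<Rightarrow> real"
  assumes "finite P" "subspace S" "\<And>p. p \<in> P \<Longrightarrow> linear (f p)"
  shows "dim S \<le> dim {u\<in>S. \<forall>p\<in>P. f p u = 0} + card P \<and>
     (dim S = dim {u\<in>S. \<forall>p\<in>P. f p u = 0} + card P \<longleftrightarrow> (\<forall>r. \<exists>u\<in>S. \<forall>p\<in>P. f p u = r p))"
  using assms(1,3)
proof (induction P)
  case empty
  have "0 \<in> S" by (rule subspace_0[OF assms(2)])
  then show ?case by auto
next
  case (insert q P)
  let ?K = "{u\<in>S. \<forall>p\<in>P. f p u = 0}"
  let ?K' = "{u\<in>S. \<forall>p\<in>insert q P. f p u = 0}"
  have lin: "linear (f p)" if "p \<in> insert q P" for p using insert that by blast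
  have sub: "subspace ?K" "subspace ?K'"
    using assms(2) lin by (auto simp: subspace_def linear_0 linear_add linear_scale)
  have IH: "dim S \<le> dim ?K + card P"
    "dim S = dim ?K + card P \<longleftrightarrow> (\<forall>r. \<exists>u\<in>S. \<forall>p\<in>P. f p u = r p)"
    using insert by blast+
  show ?case
  proof (cases "\<exists>u\<in>?K. f q u \<noteq> 0")
    case False
    then have eq: "?K' = ?K" by auto
    have "\<not> (\<forall>r. \<exists>u\<in>S. \<forall>p\<in>insert q P. f p u = r p)"
    proof
      assume "\<forall>r. \<exists>u\<in>S. \<forall>p\<in>insert q P. f p u = r p"
      from this[THEN spec, of "\<lambda>p. if p = q then 1 else 0"]
      obtain u where "u \<in> S" "\<forall>p\<in>insert q P. f p u = (if p = q then 1 else 0)" by blast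
      moreover have "f p u = 0" if "p \<in> P" for p
      proof -
        have "p \<noteq> q" using that insert.hyps by blast
        then show ?thesis using that calculation by simp
      qed
      ultimately show False using False by auto
    qed
    moreover have "dim S < dim ?K' + card (insert q P)" using IH(1) insert.hyps unfolding eq by simp
    ultimately show ?thesis by auto
  next
    case True
    then obtain u where u: "u \<in> ?K" "f q u \<noteq> 0" by blast
    have "span (insert u ?K') = ?K"
    proof (rule span_eq_iff[THEN iffD2, THEN subst[where P = "\<lambda>X. _ = X"]])
      show "subspace ?K" by (rule sub)
      show "span (insert u ?K') = span ?K"
      proof (rule span_eq[THEN iffD2], intro conjI)
        show "insert u ?K' \<subseteq> span ?K" using u by (auto intro: span_base)
        show "?K \<subseteq> span (insert u ?K')"
        proof
          fix w assume w: "w \<in> ?K"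
          let ?w = "w - (f q w / f q u) *\<^sub>R u"
          have "?w \<in> ?K" by (intro subspace_diff subspace_mul sub w u)
          moreover have "f q ?w = 0" using u lin by (simp add: linear_diff linear_scale)
          ultimately have "?w \<in> span (insert u ?K')" by (intro span_base) auto
          then have "?w + (f q w / f q u) *\<^sub>R u \<in> span (insert u ?K')"
            by (intro span_add span_mul) (auto intro: span_base)
          then show "w \<in> span (insert u ?K')" by simp
        qed
      qed
    qed
    then have "dim ?K = dim (insert u ?K')" using dim_span[of "insert u ?K'"] by (simp only:)
    moreover have "u \<notin> span ?K'" unfolding span_eq_iff[THEN iffD2, OF sub(2)] using u by blast
    ultimately have dimK: "dim ?K = dim ?K' + 1" by (simp only: dim_insert if_False)
    have "(\<forall>r. \<exists>u\<in>S. \<forall>p\<in>insert q P. f p u = r p) \<longleftrightarrow> (\<forall>r. \<exists>u\<in>S. \<forall>p\<in>P. f p u = r p)"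
    proof
      assume R: "\<forall>r. \<exists>u\<in>S. \<forall>p\<in>P. f p u = r p"
      show "\<forall>r. \<exists>u\<in>S. \<forall>p\<in>insert q P. f p u = r p"
      proof
        fix r
        obtain w where w: "w \<in> S" "\<forall>p\<in>P. f p w = r p" using R by blast
        let ?w = "w + ((r q - f q w) / f q u) *\<^sub>R u"
        have "?w \<in> S" using w u by (auto intro!: subspace_add subspace_mul assms(2))
        moreover have "f p ?w = r p" if "p \<in> insert q P" for p
          using that w u lin[OF that] by (auto simp: linear_add linear_scale)
        ultimately show "\<exists>u\<in>S. \<forall>p\<in>insert q P. f p u = r p" by blast
      qed
    qed blast
    then show ?thesis using IH dimK insert.hyps by simp
  qed
qed

section \<open>Tangent spaces of open cells\<close>

context network
begin

text \<open>The local form shows by induction over layers that the vanishing neurons remain zero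
  along the ray; the others keep their sign by continuity. Both signs of \<open>t\<close> are
  covered, because a two-sided derivative along \<open>u\<close> is taken later.\<close>

lemma ray_in_open_cell:
  assumes x: "x \<in> L0" and lf: "local_form x \<alpha> \<gamma>" and k: "k \<le> m"
    and u: "u \<in> L0" "\<forall>p\<in>Z k x. \<alpha> p u = 0"
  shows "\<forall>\<^sub>F t in nhds (0::real). x + t *\<^sub>R u \<in> open_cell \<Phi> k x"
proof -
  have "((\<lambda>t. x + t *\<^sub>R u) \<longlongrightarrow> x + 0 *\<^sub>R u) (nhds (0::real))"
    by (intro tendsto_intros filterlim_ident)
  then have lim: "filterlim (\<lambda>t. x + t *\<^sub>R u) (nhds x) (nhds (0::real))" by simp
  have lin: "linear (\<alpha> p)" if "p \<in> Z m x" for p using lf that by (auto simp: local_form_def)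
  have "\<forall>\<^sub>F y in nhds x. y \<in> L0 \<longrightarrow> (\<forall>p\<in>E m - Z m x. sgn (pre p y) = sgn (pre p x)) \<and>
        (\<forall>p\<in>Z m x. pre p y = \<alpha> p (y - x) + (\<Sum>q\<in>Z (fst p - 1) x. \<gamma> p q * max 0 (pre q y)))"
    using eventually_sgn_pre[OF x] lf[unfolded local_form_def, THEN conjunct2] by eventually_elim blast
  then have "\<forall>\<^sub>F t in nhds 0. x + t *\<^sub>R u \<in> L0 \<longrightarrow>
       (\<forall>p\<in>E m - Z m x. sgn (pre p (x + t *\<^sub>R u)) = sgn (pre p x)) \<and>
       (\<forall>p\<in>Z m x. pre p (x + t *\<^sub>R u) = \<alpha> p (x + t *\<^sub>R u - x) + (\<Sum>q\<in>Z (fst p - 1) x. \<gamma> p q * max 0 (pre q (x + t *\<^sub>R u))))"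
    using lim by (rule eventually_compose_filterlim)
  then show ?thesis
  proof (rule eventually_mono)
    fix t assume *: "x + t *\<^sub>R u \<in> L0 \<longrightarrow>
       (\<forall>p\<in>E m - Z m x. sgn (pre p (x + t *\<^sub>R u)) = sgn (pre p x)) \<and>
       (\<forall>p\<in>Z m x. pre p (x + t *\<^sub>R u) = \<alpha> p (x + t *\<^sub>R u - x) + (\<Sum>q\<in>Z (fst p - 1) x. \<gamma> p q * max 0 (pre q (x + t *\<^sub>R u))))"
    let ?y = "x + t *\<^sub>R u"
    have y: "?y \<in> L0" by (intro subspace_add subspace_mul subspace_layer_space x u)
    note nz = *[THEN mp, OF y, THEN conjunct1] and lf = *[THEN mp, OF y, THEN conjunct2]
    have zero: "p \<in> Z k x \<Longrightarrow> pre p ?y = 0" for p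
    proof (induction "fst p" arbitrary: p rule: less_induct)
      case less
      have p: "p \<in> Z m x" using less.prems Z_mono[OF k] by blast
      have "\<alpha> p (?y - x) = 0" using less.prems u lin[OF p] by (simp add: linear_scale)
      moreover have "pre q ?y = 0" if "q \<in> Z (fst p - 1) x" for q
      proof -
        have "fst p \<le> k" "1 \<le> fst p" "1 \<le> fst q" "fst q \<le> fst p - 1"
          using less.prems that by (auto simp: zero_set_def entries_upto_def)
        then have "fst q < fst p" "fst p - 1 \<le> k" by linarith+
        then show ?thesis using less.hyps[of q] Z_mono[of "fst p - 1" k x] that by blast
      qed
      ultimately show ?case using lf p by simp
    qed
    have "sgn (pre p ?y) = sgn (pre p x)" if p: "p \<in> E k" for p
    proof (cases "pre p x = 0")
      case True
      then have "p \<in> Z k x" using p by (simp add: zero_set_def)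
      then show ?thesis using zero True by simp
    next
      case False
      then have "p \<in> E m - Z m x" using p E_mono[OF k] by (auto simp: zero_set_def)
      then show ?thesis using nz by blast
    qed
    then show "?y \<in> open_cell \<Phi> k x" using y by (simp add: open_cell_def)
  qed
qed

lemma open_cell_combine:
  assumes "k \<le> m" "y \<in> cell_of \<Phi> k x" "z \<in> open_cell \<Phi> k x" "0 < t" "t \<le> 1"
  shows "(1 - t) *\<^sub>R y + t *\<^sub>R z \<in> open_cell \<Phi> k x"
proof -
  have zc: "z \<in> cell_of \<Phi> k x" using assms open_cell_sub by blast
  have L: "(1 - t) *\<^sub>R y + t *\<^sub>R z \<in> L0"
    using assms by (intro subspace_add subspace_mul subspace_layer_space) (auto simp: weak_cell_def open_cell_def)
  have "sgn (pre p ((1 - t) *\<^sub>R y + t *\<^sub>R z)) = sgn (pre p x)" if p: "p \<in> E k" for p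
  proof -
    have "pre p ((1 - t) *\<^sub>R y + t *\<^sub>R z) = (1 - t) * pre p y + t * pre p z"
      using E_le[OF p] assms zc by (intro pre_combine[OF assms(1,2) zc]) auto
    moreover have "sgn (pre p y) \<in> {0, sgn (pre p x)}" using assms(2) p unfolding weak_cell_def by blast
    moreover have "sgn (pre p z) = sgn (pre p x)" using assms(3) p unfolding open_cell_def by blast
    ultimately show ?thesis using sgn_strict_combine assms by metis
  qed
  then show ?thesis using L by (simp add: open_cell_def)
qed

text \<open>The local form holds near \<open>x\<close> only, so \<open>y\<close> is first moved
  towards \<open>x\<close> inside the open cell; linearity of \<open>\<alpha> p\<close> then carries
  the conclusion back to \<open>y\<close>.\<close>

lemma kernel_on_open_cell:
  assumes x: "x \<in> L0" and lf: "local_form x \<alpha> \<gamma>" and k: "k \<le> m" and y: "y \<in> open_cell \<Phi> k x"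
    and p: "p \<in> Z k x"
  shows "\<alpha> p (y - x) = 0"
proof -
  have "((\<lambda>t. (1 - t) *\<^sub>R x + t *\<^sub>R y) \<longlongrightarrow> (1 - 0) *\<^sub>R x + 0 *\<^sub>R y) (at_right (0::real))"
    by (intro tendsto_intros)
  then have lim: "filterlim (\<lambda>t. (1 - t) *\<^sub>R x + t *\<^sub>R y) (nhds x) (at_right (0::real))" by simp
  have pm: "p \<in> Z m x" using p Z_mono[OF k] by blast
  have lin: "linear (\<alpha> p)" using lf pm by (auto simp: local_form_def)
  have "\<forall>\<^sub>F t in at_right 0. (1 - t) *\<^sub>R x + t *\<^sub>R y \<in> L0 \<longrightarrow> (\<forall>p\<in>Z m x. pre p ((1 - t) *\<^sub>R x + t *\<^sub>R y)
      = \<alpha> p ((1 - t) *\<^sub>R x + t *\<^sub>R y - x) + (\<Sum>q\<in>Z (fst p - 1) x. \<gamma> p q * max 0 (pre q ((1 - t) *\<^sub>R x + t *\<^sub>R y))))"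
    using lf[unfolded local_form_def, THEN conjunct2] lim by (rule eventually_compose_filterlim)
  moreover have "\<forall>\<^sub>F t in at_right 0. (t::real) < 1"
    by (rule eventually_at_rightI[of 0 1]) auto
  moreover have "\<forall>\<^sub>F t in at_right 0. (0::real) < t"
    by (rule eventually_at_right_less)
  ultimately have "\<forall>\<^sub>F t in at_right (0::real). \<alpha> p (y - x) = 0"
  proof eventually_elim
    case (elim t)
    let ?z = "(1 - t) *\<^sub>R x + t *\<^sub>R y"
    have z: "?z \<in> open_cell \<Phi> k x"
      using elim by (intro open_cell_combine[OF k mem_cell_of[OF x] y]) auto
    have 0: "pre q ?z = 0" if "q \<in> Z k x" for q
      using z that by (auto simp: open_cell_def zero_set_def sgn_zero_iff)
    have "fst p - 1 \<le> k" using p by (auto simp: zero_set_def entries_upto_def)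
    then have "(\<Sum>q\<in>Z (fst p - 1) x. \<gamma> p q * max 0 (pre q ?z)) = 0"
      using 0 Z_mono[of "fst p - 1" k x] by (intro sum.neutral) auto
    moreover have "?z \<in> L0" using z by (simp add: open_cell_def)
    ultimately have "\<alpha> p (?z - x) = 0" using elim(1) pm 0[OF p] by auto
    moreover have "?z - x = t *\<^sub>R (y - x)" by (simp add: algebra_simps)
    ultimately show ?case using elim lin by (simp add: linear_scale)
  qed
  then show ?thesis by (simp add: trivial_limit_at_right_real)
qed

text \<open>Turns the tangent space in the definition of transversality into a kernel: differences
  of points of the cell are killed by the functionals, and small multiples of kernel vectors are
  such differences.\<close>

lemma tangent_open_cell:
  assumes x: "x \<in> L0" and lf: "local_form x \<alpha> \<gamma>" and k: "k \<le> m"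
  shows "tangent (open_cell \<Phi> k x) = {u \<in> L0. \<forall>p\<in>Z k x. \<alpha> p u = 0}" (is "_ = ?K")
proof
  have lin: "linear (\<alpha> p)" if "p \<in> Z k x" for p
    using lf that Z_mono[OF k] by (auto simp: local_form_def)
  have sub: "subspace ?K"
    using subspace_layer_space[of \<Phi> 0] lin by (auto simp: subspace_def linear_0 linear_add linear_scale)
  have "y - z \<in> ?K" if y: "y \<in> open_cell \<Phi> k x" and z: "z \<in> open_cell \<Phi> k x" for y z
  proof -
    have "\<alpha> p (y - z) = 0" if p: "p \<in> Z k x" for p
    proof -
      have "\<alpha> p (y - z) = \<alpha> p (y - x) - \<alpha> p (z - x)"
        using linear_diff[OF lin[OF p], of "y - x" "z - x"] by simp
      then show ?thesis using kernel_on_open_cell[OF x lf k _ p] y z by simp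
    qed
    moreover have "y - z \<in> L0" using y z by (auto simp: open_cell_def intro!: subspace_diff subspace_layer_space)
    ultimately show ?thesis by blast
  qed
  then show "tangent (open_cell \<Phi> k x) \<subseteq> ?K"
    unfolding tangent_def by (intro span_minimal sub) blast
  show "?K \<subseteq> tangent (open_cell \<Phi> k x)"
  proof
    fix u assume u: "u \<in> ?K"
    then have "\<forall>\<^sub>F t in nhds (0::real). x + t *\<^sub>R u \<in> open_cell \<Phi> k x"
      using ray_in_open_cell[OF x lf k] by blast
    then have "\<forall>\<^sub>F t in at_right (0::real). x + t *\<^sub>R u \<in> open_cell \<Phi> k x"
      by (rule filter_leD[rotated]) (simp add: at_within_le_nhds)
    then have "\<forall>\<^sub>F t in at_right (0::real). 0 < t \<and> x + t *\<^sub>R u \<in> open_cell \<Phi> k x"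
      using eventually_at_right_less by (rule eventually_conj[rotated])
    then obtain t where t: "0 < (t::real)" "x + t *\<^sub>R u \<in> open_cell \<Phi> k x"
      using eventually_happens'[OF trivial_limit_at_right_real] by blast
    then have "(x + t *\<^sub>R u) - x \<in> tangent (open_cell \<Phi> k x)"
      unfolding tangent_def using mem_open_cell[OF x] by (intro span_base) blast
    then have "(1 / t) *\<^sub>R ((x + t *\<^sub>R u) - x) \<in> tangent (open_cell \<Phi> k x)"
      unfolding tangent_def by (rule span_mul)
    then show "u \<in> tangent (open_cell \<Phi> k x)" using t by simp
  qed
qed

end

section \<open>Independence of the local functionals\<close>

locale transversal_network = network +
  assumes supertransversal: "supertransversal \<Phi>" and generic: "generic \<Phi>"
begin

text \<open>The intersection of the hyperplanes is a translate of the common kernel of the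
  functionals. Genericity gives its dimension, and the count makes the functionals jointly
  surjective. The point \<open>z\<close> rules out the alternative of an empty intersection.\<close>

lemma layer_functionals_surj:
  assumes k: "Suc k \<le> m" and J: "J \<subseteq> neurons \<Phi> (Suc k)" and z: "z \<in> hyperplane_meet \<Phi> (Suc k) J"
  shows "\<exists>w\<in>layer_space \<Phi> k. \<forall>j\<in>J. layer_lin \<Phi> (Suc k) w $ j = s j"
proof -
  let ?l = "layer_lin \<Phi> (Suc k)" and ?L = "layer_space \<Phi> k"
  have lin: "linear ?l" using k layer_lin(1)[of "Suc k"] by simp
  have aff: "aff_layer \<Phi> (Suc k) y = ?l y + layer_const \<Phi> (Suc k)" if "y \<in> ?L" for y
    using that k layer_lin(2)[of "Suc k"] by simp
  have meet: "hyperplane_meet \<Phi> (Suc k) J = {y \<in> ?L. \<forall>j\<in>J. (?l y + layer_const \<Phi> (Suc k)) $ j = 0}"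
    using aff unfolding hyperplane_meet_def neuron_hyperplane_def diff_Suc_1 by auto
  let ?K = "{u\<in>?L. \<forall>j\<in>J. ?l u $ j = 0}"
  have zL: "z \<in> ?L" and zJ: "\<And>j. j \<in> J \<Longrightarrow> ?l z $ j = - layer_const \<Phi> (Suc k) $ j"
    using z unfolding meet by (auto simp: eq_neg_iff_add_eq_0)
  have linj: "linear (\<lambda>u. ?l u $ j)" for j
    using lin by (intro linearI) (simp_all add: linear_add linear_scale)
  have "hyperplane_meet \<Phi> (Suc k) J = (+) z ` ?K"
  proof (intro Set.set_eqI iffI)
    fix y assume y: "y \<in> hyperplane_meet \<Phi> (Suc k) J"
    have "y - z \<in> ?L" using y zL unfolding meet by (auto intro!: subspace_diff subspace_layer_space)
    moreover have "?l (y - z) $ j = 0" if "j \<in> J" for j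
      using y zJ[OF that] that unfolding meet by (auto simp: linear_diff[OF lin] eq_neg_iff_add_eq_0)
    ultimately have "y - z \<in> ?K" by blast
    then have "z + (y - z) \<in> (+) z ` ?K" by (rule imageI)
    then show "y \<in> (+) z ` ?K" by simp
  next
    fix y assume "y \<in> (+) z ` ?K"
    then obtain u where u: "y = z + u" "u \<in> ?L" "\<And>j. j \<in> J \<Longrightarrow> ?l u $ j = 0" by blast
    have "y \<in> ?L" unfolding u(1) by (intro subspace_add subspace_layer_space zL u)
    then show "y \<in> hyperplane_meet \<Phi> (Suc k) J"
      unfolding meet u(1) using u zJ by (auto simp: linear_add[OF lin])
  qed
  moreover have "subspace ?K"
    using subspace_layer_space[of \<Phi> k] linj by (auto simp: subspace_def linear_0[OF lin] linear_add[OF lin] linear_scale[OF lin])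
  ultimately have "aff_dim (hyperplane_meet \<Phi> (Suc k) J) = int (dim ?K)"
    by (simp add: aff_dim_translation_eq aff_dim_subspace)
  moreover have g: "if card J \<le> card (neurons \<Phi> k)
     then aff_dim (hyperplane_meet \<Phi> (Suc k) J) = int (card (neurons \<Phi> k)) - int (card J)
     else hyperplane_meet \<Phi> (Suc k) J = {}"
    using generic k J unfolding generic_def by (auto dest!: bspec[of _ _ "Suc k"])
  moreover have "card J \<le> card (neurons \<Phi> k)" using g z by (auto split: if_splits)
  ultimately have "dim ?L = dim ?K + card J" by (simp add: dim_layer_space)
  moreover have "finite J" by simp
  ultimately have "\<exists>u\<in>?L. \<forall>j\<in>J. ?l u $ j = s j"
    using dim_common_kernel[OF \<open>finite J\<close> subspace_layer_space[of \<Phi> k], of "\<lambda>j u. ?l u $ j"] linj by blast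
  then show ?thesis .
qed

text \<open>Induction over layers. On the tangent space of the cell of level \<open>k\<close> all
  earlier functionals vanish, and the new ones are the derivative of \<open>hidden \<Phi> k\<close>
  followed by the next layer. Supertransversality writes any vector of the layer space as such a
  derivative plus a vector tangent to the hyperplanes, which the new functionals do not see. So
  their values can be adjusted without changing the earlier ones.\<close>

lemma local_form_surj:
  assumes x: "x \<in> L0" and lf: "local_form x \<alpha> \<gamma>"
  shows "k \<le> m \<Longrightarrow> \<exists>u\<in>L0. \<forall>p\<in>Z k x. \<alpha> p u = r p"
proof (induction k arbitrary: r)
  case 0
  have "Z 0 x = {}" by (auto simp: zero_set_def entries_upto_def)
  then show ?case using x by blast
next
  case (Suc k)
  have k: "Suc k \<le> m" "k \<le> m" using Suc.prems by auto
  define J where "J = {j \<in> neurons \<Phi> (Suc k). pre (Suc k, j) x = 0}"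
  let ?l = "layer_lin \<Phi> (Suc k)" and ?C = "cell_of \<Phi> k x" and ?O = "open_cell \<Phi> k x"
  have lin: "linear ?l" using k layer_lin(1)[of "Suc k"] by simp
  have ZJ: "(Suc k, j) \<in> Z (Suc k) x" "(Suc k, j) \<in> Z m x" if "j \<in> J" for j
    using that Z_mono[OF k(1)] by (auto simp: Z_Suc J_def)
  have hx: "hidden \<Phi> k x \<in> hyperplane_meet \<Phi> (Suc k) J"
    using hidden_in[OF k(2) x] by (auto simp: hyperplane_meet_def neuron_hyperplane_def J_def pre_act_def)
  have "?C \<in> partial_cells \<Phi> k" using partial_cells_eq[OF k(2)] x by blast
  moreover have "J \<subseteq> neurons \<Phi> (Suc k)" by (auto simp: J_def)
  ultimately have "transverse_on (hidden \<Phi> k) ?O (hyperplane_meet \<Phi> (Suc k) J) (layer_space \<Phi> k)"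
    using supertransversal k rel_interior_cell_of[OF k(2) x]
    unfolding supertransversal_def by (metis atLeastAtMost_iff diff_Suc_1 le_add1 plus_1_eq_Suc)
  then obtain D where D: "(hidden \<Phi> k has_derivative D) (at x within ?O)"
    "{D u + w | u w. u \<in> tangent ?O \<and> w \<in> tangent (hyperplane_meet \<Phi> (Suc k) J)} = layer_space \<Phi> k"
    using mem_open_cell[OF x] hx unfolding transverse_on_def by blast
  have tanN: "?l w $ j = 0" if "w \<in> tangent (hyperplane_meet \<Phi> (Suc k) J)" "j \<in> J" for w j
  proof -
    have "subspace {w. ?l w $ j = 0}" by (auto simp: subspace_def linear_0[OF lin] linear_add[OF lin] linear_scale[OF lin])
    moreover have "{y - x |x y. x \<in> hyperplane_meet \<Phi> (Suc k) J \<and> y \<in> hyperplane_meet \<Phi> (Suc k) J} \<subseteq> {w. ?l w $ j = 0}"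
    proof clarify
      fix y z assume yz: "y \<in> hyperplane_meet \<Phi> (Suc k) J" "z \<in> hyperplane_meet \<Phi> (Suc k) J"
      have "aff_layer \<Phi> (Suc k) w $ j = 0" "aff_layer \<Phi> (Suc k) w = ?l w + layer_const \<Phi> (Suc k)"
        if "w \<in> hyperplane_meet \<Phi> (Suc k) J" for w
        using that \<open>j \<in> J\<close> k(1) layer_lin(2)[of "Suc k" w] by (auto simp: hyperplane_meet_def neuron_hyperplane_def)
      from this[OF yz(1)] this[OF yz(2)] show "?l (z - y) $ j = 0"
        by (simp add: linear_diff[OF lin] add_eq_0_iff)
    qed
    ultimately have "tangent (hyperplane_meet \<Phi> (Suc k) J) \<subseteq> {w. ?l w $ j = 0}"
      unfolding tangent_def by (rule span_minimal[rotated])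
    then show ?thesis using that by blast
  qed
  \<comment> \<open>Two expressions for the derivative along \<open>x + t *\<^sub>R u\<close> are
    compared: the chain rule through \<open>D\<close>, and the local form, whose rectified terms
    vanish on the open cell.\<close>
  have deriv: "?l (D u) $ j = \<alpha> (Suc k, j) u" if u: "u \<in> tangent ?O" and j: "j \<in> J" for u j
  proof -
    have uK: "u \<in> L0" "\<forall>p\<in>Z k x. \<alpha> p u = 0" using u tangent_open_cell[OF x lf k(2)] by auto
    have ray: "\<forall>\<^sub>F t in nhds (0::real). x + t *\<^sub>R u \<in> ?O" by (rule ray_in_open_cell[OF x lf k(2) uK])
    obtain e where e: "0 < e" "\<And>t. \<bar>t\<bar> < e \<Longrightarrow> x + t *\<^sub>R u \<in> ?O"
      using ray unfolding eventually_nhds_metric by (auto simp: dist_real_def)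
    have "((\<lambda>t. x + t *\<^sub>R u) has_derivative (\<lambda>t. t *\<^sub>R u)) (at 0 within {-e<..<e})"
      by (auto intro!: derivative_eq_intros)
    moreover have "(hidden \<Phi> k has_derivative D) (at x within (\<lambda>t. x + t *\<^sub>R u) ` {-e<..<e})"
      by (rule has_derivative_subset[OF D(1)]) (use e in auto)
    then have "(hidden \<Phi> k has_derivative D) (at (x + 0 *\<^sub>R u) within (\<lambda>t. x + t *\<^sub>R u) ` {-e<..<e})"
      by simp
    ultimately have "((\<lambda>t. hidden \<Phi> k (x + t *\<^sub>R u)) has_derivative (\<lambda>t. D (t *\<^sub>R u))) (at 0 within {-e<..<e})"
      by (rule has_derivative_in_compose)
    then have "((\<lambda>t. hidden \<Phi> k (x + t *\<^sub>R u)) has_derivative (\<lambda>t. D (t *\<^sub>R u))) (at 0)"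
      using e(1) by (subst (asm) at_within_open) auto
    moreover have "bounded_linear (\<lambda>w. ?l w $ j)"
      using lin by (intro linear_conv_bounded_linear[THEN iffD1] linearI) (simp_all add: linear_add linear_scale)
    ultimately have "((\<lambda>t. ?l (hidden \<Phi> k (x + t *\<^sub>R u)) $ j) has_derivative (\<lambda>t. ?l (D (t *\<^sub>R u)) $ j)) (at 0)"
      by (rule bounded_linear.has_derivative[rotated])
    then have d1: "((\<lambda>t. ?l (hidden \<Phi> k (x + t *\<^sub>R u)) $ j + layer_const \<Phi> (Suc k) $ j) has_derivative (\<lambda>t. ?l (D (t *\<^sub>R u)) $ j)) (at 0)"
      by (auto intro!: derivative_eq_intros)
    have "((\<lambda>t. x + t *\<^sub>R u) \<longlongrightarrow> x + 0 *\<^sub>R u) (nhds (0::real))" by (intro tendsto_intros filterlim_ident)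
    then have lim: "filterlim (\<lambda>t. x + t *\<^sub>R u) (nhds x) (nhds (0::real))" by simp
    have "\<forall>\<^sub>F t in nhds (0::real). x + t *\<^sub>R u \<in> L0 \<longrightarrow> (\<forall>p\<in>Z m x. pre p (x + t *\<^sub>R u)
      = \<alpha> p (x + t *\<^sub>R u - x) + (\<Sum>q\<in>Z (fst p - 1) x. \<gamma> p q * max 0 (pre q (x + t *\<^sub>R u))))"
      using lf[unfolded local_form_def, THEN conjunct2] lim by (rule eventually_compose_filterlim)
    with ray have ev: "\<forall>\<^sub>F t in nhds (0::real). ?l (hidden \<Phi> k (x + t *\<^sub>R u)) $ j + layer_const \<Phi> (Suc k) $ j = t * \<alpha> (Suc k, j) u"
    proof eventually_elim
      case (elim t)
      let ?y = "x + t *\<^sub>R u"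
      have y: "?y \<in> L0" using elim by (simp add: open_cell_def)
      have "pre q ?y = 0" if "q \<in> Z k x" for q
        using elim(1) that by (auto simp: open_cell_def zero_set_def sgn_zero_iff)
      then have "(\<Sum>q\<in>Z k x. \<gamma> (Suc k, j) q * max 0 (pre q ?y)) = 0" by (intro sum.neutral) auto
      moreover have "pre (Suc k, j) ?y = \<alpha> (Suc k, j) (?y - x) + (\<Sum>q\<in>Z k x. \<gamma> (Suc k, j) q * max 0 (pre q ?y))"
        using elim(2)[THEN mp, OF y, THEN bspec, OF ZJ(2)[OF j]] by simp
      moreover have "linear (\<alpha> (Suc k, j))" using lf ZJ(2)[OF j] by (auto simp: local_form_def)
      moreover have "(Suc k, j) \<in> E m" using ZJ(2)[OF j] by (simp add: zero_set_def)
      ultimately show ?case using pre_act_eq_lin[OF _ y, of "(Suc k, j)"] by (simp add: linear_scale)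
    qed
    have "((\<lambda>t. t * \<alpha> (Suc k, j) u) has_derivative (\<lambda>t. t * \<alpha> (Suc k, j) u)) (at 0)"
      by (auto intro!: derivative_eq_intros)
    moreover have "((\<lambda>t. t * \<alpha> (Suc k, j) u) has_derivative (\<lambda>t. ?l (D (t *\<^sub>R u)) $ j)) (at 0)"
      by (rule has_derivative_transform_eventually[OF d1 filter_leD[OF at_within_le_nhds ev]
            eventually_nhds_x_imp_x[OF ev] UNIV_I])
    ultimately have "(\<lambda>t. t * \<alpha> (Suc k, j) u) = (\<lambda>t. ?l (D (t *\<^sub>R u)) $ j)"
      by (rule has_derivative_unique)
    from fun_cong[OF this, of 1] show ?thesis by simp
  qed
  \<comment> \<open>\<open>u0\<close> settles the earlier layers. The vector \<open>w\<close>
    encodes the defect left in the new layer, and its derivative part yields the correction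
    \<open>u\<close>.\<close>
  obtain u0 where u0: "u0 \<in> L0" "\<forall>p\<in>Z k x. \<alpha> p u0 = r p" using Suc.IH k by blast
  obtain w where w: "w \<in> layer_space \<Phi> k" "\<forall>j\<in>J. ?l w $ j = r (Suc k, j) - \<alpha> (Suc k, j) u0"
    using layer_functionals_surj[OF k(1) _ hx, of "\<lambda>j. r (Suc k, j) - \<alpha> (Suc k, j) u0"] by (auto simp: J_def)
  then obtain u v where uv: "w = D u + v" "u \<in> tangent ?O" "v \<in> tangent (hyperplane_meet \<Phi> (Suc k) J)"
    using D(2) by blast
  have uK: "u \<in> L0" "\<forall>p\<in>Z k x. \<alpha> p u = 0" using uv tangent_open_cell[OF x lf k(2)] by auto
  have "\<alpha> p (u0 + u) = r p" if p: "p \<in> Z (Suc k) x" for p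
  proof -
    have lp: "linear (\<alpha> p)" using lf p Z_mono[OF k(1)] by (auto simp: local_form_def)
    consider "p \<in> Z k x" | j where "p = (Suc k, j)" "j \<in> J" using p unfolding Z_Suc J_def by blast
    then show ?thesis
    proof cases
      case 1
      then show ?thesis using u0 uK by (simp add: linear_add[OF lp])
    next
      case 2
      have "?l w $ j = \<alpha> (Suc k, j) u"
        using deriv[OF uv(2) 2(2)] tanN[OF uv(3) 2(2)] by (simp add: uv(1) linear_add[OF lin])
      then show ?thesis using w(2) 2 linear_add[OF lp, of u0 u] by auto
    qed
  qed
  moreover have "u0 + u \<in> L0" by (intro subspace_add subspace_layer_space u0 uK)
  ultimately show ?case by blast
qed

end

section \<open>Charts at a vertex\<close>

context network
begin

lemma net_fun_affine_on_cell:
  assumes "y \<in> weak_cell \<Phi> m \<sigma>" "z \<in> weak_cell \<Phi> m \<sigma>" "0 \<le> t" "t \<le> 1"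
  shows "net_fun \<Phi> ((1 - t) *\<^sub>R y + t *\<^sub>R z) = (1 - t) * net_fun \<Phi> y + t * net_fun \<Phi> z"
proof -
  have w: "(1 - t) *\<^sub>R y + t *\<^sub>R z \<in> weak_cell \<Phi> m \<sigma>"
    using convex_weak_cell[OF order_refl, of \<sigma>] assms unfolding convex_alt by blast
  have sub: "weak_cell \<Phi> m \<sigma> \<subseteq> L0" by (auto simp: weak_cell_def)
  obtain L b where L: "linear L" and net: "\<forall>x\<in>L0. net_fun \<Phi> x = L (hidden \<Phi> m x) + b"
    using net_fun_affine_in_hidden by blast
  have F: "net_fun \<Phi> x = L (frozen_hidden \<Phi> \<sigma> m x) + b" if "x \<in> weak_cell \<Phi> m \<sigma>" for x
    using net frozen_hidden_on_cell[OF order_refl that] sub that by auto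
  have "L (frozen_hidden \<Phi> \<sigma> m ((1 - t) *\<^sub>R y + t *\<^sub>R z)) =
      (1 - t) * L (frozen_hidden \<Phi> \<sigma> m y) + t * L (frozen_hidden \<Phi> \<sigma> m z)"
    unfolding affine_map_combine[OF affine_frozen_hidden[OF order_refl]]
    by (simp add: linear_add[OF L] linear_scale[OF L])
  then show ?thesis unfolding F[OF w] F[OF assms(1)] F[OF assms(2)] by (simp add: algebra_simps)
qed

lemma sign_seq_cell_of:
  assumes "x \<in> L0"
  shows "sign_seq \<Phi> (cell_of \<Phi> m x) = (\<lambda>p. if p \<in> E m then sgn (pre p x) else 0)"
proof
  fix p :: "nat \<times> 'd"
  obtain i j where p: "p = (i, j)" by (cases p)
  have "(THE s. \<forall>y\<in>open_cell \<Phi> m x. sgn (aff_layer \<Phi> i (hidden \<Phi> (i - 1) y) $ j) = s) = sgn (pre (i, j) x)"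
    if "(i, j) \<in> E m"
  proof (rule the_equality)
    show *: "\<forall>y\<in>open_cell \<Phi> m x. sgn (aff_layer \<Phi> i (hidden \<Phi> (i - 1) y) $ j) = sgn (pre (i, j) x)"
      using that by (auto simp: open_cell_def pre_act_def dest: bspec)
    fix s assume "\<forall>y\<in>open_cell \<Phi> m x. sgn (aff_layer \<Phi> i (hidden \<Phi> (i - 1) y) $ j) = s"
    from bspec[OF this mem_open_cell[OF assms]] bspec[OF * mem_open_cell[OF assms]]
    show "s = sgn (pre (i, j) x)" by simp
  qed
  then show "sign_seq \<Phi> (cell_of \<Phi> m x) p = (if p \<in> E m then sgn (pre p x) else 0)"
    unfolding sign_seq_def entries_eq rel_interior_cell_of[OF order_refl assms] p by simp
qed

lemma cell_of_mono:
  assumes "y \<in> weak_cell \<Phi> k \<sigma>" shows "cell_of \<Phi> k y \<subseteq> weak_cell \<Phi> k \<sigma>"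
proof
  fix z assume z: "z \<in> cell_of \<Phi> k y"
  have "sgn (pre p z) \<in> {0, \<sigma> p}" if "p \<in> E k" for p
  proof -
    have "sgn (pre p z) \<in> {0, sgn (pre p y)}" "sgn (pre p y) \<in> {0, \<sigma> p}"
      using z assms that unfolding weak_cell_def by blast+
    then show ?thesis by auto
  qed
  then show "z \<in> weak_cell \<Phi> k \<sigma>" using z unfolding weak_cell_def by blast
qed

lemma vertices_eq: "vertices \<Phi> = {v \<in> L0. cell_of \<Phi> m v = {v}}"
proof -
  have "v = x" if "{v} = cell_of \<Phi> m x" "x \<in> L0" for v x
    using mem_cell_of[OF that(2), of m] unfolding that(1)[symmetric] by simp
  then show ?thesis unfolding vertices_def cells_eq by blast
qed

end

context transversal_network
begin

text \<open>The tangent space is cut out by one functional per vanishing neuron, and these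
  functionals are jointly surjective, so each of them costs exactly one dimension.\<close>

lemma aff_dim_cell_of:
  assumes x: "x \<in> L0"
  shows "aff_dim (cell_of \<Phi> m x) + int (card (Z m x)) = int (dim L0)"
proof -
  obtain \<alpha> \<gamma> where lf: "local_form x \<alpha> \<gamma>" using local_form_exists[OF x] by blast
  let ?K = "{u \<in> L0. \<forall>p\<in>Z m x. \<alpha> p u = 0}" and ?C = "cell_of \<Phi> m x"
  have lin: "\<And>p. p \<in> Z m x \<Longrightarrow> linear (\<alpha> p)" using lf by (auto simp: local_form_def)
  have dimL: "dim L0 = dim ?K + card (Z m x)"
    using dim_common_kernel[OF finite_Z[of m x] subspace_layer_space[of \<Phi> 0], where f = \<alpha>] lin
      local_form_surj[OF x lf order_refl] by blast
  have tan: "tangent (open_cell \<Phi> m x) = ?K" by (rule tangent_open_cell[OF x lf order_refl])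
  have sub: "subspace ?K" unfolding tan[symmetric] tangent_def by (rule subspace_span)
  have "span ((+) (- x) ` ?C) = ?K"
  proof
    have "- x + y \<in> ?K" if y: "y \<in> ?C" for y
    proof -
      \<comment> \<open>A point of the closed cell may lie on the boundary, but its midpoint with
        \<open>x\<close> is in the open cell; doubling recovers the difference.\<close>
      have "(1 - 1/2) *\<^sub>R y + (1/2) *\<^sub>R x \<in> open_cell \<Phi> m x"
        by (rule open_cell_combine[OF order_refl y mem_open_cell[OF x]]) auto
      then have "((1 - 1/2) *\<^sub>R y + (1/2) *\<^sub>R x) - x \<in> tangent (open_cell \<Phi> m x)"
        unfolding tangent_def using mem_open_cell[OF x] by (intro span_base) blast
      then have "2 *\<^sub>R (((1 - 1/2) *\<^sub>R y + (1/2) *\<^sub>R x) - x) \<in> ?K" unfolding tan by (rule subspace_mul[OF sub])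
      moreover have "2 *\<^sub>R (((1 - 1/2) *\<^sub>R y + (1/2) *\<^sub>R x) - x) = - x + y" by (simp add: algebra_simps scaleR_2)
      ultimately show ?thesis by simp
    qed
    then show "span ((+) (- x) ` ?C) \<subseteq> ?K" by (intro span_minimal sub) blast
    have "y - z \<in> span ((+) (- x) ` ?C)" if "y \<in> open_cell \<Phi> m x" "z \<in> open_cell \<Phi> m x" for y z
    proof -
      have "- x + y \<in> span ((+) (- x) ` ?C)" "- x + z \<in> span ((+) (- x) ` ?C)"
        using that open_cell_sub by (auto intro!: span_base)
      from span_diff[OF this] show ?thesis by simp
    qed
    then show "?K \<subseteq> span ((+) (- x) ` ?C)"
      unfolding tan[symmetric] tangent_def by (intro span_minimal subspace_span) blast
  qed
  then have "dim ((+) (- x) ` ?C) = dim ?K" using dim_span[of "(+) (- x) ` ?C"] by (simp only:)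
  moreover have "aff_dim ?C = int (dim ((+) (- x) ` ?C))"
    by (rule aff_dim_eq_dim) (simp add: hull_inc mem_cell_of[OF x])
  ultimately show ?thesis using dimL by linarith
qed

end

locale network_vertex = transversal_network \<Phi> for \<Phi> :: "'d::finite relu_net" +
  fixes v :: "real^'d"
  assumes vertex: "v \<in> vertices \<Phi>"
begin

abbreviation "Zv \<equiv> Z m v"

definition "\<alpha> = fst (SOME ag. local_form v (fst ag) (snd ag))"
definition "\<gamma> = snd (SOME ag. local_form v (fst ag) (snd ag))"

lemma vL: "v \<in> L0" using vertex unfolding vertices_eq by blast
lemma cell_v: "cell_of \<Phi> m v = {v}" using vertex unfolding vertices_eq by blast

lemma lf: "local_form v \<alpha> \<gamma>"
proof -
  have "\<exists>ag. local_form v (fst ag) (snd ag)" using local_form_exists[OF vL] by auto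
  from someI_ex[OF this] show ?thesis by (simp add: \<alpha>_def \<gamma>_def)
qed

lemma lin: "p \<in> Zv \<Longrightarrow> linear (\<alpha> p)" using lf unfolding local_form_def by blast

lemma card_Zv: "card Zv = dim L0"
  using aff_dim_cell_of[OF vL] unfolding cell_v by simp

text \<open>The common kernel is the tangent space of the open cell of \<open>v\<close>, and this
  cell is a single point.\<close>

lemma kernel_trivial:
  assumes "u \<in> L0" "\<And>p. p \<in> Zv \<Longrightarrow> \<alpha> p u = 0" shows "u = 0"
proof -
  have "u \<in> tangent (open_cell \<Phi> m v)"
    using assms tangent_open_cell[OF vL lf order_refl] by simp
  moreover have "open_cell \<Phi> m v \<subseteq> {v}" using open_cell_sub[of m v] cell_v by blast
  then have "{y - x |x y. x \<in> open_cell \<Phi> m v \<and> y \<in> open_cell \<Phi> m v} \<subseteq> {0}"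
  proof clarsimp
    fix x y assume "open_cell \<Phi> m v \<subseteq> {v}" "x \<in> open_cell \<Phi> m v" "y \<in> open_cell \<Phi> m v"
    then have "x = v" "y = v" by blast+
    then show "y = x" by simp
  qed
  then have "tangent (open_cell \<Phi> m v) \<subseteq> span {0}" unfolding tangent_def by (rule span_mono)
  ultimately show ?thesis by (auto simp: span_0)
qed

definition "dual p = (SOME u. u \<in> L0 \<and> (\<forall>q\<in>Zv. \<alpha> q u = (if q = p then 1 else 0)))"

lemma dual: "dual p \<in> L0" "q \<in> Zv \<Longrightarrow> \<alpha> q (dual p) = (if q = p then 1 else 0)"
proof -
  have "\<exists>u. u \<in> L0 \<and> (\<forall>q\<in>Zv. \<alpha> q u = (if q = p then 1 else 0))"
    using local_form_surj[OF vL lf order_refl, of "\<lambda>q. if q = p then 1 else 0"] by blast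
  from someI_ex[OF this, folded dual_def]
  show "dual p \<in> L0" "q \<in> Zv \<Longrightarrow> \<alpha> q (dual p) = (if q = p then 1 else 0)" by blast+
qed

lemma combination_in: "(\<Sum>p\<in>Zv. c p *\<^sub>R dual p) \<in> L0"
  by (intro subspace_sum subspace_mul subspace_layer_space dual)

lemma \<alpha>_combination: "q \<in> Zv \<Longrightarrow> \<alpha> q (\<Sum>p\<in>Zv. c p *\<^sub>R dual p) = c q"
  by (simp add: linear_sum[OF lin] linear_scale[OF lin] dual(2) if_distrib[of "(*) _"] cong: if_cong)

lemma coordinates:
  assumes w: "w \<in> L0" shows "w = (\<Sum>p\<in>Zv. \<alpha> p w *\<^sub>R dual p)"
proof -
  have "w - (\<Sum>p\<in>Zv. \<alpha> p w *\<^sub>R dual p) = 0"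
  proof (rule kernel_trivial)
    show "w - (\<Sum>p\<in>Zv. \<alpha> p w *\<^sub>R dual p) \<in> L0"
      by (intro subspace_diff subspace_layer_space w combination_in)
    fix q assume q: "q \<in> Zv"
    show "\<alpha> q (w - (\<Sum>p\<in>Zv. \<alpha> p w *\<^sub>R dual p)) = 0"
      by (simp add: linear_diff[OF lin[OF q]] \<alpha>_combination[OF q])
  qed
  then show ?thesis by simp
qed

text \<open>
  The pre-activations vanishing at \<open>v\<close> are coordinates near \<open>v\<close>: the chart is inverted
  layer by layer, since its local form is triangular.
\<close>

definition "chart y = (\<Sum>p\<in>Zv. pre p y *\<^sub>R dual p)"
definition "unchart w = v + (\<Sum>p\<in>Zv. (\<alpha> p w - (\<Sum>q\<in>Z (fst p - 1) v. \<gamma> p q * max 0 (\<alpha> q w))) *\<^sub>R dual p)"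

lemma Z_pred_sub: "p \<in> Zv \<Longrightarrow> Z (fst p - 1) v \<subseteq> Zv"
  by (intro Z_mono) (auto simp: zero_set_def entries_upto_def)

lemma \<alpha>_chart: "p \<in> Zv \<Longrightarrow> \<alpha> p (chart y) = pre p y"
  unfolding chart_def by (rule \<alpha>_combination)

lemma chart_in: "chart y \<in> L0" unfolding chart_def by (rule combination_in)

lemma unchart_in: "unchart w \<in> L0"
  unfolding unchart_def by (intro subspace_add subspace_layer_space vL combination_in)

lemma continuous_\<alpha>: "p \<in> Zv \<Longrightarrow> continuous_on S (\<alpha> p)"
  by (intro linear_continuous_on linear_conv_bounded_linear[THEN iffD1] lin)

lemma continuous_unchart: "continuous_on S unchart"
  unfolding unchart_def using Z_pred_sub
  by (intro continuous_intros continuous_\<alpha>) auto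

lemma unchart_0 [simp]: "unchart 0 = v"
proof -
  have "\<alpha> p 0 = 0" if "p \<in> Zv" for p using linear_0[OF lin[OF that]] .
  moreover have "\<alpha> q 0 = 0" if "p \<in> Zv" "q \<in> Z (fst p - 1) v" for p q
    using linear_0[OF lin] that Z_pred_sub by blast
  ultimately have "(\<Sum>p\<in>Zv. (\<alpha> p 0 - (\<Sum>q\<in>Z (fst p - 1) v. \<gamma> p q * max 0 (\<alpha> q 0))) *\<^sub>R dual p) = 0"
    by (intro sum.neutral ballI) simp
  then show ?thesis by (simp add: unchart_def)
qed

lemma chart_v [simp]: "chart v = 0"
  unfolding chart_def by (intro sum.neutral) (auto simp: zero_set_def)

lemma continuous_chart: "continuous_on L0 chart"
  unfolding chart_def by (intro continuous_intros continuous_pre) (auto simp: zero_set_def)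

lemma unchart_chart: "\<forall>\<^sub>F y in nhds v. y \<in> L0 \<longrightarrow> unchart (chart y) = y"
  using lf[unfolded local_form_def, THEN conjunct2]
proof (rule eventually_mono, intro impI)
  fix y assume y: "y \<in> L0" and *: "y \<in> L0 \<longrightarrow> (\<forall>p\<in>Zv. pre p y = \<alpha> p (y - v) + (\<Sum>q\<in>Z (fst p - 1) v. \<gamma> p q * max 0 (pre q y)))"
  have "\<alpha> p (chart y) - (\<Sum>q\<in>Z (fst p - 1) v. \<gamma> p q * max 0 (\<alpha> q (chart y))) = \<alpha> p (y - v)" if p: "p \<in> Zv" for p
  proof -
    have "(\<Sum>q\<in>Z (fst p - 1) v. \<gamma> p q * max 0 (\<alpha> q (chart y))) = (\<Sum>q\<in>Z (fst p - 1) v. \<gamma> p q * max 0 (pre q y))"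
      using Z_pred_sub[OF p] by (intro sum.cong refl) (auto simp: \<alpha>_chart)
    then show ?thesis using *[THEN mp, OF y, THEN bspec, OF p] \<alpha>_chart[OF p] by simp
  qed
  then have "unchart (chart y) = v + (\<Sum>p\<in>Zv. \<alpha> p (y - v) *\<^sub>R dual p)"
    unfolding unchart_def by simp
  also have "\<dots> = v + (y - v)"
    using coordinates[OF subspace_diff[OF subspace_layer_space y vL]] by (simp only:)
  finally show "unchart (chart y) = y" by simp
qed

lemma filterlim_unchart: "filterlim unchart (nhds v) (nhds 0)"
proof -
  have "(unchart \<longlongrightarrow> unchart 0) (at 0)"
    using continuous_unchart[of UNIV] unfolding continuous_on_def by blast
  then have "(unchart \<longlongrightarrow> unchart 0) (nhds 0)" unfolding tendsto_at_iff_tendsto_nhds .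
  then show ?thesis unfolding unchart_0 .
qed

text \<open>The local form at \<open>unchart w\<close> is solved by induction over layers: once the
  earlier pre-activations have the prescribed values, the correction built into
  \<open>unchart\<close> cancels the rectified sum.\<close>

lemma pre_unchart:
  "\<forall>\<^sub>F w in nhds 0. w \<in> L0 \<longrightarrow> (\<forall>p\<in>Zv. pre p (unchart w) = \<alpha> p w) \<and>
      (\<forall>p\<in>E m - Zv. sgn (pre p (unchart w)) = sgn (pre p v))"
proof -
  have "\<forall>\<^sub>F y in nhds v. y \<in> L0 \<longrightarrow> (\<forall>p\<in>E m - Zv. sgn (pre p y) = sgn (pre p v)) \<and>
        (\<forall>p\<in>Zv. pre p y = \<alpha> p (y - v) + (\<Sum>q\<in>Z (fst p - 1) v. \<gamma> p q * max 0 (pre q y)))"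
    using eventually_sgn_pre[OF vL] lf[unfolded local_form_def, THEN conjunct2] by eventually_elim blast
  then have "\<forall>\<^sub>F w in nhds 0. unchart w \<in> L0 \<longrightarrow> (\<forall>p\<in>E m - Zv. sgn (pre p (unchart w)) = sgn (pre p v)) \<and>
        (\<forall>p\<in>Zv. pre p (unchart w) = \<alpha> p (unchart w - v) + (\<Sum>q\<in>Z (fst p - 1) v. \<gamma> p q * max 0 (pre q (unchart w))))"
    using filterlim_unchart by (rule eventually_compose_filterlim)
  then show ?thesis
  proof (rule eventually_mono, intro impI)
    fix w assume "w \<in> L0" and *: "unchart w \<in> L0 \<longrightarrow> (\<forall>p\<in>E m - Zv. sgn (pre p (unchart w)) = sgn (pre p v)) \<and>
        (\<forall>p\<in>Zv. pre p (unchart w) = \<alpha> p (unchart w - v) + (\<Sum>q\<in>Z (fst p - 1) v. \<gamma> p q * max 0 (pre q (unchart w))))"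
    note sg = *[THEN mp, OF unchart_in, THEN conjunct1] and form = *[THEN mp, OF unchart_in, THEN conjunct2]
    have "p \<in> Zv \<Longrightarrow> pre p (unchart w) = \<alpha> p w" for p
    proof (induction "fst p" arbitrary: p rule: less_induct)
      case less
      have "pre q (unchart w) = \<alpha> q w" if q: "q \<in> Z (fst p - 1) v" for q
      proof -
        have "1 \<le> fst p" "1 \<le> fst q" "fst q \<le> fst p - 1" using less.prems q by (auto simp: zero_set_def entries_upto_def)
        then have "fst q < fst p" by linarith
        then show ?thesis using less.hyps Z_pred_sub[OF less.prems] q by blast
      qed
      then have "(\<Sum>q\<in>Z (fst p - 1) v. \<gamma> p q * max 0 (pre q (unchart w))) = (\<Sum>q\<in>Z (fst p - 1) v. \<gamma> p q * max 0 (\<alpha> q w))"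
        by (intro sum.cong refl) simp
      moreover have "\<alpha> p (unchart w - v) = \<alpha> p w - (\<Sum>q\<in>Z (fst p - 1) v. \<gamma> p q * max 0 (\<alpha> q w))"
        unfolding unchart_def add_diff_cancel_left' by (rule \<alpha>_combination[OF less.prems])
      ultimately show ?case using form[THEN bspec, OF less.prems] by linarith
    qed
    then show "(\<forall>p\<in>Zv. pre p (unchart w) = \<alpha> p w) \<and> (\<forall>p\<in>E m - Zv. sgn (pre p (unchart w)) = sgn (pre p v))"
      using sg by blast
  qed
qed

text \<open>The local form expresses \<open>y - v\<close> through the pre-activations and their
  positive parts, so the linear part of the network becomes a sum over single coordinates. No mixed
  terms occur, and hence descent can be tested edge by edge.\<close>

lemma net_fun_separable:
  "\<exists>A B. \<forall>\<^sub>F y in nhds v. y \<in> L0 \<longrightarrow>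
     net_fun \<Phi> y = net_fun \<Phi> v + (\<Sum>p\<in>Zv. A p * pre p y + B p * max 0 (pre p y))"
proof -
  obtain \<beta> \<delta> where \<beta>: "linear \<beta>" and ev: "\<forall>\<^sub>F y in nhds v. y \<in> L0 \<longrightarrow>
     net_fun \<Phi> y = net_fun \<Phi> v + \<beta> (y - v) + (\<Sum>q\<in>Zv. \<delta> q * max 0 (pre q y))"
    using net_fun_local[OF vL] by blast
  \<comment> \<open>Extension by zero gives all the triangular sums the same index set, so that they
    can be interchanged.\<close>
  define g where "g p q = (if q \<in> Z (fst p - 1) v then \<gamma> p q else 0)" for p q
  let ?A = "\<lambda>p. \<beta> (dual p)" and ?B = "\<lambda>q. \<delta> q - (\<Sum>p\<in>Zv. \<beta> (dual p) * g p q)"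
  have "\<forall>\<^sub>F y in nhds v. y \<in> L0 \<longrightarrow>
     net_fun \<Phi> y = net_fun \<Phi> v + (\<Sum>p\<in>Zv. ?A p * pre p y + ?B p * max 0 (pre p y))"
    using ev lf[unfolded local_form_def, THEN conjunct2]
  proof eventually_elim
    case (elim y)
    show ?case
    proof
      assume y: "y \<in> L0"
      let ?r = "\<lambda>q. max 0 (pre q y)"
      have "\<alpha> p (y - v) = pre p y - (\<Sum>q\<in>Zv. g p q * ?r q)" if p: "p \<in> Zv" for p
      proof -
        have "(\<Sum>q\<in>Zv. g p q * ?r q) = (\<Sum>q\<in>Z (fst p - 1) v. g p q * ?r q)"
          using Z_pred_sub[OF p] by (intro sum.mono_neutral_right) (auto simp: g_def)
        also have "\<dots> = (\<Sum>q\<in>Z (fst p - 1) v. \<gamma> p q * ?r q)"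
          by (intro sum.cong refl) (simp add: g_def)
        finally show ?thesis using elim(2)[THEN mp, OF y, THEN bspec, OF p] by simp
      qed
      moreover have "\<beta> (y - v) = (\<Sum>p\<in>Zv. \<alpha> p (y - v) * \<beta> (dual p))"
      proof -
        have "y - v \<in> L0" using y vL subspace_diff[OF subspace_layer_space] by blast
        have "\<beta> (\<Sum>p\<in>Zv. \<alpha> p (y - v) *\<^sub>R dual p) = (\<Sum>p\<in>Zv. \<alpha> p (y - v) * \<beta> (dual p))"
          by (simp add: linear_sum[OF \<beta>] linear_scale[OF \<beta>])
        then show ?thesis using coordinates[OF \<open>y - v \<in> L0\<close>] by simp
      qed
      ultimately have "\<beta> (y - v) = (\<Sum>p\<in>Zv. (pre p y - (\<Sum>q\<in>Zv. g p q * ?r q)) * \<beta> (dual p))"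
        by simp
      also have "\<dots> = (\<Sum>p\<in>Zv. ?A p * pre p y) - (\<Sum>p\<in>Zv. \<Sum>q\<in>Zv. \<beta> (dual p) * g p q * ?r q)"
      proof -
        have "(pre p y - (\<Sum>q\<in>Zv. g p q * ?r q)) * \<beta> (dual p) = ?A p * pre p y - (\<Sum>q\<in>Zv. \<beta> (dual p) * g p q * ?r q)" for p
          unfolding mult.assoc[of "\<beta> (dual p)"] sum_distrib_left[symmetric] by (simp add: algebra_simps)
        then show ?thesis by (simp add: sum_subtractf)
      qed
      also have "(\<Sum>p\<in>Zv. \<Sum>q\<in>Zv. \<beta> (dual p) * g p q * ?r q) = (\<Sum>q\<in>Zv. (\<Sum>p\<in>Zv. \<beta> (dual p) * g p q) * ?r q)"
        unfolding sum_distrib_right by (rule sum.swap)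
      finally have b: "\<beta> (y - v) = (\<Sum>p\<in>Zv. ?A p * pre p y) - (\<Sum>q\<in>Zv. (\<Sum>p\<in>Zv. \<beta> (dual p) * g p q) * ?r q)" .
      have "(\<Sum>p\<in>Zv. ?A p * pre p y + ?B p * ?r p) = (\<Sum>p\<in>Zv. ?A p * pre p y) + ((\<Sum>p\<in>Zv. \<delta> p * ?r p) - (\<Sum>q\<in>Zv. (\<Sum>p\<in>Zv. \<beta> (dual p) * g p q) * ?r q))"
        unfolding sum.distrib left_diff_distrib sum_subtractf ..
      then show "net_fun \<Phi> y = net_fun \<Phi> v + (\<Sum>p\<in>Zv. ?A p * pre p y + ?B p * ?r p)"
        using elim(1)[THEN mp, OF y] b by linarith
    qed
  qed
  then show ?thesis by (rule_tac exI[of _ ?A], rule_tac exI[of _ ?B])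
qed

end

section \<open>The star of a vertex\<close>

context network_vertex
begin

definition "sign_vector \<tau> \<longleftrightarrow> (\<forall>p\<in>Zv. \<tau> p \<in> {-1, 0, 1::real})"
text \<open>Only the neurons vanishing at \<open>v\<close> can change sign near \<open>v\<close>;
  all other entries of a cell containing \<open>v\<close> are those of \<open>v\<close>.\<close>

definition "full_sign \<tau> p = (if p \<in> Zv then \<tau> p else sgn (pre p v))"

abbreviation "star_cell \<tau> \<equiv> weak_cell \<Phi> m (full_sign \<tau>)"
abbreviation "axis_sign p s \<equiv> (\<lambda>q. if q = p then s else 0 :: real)"

lemma sign_vector_axis: "s \<in> {-1, 1} \<Longrightarrow> sign_vector (axis_sign p s)"
  by (auto simp: sign_vector_def)

text \<open>The pattern is realised by the point with chart coordinates \<open>t * \<tau> p\<close>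
  for small positive \<open>t\<close>. The exact coordinates, the signs and the convergence to
  \<open>v\<close> are recorded together, because evaluating the network at this point uses all
  three.\<close>

lemma realize_near:
  assumes "sign_vector \<tau>"
  shows "\<forall>\<^sub>F t in at_right 0. \<forall>p\<in>Zv. pre p (unchart (\<Sum>p\<in>Zv. (t * \<tau> p) *\<^sub>R dual p)) = t * \<tau> p"
    and "\<forall>\<^sub>F t in at_right 0. \<forall>p\<in>E m. sgn (pre p (unchart (\<Sum>p\<in>Zv. (t * \<tau> p) *\<^sub>R dual p))) = full_sign \<tau> p"
    and "filterlim (\<lambda>t. unchart (\<Sum>p\<in>Zv. (t * \<tau> p) *\<^sub>R dual p)) (nhds v) (at_right 0)"
proof -
  let ?w = "\<lambda>t. \<Sum>p\<in>Zv. (t * \<tau> p) *\<^sub>R dual p"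
  have "(?w \<longlongrightarrow> (\<Sum>p\<in>Zv. (0 * \<tau> p) *\<^sub>R dual p)) (at_right 0)"
    by (intro tendsto_intros)
  then have lim: "filterlim ?w (nhds 0) (at_right 0)" by simp
  then show "filterlim (\<lambda>t. unchart (?w t)) (nhds v) (at_right 0)"
    by (rule filterlim_compose[OF filterlim_unchart])
  have ev: "\<forall>\<^sub>F t in at_right 0. ?w t \<in> L0 \<longrightarrow> (\<forall>p\<in>Zv. pre p (unchart (?w t)) = \<alpha> p (?w t)) \<and>
      (\<forall>p\<in>E m - Zv. sgn (pre p (unchart (?w t))) = sgn (pre p v))"
    using pre_unchart lim by (rule eventually_compose_filterlim)
  show 1: "\<forall>\<^sub>F t in at_right 0. \<forall>p\<in>Zv. pre p (unchart (?w t)) = t * \<tau> p"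
    using ev
  proof (rule eventually_mono, intro ballI)
    fix t p assume *: "?w t \<in> L0 \<longrightarrow> (\<forall>p\<in>Zv. pre p (unchart (?w t)) = \<alpha> p (?w t)) \<and>
      (\<forall>p\<in>E m - Zv. sgn (pre p (unchart (?w t))) = sgn (pre p v))" and p: "p \<in> Zv"
    show "pre p (unchart (?w t)) = t * \<tau> p"
      using *[THEN mp, OF combination_in, THEN conjunct1, THEN bspec, OF p] \<alpha>_combination[OF p] by simp
  qed
  show "\<forall>\<^sub>F t in at_right 0. \<forall>p\<in>E m. sgn (pre p (unchart (?w t))) = full_sign \<tau> p"
    using ev 1 eventually_at_right_less
  proof eventually_elim
    case (elim t)
    show ?case
    proof
      fix p assume p: "p \<in> E m"
      show "sgn (pre p (unchart (?w t))) = full_sign \<tau> p"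
      proof (cases "p \<in> Zv")
        case True
        then have "\<tau> p \<in> {-1, 0, 1}" using assms by (simp add: sign_vector_def)
        then have "sgn (t * \<tau> p) = \<tau> p" using elim(3) by (auto simp: sgn_mult)
        then show ?thesis using elim(2) True by (simp add: full_sign_def)
      next
        case False
        then show ?thesis using elim(1)[THEN mp, OF combination_in] p by (simp add: full_sign_def)
      qed
    qed
  qed
qed

lemma realize:
  assumes "sign_vector \<tau>"
  shows "\<exists>y\<in>L0. \<forall>p\<in>E m. sgn (pre p y) = full_sign \<tau> p"
  using eventually_happens'[OF trivial_limit_at_right_real realize_near(2)[OF assms]] unchart_in by blast

lemma star_cell_eq:
  assumes "\<forall>p\<in>E m. sgn (pre p y) = full_sign \<tau> p" shows "star_cell \<tau> = cell_of \<Phi> m y"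
  by (rule weak_cell_cong) (use assms in simp)

lemma star_cell_in:
  assumes "sign_vector \<tau>" shows "star_cell \<tau> \<in> cells \<Phi>" "v \<in> star_cell \<tau>"
proof -
  obtain y where "y \<in> L0" "\<forall>p\<in>E m. sgn (pre p y) = full_sign \<tau> p" using realize[OF assms] by blast
  then show "star_cell \<tau> \<in> cells \<Phi>" using star_cell_eq unfolding cells_eq by blast
  show "v \<in> star_cell \<tau>"
    using vL by (auto simp: weak_cell_def full_sign_def zero_set_def)
qed

text \<open>If \<open>v\<close> lies in the closed cell of \<open>x\<close>, a neuron nonzero at
  \<open>v\<close> must have the same sign at \<open>x\<close>. So only the entries at the vanishing
  neurons carry information.\<close>

lemma star_cell_exists:
  assumes "C \<in> cells \<Phi>" "v \<in> C"
  shows "\<exists>\<tau>. sign_vector \<tau> \<and> (\<forall>p. p \<notin> Zv \<longrightarrow> \<tau> p = 0) \<and> C = star_cell \<tau>"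
proof -
  obtain x where x: "x \<in> L0" "C = cell_of \<Phi> m x" using assms cells_eq by blast
  let ?\<tau> = "\<lambda>p. if p \<in> Zv then sgn (pre p x) else 0"
  have "sgn (pre p x) = full_sign ?\<tau> p" if p: "p \<in> E m" for p
  proof (cases "p \<in> Zv")
    case False
    then have "sgn (pre p v) \<noteq> 0" using p by (simp add: zero_set_def sgn_zero_iff)
    moreover have "sgn (pre p v) \<in> {0, sgn (pre p x)}" using assms(2) p unfolding x(2) weak_cell_def by blast
    ultimately show ?thesis using False by (simp add: full_sign_def)
  qed (simp add: full_sign_def)
  then have "star_cell ?\<tau> = cell_of \<Phi> m x" by (intro star_cell_eq ballI)
  then have "C = star_cell ?\<tau>" using x(2) by (simp only:)
  moreover have "sign_vector ?\<tau>" using sgn_cases by (auto simp: sign_vector_def)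
  ultimately show ?thesis by (intro exI[of _ ?\<tau>]) auto
qed

text \<open>A point realising \<open>\<tau>\<close> exactly is the witness for the forward
  direction. Thus the face order on the star is decided by sign vectors, whatever the cells look
  like far from \<open>v\<close>.\<close>

lemma star_cell_subset_iff:
  assumes "sign_vector \<tau>"
  shows "star_cell \<tau> \<subseteq> star_cell \<tau>' \<longleftrightarrow> (\<forall>p\<in>Zv. \<tau> p \<in> {0, \<tau>' p})"
proof
  assume sub: "star_cell \<tau> \<subseteq> star_cell \<tau>'"
  obtain y where y: "y \<in> L0" "\<forall>p\<in>E m. sgn (pre p y) = full_sign \<tau> p" using realize[OF assms] by blast
  then have "y \<in> star_cell \<tau>'" using sub mem_cell_of[of y m] star_cell_eq by blast
  then have *: "\<forall>p\<in>E m. sgn (pre p y) \<in> {0, full_sign \<tau>' p}" unfolding weak_cell_def by blast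
  show "\<forall>p\<in>Zv. \<tau> p \<in> {0, \<tau>' p}"
  proof
    fix p assume p: "p \<in> Zv"
    then have "p \<in> E m" by (simp add: zero_set_def)
    then have "sgn (pre p y) \<in> {0, full_sign \<tau>' p}" "sgn (pre p y) = full_sign \<tau> p" using * y(2) by blast+
    then show "\<tau> p \<in> {0, \<tau>' p}" using p by (simp add: full_sign_def)
  qed
next
  assume *: "\<forall>p\<in>Zv. \<tau> p \<in> {0, \<tau>' p}"
  show "star_cell \<tau> \<subseteq> star_cell \<tau>'"
  proof
    fix y assume y: "y \<in> star_cell \<tau>"
    have "sgn (pre p y) \<in> {0, full_sign \<tau>' p}" if p: "p \<in> E m" for p
    proof -
      have "sgn (pre p y) \<in> {0, full_sign \<tau> p}" using y p unfolding weak_cell_def by blast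
      then show ?thesis using bspec[OF *, of p] by (cases "p \<in> Zv") (auto simp: full_sign_def)
    qed
    then show "y \<in> star_cell \<tau>'" using y unfolding weak_cell_def by blast
  qed
qed

lemma star_cell_eq_iff:
  assumes "sign_vector \<tau>" "sign_vector \<tau>'"
  shows "star_cell \<tau> = star_cell \<tau>' \<longleftrightarrow> (\<forall>p\<in>Zv. \<tau> p = \<tau>' p)"
  unfolding set_eq_subset star_cell_subset_iff[OF assms(1)] star_cell_subset_iff[OF assms(2)]
  by (metis insert_iff empty_iff)

lemma aff_dim_star_cell:
  assumes "sign_vector \<tau>"
  shows "aff_dim (star_cell \<tau>) = int (card {p\<in>Zv. \<tau> p \<noteq> 0})"
proof -
  obtain y where y: "y \<in> L0" "\<forall>p\<in>E m. sgn (pre p y) = full_sign \<tau> p" using realize[OF assms] by blast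
  have "pre p y = 0 \<longleftrightarrow> full_sign \<tau> p = 0" if "p \<in> E m" for p using y(2) that by (metis sgn_zero_iff)
  then have "Z m y = {p\<in>E m. full_sign \<tau> p = 0}" by (auto simp: zero_set_def)
  also have "\<dots> = {p\<in>Zv. \<tau> p = 0}"
    by (auto simp: zero_set_def full_sign_def sgn_zero_iff split: if_splits)
  finally have Zy: "Z m y = {p\<in>Zv. \<tau> p = 0}" .
  have "card Zv = card ({p\<in>Zv. \<tau> p = 0} \<union> {p\<in>Zv. \<tau> p \<noteq> 0})" by (rule arg_cong[of _ _ card]) blast
  also have "\<dots> = card {p\<in>Zv. \<tau> p = 0} + card {p\<in>Zv. \<tau> p \<noteq> 0}"
    by (rule card_Un_disjoint) auto
  finally show ?thesis
    using aff_dim_cell_of[OF y(1)] card_Zv unfolding Zy star_cell_eq[OF y(2)] by linarith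
qed

section \<open>Edges at a vertex and descending cells\<close>

lemma directions_eq: "directions \<Phi> v = Zv"
  using sign_seq_cell_of[OF vL] unfolding cell_v directions_def entries_eq zero_set_def
  by (auto simp: sgn_zero_iff)

text \<open>Resolves the definite description in \<open>edge\<close>: existence by realising the
  axis sign vector, uniqueness because a cell is determined by its sign sequence.\<close>

lemma edge_eq:
  assumes p: "p \<in> Zv" and s: "s \<in> {-1, 1}"
  shows "edge \<Phi> v p s = star_cell (axis_sign p s)"
proof -
  let ?\<tau> = "axis_sign p s"
  have seq: "(sign_seq \<Phi> {v})(p := s) = (\<lambda>q. if q \<in> E m then full_sign ?\<tau> q else 0)"
    using sign_seq_cell_of[OF vL] p unfolding cell_v
    by (auto simp: fun_eq_iff full_sign_def zero_set_def)
  obtain y where y: "y \<in> L0" "\<forall>p\<in>E m. sgn (pre p y) = full_sign ?\<tau> p" using realize[OF sign_vector_axis[OF s]] by blast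
  have "(THE C. C \<in> cells \<Phi> \<and> sign_seq \<Phi> C = (sign_seq \<Phi> {v})(p := s)) = star_cell ?\<tau>"
  proof (rule the_equality)
    have "sign_seq \<Phi> (star_cell ?\<tau>) = (\<lambda>q. if q \<in> E m then full_sign ?\<tau> q else 0)"
      unfolding star_cell_eq[OF y(2)] sign_seq_cell_of[OF y(1)] using y(2) by (simp add: fun_eq_iff)
    then show "star_cell ?\<tau> \<in> cells \<Phi> \<and> sign_seq \<Phi> (star_cell ?\<tau>) = (sign_seq \<Phi> {v})(p := s)"
      unfolding seq using star_cell_in(1)[OF sign_vector_axis[OF s]] by blast
    fix C assume C: "C \<in> cells \<Phi> \<and> sign_seq \<Phi> C = (sign_seq \<Phi> {v})(p := s)"
    then obtain x where x: "x \<in> L0" "C = cell_of \<Phi> m x" using cells_eq by blast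
    have "(\<lambda>q. if q \<in> E m then sgn (pre q x) else 0) = (\<lambda>q. if q \<in> E m then full_sign ?\<tau> q else 0)"
      using C unfolding seq x(2) sign_seq_cell_of[OF x(1)] by blast
    then have "sgn (pre q x) = full_sign ?\<tau> q" if "q \<in> E m" for q
      using that fun_cong[where x = q] by (metis (mono_tags))
    then have "star_cell ?\<tau> = cell_of \<Phi> m x" by (intro star_cell_eq ballI)
    then show "C = star_cell ?\<tau>" using x(2) by simp
  qed
  then show ?thesis unfolding edge_def .
qed

lemma edge_subset_iff:
  assumes "p \<in> Zv" "s \<in> {-1, 1}"
  shows "edge \<Phi> v p s \<subseteq> star_cell \<tau> \<longleftrightarrow> \<tau> p = s"
  unfolding edge_eq[OF assms] star_cell_subset_iff[OF sign_vector_axis[OF assms(2)]]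
  using assms by auto

lemma edge_inj:
  assumes "p \<in> Zv" "s \<in> {-1, 1}" "p' \<in> Zv" "s' \<in> {-1, 1}" "edge \<Phi> v p s = edge \<Phi> v p' s'"
  shows "p = p' \<and> s = s'"
proof -
  have "\<forall>q\<in>Zv. axis_sign p s q = axis_sign p' s' q"
    using assms(5) unfolding edge_eq[OF assms(1,2)] edge_eq[OF assms(3,4)]
      star_cell_eq_iff[OF sign_vector_axis[OF assms(2)] sign_vector_axis[OF assms(4)]] .
  from bspec[OF this assms(1)] show ?thesis using assms(2) by (auto split: if_splits)
qed

lemma edges_at_star_cell:
  assumes "sign_vector \<tau>"
  shows "edges_at \<Phi> v (star_cell \<tau>) = (\<lambda>p. edge \<Phi> v p (\<tau> p)) ` {p\<in>Zv. \<tau> p \<noteq> 0}"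
proof (intro Set.set_eqI iffI)
  fix D assume "D \<in> edges_at \<Phi> v (star_cell \<tau>)"
  then obtain p s where "p \<in> Zv" "s \<in> {-1, 1}" "D = edge \<Phi> v p s" "D \<subseteq> star_cell \<tau>"
    unfolding edges_at_def directions_eq by blast
  moreover from this have "\<tau> p = s" using edge_subset_iff by blast
  ultimately show "D \<in> (\<lambda>p. edge \<Phi> v p (\<tau> p)) ` {p\<in>Zv. \<tau> p \<noteq> 0}" by auto
next
  fix D assume "D \<in> (\<lambda>p. edge \<Phi> v p (\<tau> p)) ` {p\<in>Zv. \<tau> p \<noteq> 0}"
  then obtain p where p: "p \<in> Zv" "\<tau> p \<noteq> 0" "D = edge \<Phi> v p (\<tau> p)" by blast
  then have s: "\<tau> p \<in> {-1, 1}" using assms by (auto simp: sign_vector_def)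
  then show "D \<in> edges_at \<Phi> v (star_cell \<tau>)"
    unfolding edges_at_def directions_eq using p edge_subset_iff[OF p(1) s] by blast
qed

lemma edge_mem_edges_at:
  assumes "sign_vector \<tau>" "p \<in> Zv" "s \<in> {-1, 1}"
  shows "edge \<Phi> v p s \<in> edges_at \<Phi> v (star_cell \<tau>) \<longleftrightarrow> \<tau> p = s"
  using edge_subset_iff[OF assms(2,3)] assms unfolding edges_at_def directions_eq by blast

definition "lower p s \<longleftrightarrow> edge \<Phi> v p s \<in> lower_star \<Phi> v"

text \<open>By separability the increment of the network near \<open>v\<close> is a sum of
  positively homogeneous functions of one coordinate. If all edges of the cell descend, every
  summand is nonpositive on it. The forward direction only uses that edges are contained in the
  cell.\<close>

lemma star_cell_lower_iff:
  assumes \<tau>: "sign_vector \<tau>"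
  shows "star_cell \<tau> \<in> lower_star \<Phi> v \<longleftrightarrow> (\<forall>p\<in>Zv. \<tau> p \<noteq> 0 \<longrightarrow> lower p (\<tau> p))"
proof
  assume low: "star_cell \<tau> \<in> lower_star \<Phi> v"
  show "\<forall>p\<in>Zv. \<tau> p \<noteq> 0 \<longrightarrow> lower p (\<tau> p)"
  proof (intro ballI impI)
    fix p assume p: "p \<in> Zv" "\<tau> p \<noteq> 0"
    then have s: "\<tau> p \<in> {-1, 1}" using \<tau> by (auto simp: sign_vector_def)
    have "edge \<Phi> v p (\<tau> p) \<subseteq> star_cell \<tau>" using edge_subset_iff[OF p(1) s] by simp
    moreover have "edge \<Phi> v p (\<tau> p) \<in> cells \<Phi>" "v \<in> edge \<Phi> v p (\<tau> p)"
      unfolding edge_eq[OF p(1) s] using star_cell_in[OF sign_vector_axis[OF s]] by blast+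
    ultimately show "lower p (\<tau> p)" using low unfolding lower_def lower_star_def by blast
  qed
next
  assume low: "\<forall>p\<in>Zv. \<tau> p \<noteq> 0 \<longrightarrow> lower p (\<tau> p)"
  obtain A B where ev: "\<forall>\<^sub>F y in nhds v. y \<in> L0 \<longrightarrow>
     net_fun \<Phi> y = net_fun \<Phi> v + (\<Sum>p\<in>Zv. A p * pre p y + B p * max 0 (pre p y))"
    using net_fun_separable by blast
  \<comment> \<open>The summand of direction \<open>p\<close> is tested at a point of the edge whose
    only nonzero coordinate is \<open>t * \<tau> p\<close>, where the other summands vanish.\<close>
  have slope: "A p * h + B p * max 0 h \<le> 0" if p: "p \<in> Zv" and h: "sgn h \<in> {0, \<tau> p}" for p h
  proof (cases "h = 0")
    case False
    let ?s = "\<tau> p"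
    have sh: "sgn h = ?s" using h False by (simp add: sgn_zero_iff)
    then have s: "?s \<in> {-1, 1}" using False sgn_cases[of h] by (auto simp: sgn_zero_iff)
    let ?y = "\<lambda>t. unchart (\<Sum>q\<in>Zv. (t * axis_sign p ?s q) *\<^sub>R dual q)"
    note sv = sign_vector_axis[OF s, of p]
    have "\<forall>\<^sub>F t in at_right 0. ?y t \<in> L0 \<longrightarrow>
       net_fun \<Phi> (?y t) = net_fun \<Phi> v + (\<Sum>q\<in>Zv. A q * pre q (?y t) + B q * max 0 (pre q (?y t)))"
      using ev realize_near(3)[OF sv] by (rule eventually_compose_filterlim)
    then have "\<forall>\<^sub>F t in at_right 0. 0 < t \<and> (A p * (t * ?s) + B p * max 0 (t * ?s) \<le> 0)"
      using realize_near(1,2)[OF sv] eventually_at_right_less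
    proof eventually_elim
      case (elim t)
      have "?y t \<in> cell_of \<Phi> m (?y t)" by (rule mem_cell_of[OF unchart_in])
      then have "?y t \<in> edge \<Phi> v p ?s" unfolding edge_eq[OF p s] star_cell_eq[OF elim(3)] .
      moreover have "edge \<Phi> v p ?s \<in> lower_star \<Phi> v" using low p s unfolding lower_def by force
      ultimately have "net_fun \<Phi> (?y t) \<le> net_fun \<Phi> v" unfolding lower_star_def by blast
      moreover have "(\<Sum>q\<in>Zv. A q * pre q (?y t) + B q * max 0 (pre q (?y t))) =
          (\<Sum>q\<in>Zv. if q = p then A q * (t * ?s) + B q * max 0 (t * ?s) else 0)"
        using elim(2) by (intro sum.cong refl) auto
      moreover have "\<dots> = A p * (t * ?s) + B p * max 0 (t * ?s)" using p by simp
      ultimately show ?case using elim(1)[THEN mp, OF unchart_in] elim(4) by linarith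
    qed
    then obtain t where t: "0 < t" "A p * (t * ?s) + B p * max 0 (t * ?s) \<le> 0"
      using eventually_happens'[OF trivial_limit_at_right_real] by blast
    \<comment> \<open>The factor by which the tested coordinate is stretched to \<open>h\<close>;
      homogeneity then transfers the inequality.\<close>
    define c where "c = \<bar>h\<bar> / t"
    have "0 \<le> c" using t by (simp add: c_def)
    have hc: "h = c * (t * ?s)" using t sh[symmetric] by (simp add: c_def abs_mult_sgn)
    have "max 0 h = c * max 0 (t * ?s)" unfolding hc using \<open>0 \<le> c\<close> by (simp add: max_mult_distrib_left)
    then have "A p * h + B p * max 0 h = c * (A p * (t * ?s) + B p * max 0 (t * ?s))"
      using hc by (simp add: algebra_simps)
    then show ?thesis using t \<open>0 \<le> c\<close> by (simp add: mult_nonneg_nonpos)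
  qed simp
  have "net_fun \<Phi> x \<le> net_fun \<Phi> v" if x: "x \<in> star_cell \<tau>" for x
  proof -
    note vs = star_cell_in(2)[OF \<tau>]
    have "((\<lambda>t. (1 - t) *\<^sub>R v + t *\<^sub>R x) \<longlongrightarrow> (1 - 0) *\<^sub>R v + 0 *\<^sub>R x) (at_right (0::real))"
      by (intro tendsto_intros)
    then have lim: "filterlim (\<lambda>t. (1 - t) *\<^sub>R v + t *\<^sub>R x) (nhds v) (at_right (0::real))" by simp
    have "\<forall>\<^sub>F t in at_right (0::real). (1 - t) *\<^sub>R v + t *\<^sub>R x \<in> L0 \<longrightarrow>
       net_fun \<Phi> ((1 - t) *\<^sub>R v + t *\<^sub>R x) = net_fun \<Phi> v + (\<Sum>p\<in>Zv. A p * pre p ((1 - t) *\<^sub>R v + t *\<^sub>R x) + B p * max 0 (pre p ((1 - t) *\<^sub>R v + t *\<^sub>R x)))"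
      using ev lim by (rule eventually_compose_filterlim)
    moreover have "\<forall>\<^sub>F t in at_right 0. (t::real) < 1"
      by (rule eventually_at_rightI[of 0 1]) auto
    moreover have "\<forall>\<^sub>F t in at_right 0. (0::real) < t" by (rule eventually_at_right_less)
    ultimately have "\<forall>\<^sub>F t in at_right (0::real). net_fun \<Phi> x \<le> net_fun \<Phi> v"
    proof eventually_elim
      case (elim t)
      let ?z = "(1 - t) *\<^sub>R v + t *\<^sub>R x"
      have z: "?z \<in> star_cell \<tau>"
        using convex_weak_cell[OF order_refl, of "full_sign \<tau>"] vs x elim unfolding convex_alt by auto
      have "sgn (pre p ?z) \<in> {0, \<tau> p}" if p: "p \<in> Zv" for p
      proof -
        have "p \<in> E m" using p by (simp add: zero_set_def)
        then have "sgn (pre p ?z) \<in> {0, full_sign \<tau> p}" using z unfolding weak_cell_def by blast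
        then show ?thesis using p by (simp add: full_sign_def)
      qed
      then have "(\<Sum>p\<in>Zv. A p * pre p ?z + B p * max 0 (pre p ?z)) \<le> 0"
        by (intro sum_nonpos slope)
      moreover have "?z \<in> L0" using z by (simp add: weak_cell_def)
      ultimately have "net_fun \<Phi> ?z \<le> net_fun \<Phi> v" using elim(1) by linarith
      \<comment> \<open>The estimate is available near \<open>v\<close> only; affineness on the
        segment from \<open>v\<close> extends it to \<open>x\<close>.\<close>
      moreover have "net_fun \<Phi> ?z = (1 - t) * net_fun \<Phi> v + t * net_fun \<Phi> x"
        using elim by (intro net_fun_affine_on_cell[OF vs x]) auto
      ultimately have "t * net_fun \<Phi> x \<le> t * net_fun \<Phi> v" by (simp add: algebra_simps)
      then show ?case using elim by simp
    qed
    then show ?thesis by (simp add: trivial_limit_at_right_real)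
  qed
  then show "star_cell \<tau> \<in> lower_star \<Phi> v"
    using star_cell_in[OF \<tau>] unfolding lower_star_def by blast
qed

end

section \<open>Local pairings\<close>

context network_vertex
begin

lemma lower_star_cell:
  assumes "C \<in> lower_star \<Phi> v"
  shows "\<exists>\<tau>. sign_vector \<tau> \<and> (\<forall>p. p \<notin> Zv \<longrightarrow> \<tau> p = 0) \<and> C = star_cell \<tau>"
  using assms star_cell_exists unfolding lower_star_def by blast

text \<open>Translates the growth of edge sets into a change of one entry from 0 to
  \<open>s\<close>. The opposite edge cannot have been present, since \<open>\<tau>' p\<close> would
  then have two different values.\<close>

lemma edges_at_insert_iff:
  assumes \<tau>: "sign_vector \<tau>" "sign_vector \<tau>'" and p: "p \<in> Zv" and s: "s \<in> {-1, 1}"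
  shows "edge \<Phi> v p s \<notin> edges_at \<Phi> v (star_cell \<tau>) \<and>
      edges_at \<Phi> v (star_cell \<tau>') = insert (edge \<Phi> v p s) (edges_at \<Phi> v (star_cell \<tau>)) \<longleftrightarrow>
      \<tau> p = 0 \<and> (\<forall>q\<in>Zv. \<tau>' q = (\<tau>(p := s)) q)" (is "?l \<longleftrightarrow> ?r")
proof
  assume l: ?l
  have key: "\<tau>' q = t \<longleftrightarrow> (q = p \<and> t = s) \<or> \<tau> q = t" if q: "q \<in> Zv" and t: "t \<in> {-1, 1}" for q t
  proof -
    have "edge \<Phi> v q t \<in> edges_at \<Phi> v (star_cell \<tau>') \<longleftrightarrow>
        edge \<Phi> v q t = edge \<Phi> v p s \<or> edge \<Phi> v q t \<in> edges_at \<Phi> v (star_cell \<tau>)"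
      using l by blast
    moreover have "edge \<Phi> v q t = edge \<Phi> v p s \<longleftrightarrow> q = p \<and> t = s"
      using edge_inj[OF q t p s] by blast
    ultimately show ?thesis unfolding edge_mem_edges_at[OF \<tau>(1) q t] edge_mem_edges_at[OF \<tau>(2) q t] by blast
  qed
  have "\<tau> p \<noteq> s" using l unfolding edge_mem_edges_at[OF \<tau>(1) p s] by blast
  have \<tau>v: "\<tau> q \<in> {-1, 0, 1}" "\<tau>' q \<in> {-1, 0, 1}" if "q \<in> Zv" for q
    using \<tau> that unfolding sign_vector_def by blast+
  have "\<tau>' p = s" using key[OF p s] by blast
  have "\<tau> p = 0"
  proof (rule ccontr)
    assume "\<tau> p \<noteq> 0"
    then have "\<tau> p \<in> {-1, 1}" using \<tau>v(1)[OF p] by blast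
    from key[OF p this] show False using \<open>\<tau> p \<noteq> s\<close> \<open>\<tau>' p = s\<close> by simp
  qed
  moreover have "\<tau>' q = (\<tau>(p := s)) q" if q: "q \<in> Zv" for q
  proof (cases "q = p")
    case True
    then show ?thesis using \<open>\<tau>' p = s\<close> by simp
  next
    case False
    then show ?thesis using key[OF q, of 1] key[OF q, of "-1"] \<tau>v[OF q] by auto
  qed
  ultimately show ?r by blast
next
  assume r: ?r
  have s0: "s \<noteq> 0" using s by auto
  have "edge \<Phi> v p s \<notin> edges_at \<Phi> v (star_cell \<tau>)"
    unfolding edge_mem_edges_at[OF \<tau>(1) p s] using r s0 by simp
  moreover have "{q \<in> Zv. \<tau>' q \<noteq> 0} = insert p {q \<in> Zv. \<tau> q \<noteq> 0}"
    using r s0 p by (auto split: if_splits)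
  then have "edges_at \<Phi> v (star_cell \<tau>') = insert (edge \<Phi> v p (\<tau>' p)) ((\<lambda>q. edge \<Phi> v q (\<tau>' q)) ` {q \<in> Zv. \<tau> q \<noteq> 0})"
    unfolding edges_at_star_cell[OF \<tau>(2)] by simp
  moreover have "(\<lambda>q. edge \<Phi> v q (\<tau>' q)) ` {q \<in> Zv. \<tau> q \<noteq> 0} = (\<lambda>q. edge \<Phi> v q (\<tau> q)) ` {q \<in> Zv. \<tau> q \<noteq> 0}"
    using r by (intro image_cong refl) (auto split: if_splits)
  moreover have "\<tau>' p = s" using r p by simp
  ultimately show ?l unfolding edges_at_star_cell[OF \<tau>(1)] by simp
qed

lemma insert_pairs_iff:
  assumes p: "p \<in> Zv" and s: "s \<in> {-1, 1}"
  shows "(C, D) \<in> insert_pairs \<Phi> v (edge \<Phi> v p s) \<longleftrightarrow>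
    (\<exists>\<tau>. sign_vector \<tau> \<and> \<tau> p = 0 \<and> C = star_cell \<tau> \<and> D = star_cell (\<tau>(p := s)) \<and>
         C \<in> lower_star \<Phi> v \<and> D \<in> lower_star \<Phi> v)" (is "?l \<longleftrightarrow> ?r")
proof
  assume l: ?l
  then have low: "C \<in> lower_star \<Phi> v" "D \<in> lower_star \<Phi> v" unfolding insert_pairs_def by blast+
  obtain \<tau> where \<tau>: "sign_vector \<tau>" "C = star_cell \<tau>" using lower_star_cell[OF low(1)] by blast
  obtain \<tau>' where \<tau>': "sign_vector \<tau>'" "D = star_cell \<tau>'" using lower_star_cell[OF low(2)] by blast
  have "\<tau> p = 0 \<and> (\<forall>q\<in>Zv. \<tau>' q = (\<tau>(p := s)) q)"
    using l edges_at_insert_iff[OF \<tau>(1) \<tau>'(1) p s] unfolding insert_pairs_def \<tau>(2) \<tau>'(2) by blast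
  moreover have "sign_vector (\<tau>(p := s))" using \<tau>(1) s by (auto simp: sign_vector_def)
  ultimately have "\<tau> p = 0" "D = star_cell (\<tau>(p := s))"
    unfolding \<tau>'(2) star_cell_eq_iff[OF \<tau>'(1) \<open>sign_vector (\<tau>(p := s))\<close>] by blast+
  then show ?r using \<tau> low by blast
next
  assume ?r
  then obtain \<tau> where \<tau>: "sign_vector \<tau>" "\<tau> p = 0" "C = star_cell \<tau>" "D = star_cell (\<tau>(p := s))"
    "C \<in> lower_star \<Phi> v" "D \<in> lower_star \<Phi> v" by blast
  have "sign_vector (\<tau>(p := s))" using \<tau>(1) s by (auto simp: sign_vector_def)
  from edges_at_insert_iff[OF \<tau>(1) this p s] \<tau> show ?l unfolding insert_pairs_def by blast
qed

lemma lower_update_zero: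
  assumes "sign_vector \<tau>" "star_cell \<tau> \<in> lower_star \<Phi> v"
  shows "sign_vector (\<tau>(p := 0)) \<and> star_cell (\<tau>(p := 0)) \<in> lower_star \<Phi> v"
proof -
  have "sign_vector (\<tau>(p := 0))" using assms by (auto simp: sign_vector_def)
  then show ?thesis using assms by (simp add: star_cell_lower_iff)
qed

lemma lower_update:
  assumes "sign_vector \<tau>" "star_cell \<tau> \<in> lower_star \<Phi> v" "s \<in> {-1, 1}" "lower p s"
  shows "sign_vector (\<tau>(p := s)) \<and> star_cell (\<tau>(p := s)) \<in> lower_star \<Phi> v"
proof -
  have "sign_vector (\<tau>(p := s))" using assms by (auto simp: sign_vector_def)
  then show ?thesis using assms by (simp add: star_cell_lower_iff)
qed

lemma regular_pairing_direction:
  assumes "regular_pairing \<Phi> v W"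
  obtains p s where "p \<in> Zv" "s \<in> {-1, 1}" "lower p s" "\<not> lower p (- s)" "W = insert_pairs \<Phi> v (edge \<Phi> v p s)"
  using assms unfolding regular_pairing_def directions_eq lower_def by blast

text \<open>In the chosen direction a descending cell can only have entry 0 or \<open>s\<close>, and
  the pairing exchanges these two kinds of cells.\<close>

lemma regular_all_paired:
  assumes W: "regular_pairing \<Phi> v W" and C: "C \<in> lower_star \<Phi> v"
  shows "paired W C"
proof -
  obtain p s where p: "p \<in> Zv" and s: "s \<in> {-1, 1}" and low: "lower p s" "\<not> lower p (- s)"
    and W: "W = insert_pairs \<Phi> v (edge \<Phi> v p s)"
    using W by (rule regular_pairing_direction)
  obtain \<tau> where \<tau>: "sign_vector \<tau>" "C = star_cell \<tau>" using lower_star_cell[OF C] by blast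
  have C\<tau>: "star_cell \<tau> \<in> lower_star \<Phi> v" using C \<tau>(2) by simp
  have "\<tau> p \<noteq> - s"
  proof
    assume "\<tau> p = - s"
    then have "\<tau> p \<noteq> 0" using s by auto
    then show False using C\<tau> low p \<open>\<tau> p = - s\<close> unfolding star_cell_lower_iff[OF \<tau>(1)] by auto
  qed
  moreover have "\<tau> p \<in> {-1, 0, 1}" using \<tau>(1) p by (simp add: sign_vector_def)
  ultimately consider "\<tau> p = 0" | "\<tau> p = s" using s by auto
  then show ?thesis
  proof cases
    case 1
    have "(C, star_cell (\<tau>(p := s))) \<in> W"
      unfolding W insert_pairs_iff[OF p s] using \<tau> 1 C lower_update[OF \<tau>(1) C\<tau> s low(1)] by blast
    then show ?thesis unfolding paired_def by force
  next
    case 2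
    let ?\<tau> = "\<tau>(p := 0)"
    have "?\<tau> p = 0" "C = star_cell (?\<tau>(p := s))" using 2 \<tau>(2) by (simp_all add: fun_upd_idem)
    then have "(star_cell ?\<tau>, C) \<in> W"
      unfolding W insert_pairs_iff[OF p s] using C lower_update_zero[OF \<tau>(1) C\<tau>] by blast
    then show ?thesis unfolding paired_def by force
  qed
qed

definition "lower_pairs = {p\<in>Zv. lower p 1 \<and> lower p (-1)}"

lemma edge_other_point:
  assumes p: "p \<in> Zv" and s: "s \<in> {-1, 1}" shows "\<exists>y\<in>edge \<Phi> v p s. y \<noteq> v"
proof -
  obtain y where y: "y \<in> L0" "\<forall>q\<in>E m. sgn (pre q y) = full_sign (axis_sign p s) q"
    using realize[OF sign_vector_axis[OF s]] by blast
  have "y \<in> edge \<Phi> v p s" unfolding edge_eq[OF p s] star_cell_eq[OF y(2)] by (rule mem_cell_of[OF y(1)])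
  moreover have "p \<in> E m" "pre p v = 0" using p by (simp_all add: zero_set_def)
  then have "sgn (pre p y) = s" using y(2) p by (simp add: full_sign_def)
  then have "y \<noteq> v" using \<open>pre p v = 0\<close> s by auto
  ultimately show ?thesis by blast
qed

text \<open>A descending edge has a point other than \<open>v\<close>, so it cannot be oriented away
  from \<open>v\<close>. Criticality then makes both edges of its direction descend.\<close>

lemma critical_lower_iff:
  assumes crit: "pl_critical \<Phi> v" and p: "p \<in> Zv" and s: "s \<in> {-1, 1}"
  shows "lower p s \<longleftrightarrow> p \<in> lower_pairs"
proof
  assume low: "lower p s"
  have not_away: "\<not> oriented_away \<Phi> (edge \<Phi> v p s) v"
  proof
    assume away: "oriented_away \<Phi> (edge \<Phi> v p s) v"
    obtain y where y: "y \<in> edge \<Phi> v p s" "y \<noteq> v" using edge_other_point[OF p s] by blast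
    have "net_fun \<Phi> v < net_fun \<Phi> y" using away y unfolding oriented_away_def by blast
    moreover have "net_fun \<Phi> y \<le> net_fun \<Phi> v" using low y unfolding lower_def lower_star_def by blast
    ultimately show False by simp
  qed
  have toward: "lower p t" if t: "t \<in> {-1, 1}" and "oriented_toward \<Phi> (edge \<Phi> v p t) v" for t
  proof -
    have "edge \<Phi> v p t \<in> cells \<Phi>" "v \<in> edge \<Phi> v p t"
      unfolding edge_eq[OF p t] using star_cell_in[OF sign_vector_axis[OF t]] by blast+
    moreover have "net_fun \<Phi> x \<le> net_fun \<Phi> v" if "x \<in> edge \<Phi> v p t" for x
      using that \<open>oriented_toward \<Phi> (edge \<Phi> v p t) v\<close> unfolding oriented_toward_def
      by (cases "x = v") (auto intro: less_imp_le)
    ultimately show ?thesis unfolding lower_def lower_star_def by blast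
  qed
  have "oriented_toward \<Phi> (edge \<Phi> v p 1) v \<and> oriented_toward \<Phi> (edge \<Phi> v p (-1)) v"
    using crit p s not_away unfolding pl_critical_def directions_eq by auto
  then show "p \<in> lower_pairs" using toward[of 1] toward[of "-1"] p by (auto simp: lower_pairs_def)
next
  assume "p \<in> lower_pairs"
  then show "lower p s" using s by (auto simp: lower_pairs_def)
qed

text \<open>Invariant of the successive pairing, with \<open>Q\<close> the directions already
  treated: a cell survives iff its entry is the opposite one in every treated direction. The next
  direction matches the survivors with entry 0 with those with entry \<open>\<sigma> p\<close> and
  leaves those with entry \<open>- \<sigma> p\<close>.\<close>

lemma pair_along_paired:
  assumes "set ps \<subseteq> lower_pairs" and \<sigma>: "\<forall>p. \<sigma> p \<in> {-1, 1}"
    and "\<And>\<tau>. sign_vector \<tau> \<Longrightarrow> star_cell \<tau> \<in> lower_star \<Phi> v \<Longrightarrow>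
        paired W (star_cell \<tau>) \<longleftrightarrow> (\<exists>p\<in>Q. \<tau> p \<noteq> - \<sigma> p)"
    and "sign_vector \<tau>" "star_cell \<tau> \<in> lower_star \<Phi> v"
  shows "paired (pair_along \<Phi> v \<sigma> ps W) (star_cell \<tau>) \<longleftrightarrow> (\<exists>p\<in>Q \<union> set ps. \<tau> p \<noteq> - \<sigma> p)"
  using assms(1,3-)
proof (induction ps arbitrary: W Q)
  case Nil
  then show ?case by simp
next
  case (Cons p ps)
  define W' where "W' = W \<union> {(C, D) \<in> insert_pairs \<Phi> v (edge \<Phi> v p (\<sigma> p)).
             edge \<Phi> v p (- \<sigma> p) \<notin> edges_at \<Phi> v C \<and> \<not> paired W C}"
  have p: "p \<in> Zv" "lower p (\<sigma> p)" and s: "\<sigma> p \<in> {-1, 1}" "- \<sigma> p \<in> {-1, 1}" "\<sigma> p \<noteq> 0"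
    using Cons.prems(1) \<sigma>[THEN spec, of p] by (auto simp: lower_pairs_def)
  have inv: "paired W' (star_cell \<tau>) \<longleftrightarrow> (\<exists>q\<in>insert p Q. \<tau> q \<noteq> - \<sigma> q)" (is "?l \<longleftrightarrow> ?r")
    if \<tau>: "sign_vector \<tau>" and low: "star_cell \<tau> \<in> lower_star \<Phi> v" for \<tau>
  proof
    assume ?l
    then obtain C D where CD: "(C, D) \<in> W'" "star_cell \<tau> = C \<or> star_cell \<tau> = D" unfolding paired_def by auto
    show ?r
    proof (cases "(C, D) \<in> W")
      case True
      then have "paired W (star_cell \<tau>)" using CD(2) unfolding paired_def by force
      then show ?thesis using Cons.prems(2)[OF \<tau> low] by blast
    next
      case False
      then have "(C, D) \<in> insert_pairs \<Phi> v (edge \<Phi> v p (\<sigma> p))" using CD(1) unfolding W'_def by blast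
      then obtain \<tau>' where \<tau>': "sign_vector \<tau>'" "\<tau>' p = 0" "C = star_cell \<tau>'" "D = star_cell (\<tau>'(p := \<sigma> p))"
        unfolding insert_pairs_iff[OF p(1) s(1)] by blast
      have sv: "sign_vector (\<tau>'(p := \<sigma> p))" using \<tau>'(1) s(1) by (auto simp: sign_vector_def)
      have "\<tau> p = \<tau>' p \<or> \<tau> p = (\<tau>'(p := \<sigma> p)) p"
        using CD(2) p(1) unfolding \<tau>'(3,4) star_cell_eq_iff[OF \<tau> \<tau>'(1)] star_cell_eq_iff[OF \<tau> sv] by blast
      then have "\<tau> p \<noteq> - \<sigma> p" using \<tau>'(2) s(3) by auto
      then show ?thesis by blast
    qed
  next
    assume ?r
    show ?l
    proof (cases "paired W (star_cell \<tau>)")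
      case True
      then show ?thesis unfolding paired_def W'_def by blast
    next
      case False
      then have Q: "\<tau> q = - \<sigma> q" if "q \<in> Q" for q using Cons.prems(2)[OF \<tau> low] that by blast
      then have ne: "\<tau> p \<noteq> - \<sigma> p" using \<open>?r\<close> by blast
      then have "p \<notin> Q" using Q by blast
      have "\<tau> p \<in> {-1, 0, 1}" using \<tau> p(1) by (simp add: sign_vector_def)
      then consider "\<tau> p = 0" | "\<tau> p = \<sigma> p" using s ne by auto
      then show ?thesis
      proof cases
        case 1
        have "(star_cell \<tau>, star_cell (\<tau>(p := \<sigma> p))) \<in> insert_pairs \<Phi> v (edge \<Phi> v p (\<sigma> p))"
          unfolding insert_pairs_iff[OF p(1) s(1)] using \<tau> 1 low lower_update[OF \<tau> low s(1) p(2)] by blast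
        moreover have "edge \<Phi> v p (- \<sigma> p) \<notin> edges_at \<Phi> v (star_cell \<tau>)"
          unfolding edge_mem_edges_at[OF \<tau> p(1) s(2)] by (rule ne)
        ultimately have "(star_cell \<tau>, star_cell (\<tau>(p := \<sigma> p))) \<in> W'" using False unfolding W'_def by blast
        then show ?thesis unfolding paired_def by force
      next
        case 2
        let ?\<tau> = "\<tau>(p := 0)"
        have \<tau>0: "sign_vector ?\<tau>" "star_cell ?\<tau> \<in> lower_star \<Phi> v" using lower_update_zero[OF \<tau> low] by blast+
        have eq: "?\<tau>(p := \<sigma> p) = \<tau>" using 2 by (simp add: fun_upd_idem)
        have "(star_cell ?\<tau>, star_cell (?\<tau>(p := \<sigma> p))) \<in> insert_pairs \<Phi> v (edge \<Phi> v p (\<sigma> p))"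
          unfolding insert_pairs_iff[OF p(1) s(1)]
        proof (rule exI[of _ ?\<tau>], intro conjI)
          show "star_cell (?\<tau>(p := \<sigma> p)) \<in> lower_star \<Phi> v" unfolding eq by (rule low)
        qed (use \<tau>0 in simp_all)
        moreover have "edge \<Phi> v p (- \<sigma> p) \<notin> edges_at \<Phi> v (star_cell ?\<tau>)"
          unfolding edge_mem_edges_at[OF \<tau>0(1) p(1) s(2)] using s(3) by simp
        \<comment> \<open>Clearing the entry at \<open>p\<close> does not touch the treated
          directions, so this face has survived as well.\<close>
        moreover have "\<not> paired W (star_cell ?\<tau>)"
          unfolding Cons.prems(2)[OF \<tau>0] using Q \<open>p \<notin> Q\<close> by auto
        ultimately have "(star_cell ?\<tau>, star_cell \<tau>) \<in> W'" unfolding W'_def eq by blast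
        then show ?thesis unfolding paired_def by force
      qed
    qed
  qed
  have "paired (pair_along \<Phi> v \<sigma> ps W') (star_cell \<tau>) \<longleftrightarrow> (\<exists>q\<in>insert p Q \<union> set ps. \<tau> q \<noteq> - \<sigma> q)"
    by (rule Cons.IH) (use Cons.prems inv in auto)
  then show ?case by (simp add: W'_def)
qed

text \<open>The survivor is spanned by the opposite edges of all descending directions; in the other
  directions criticality forces the entry 0.\<close>

lemma critical_unpaired:
  assumes crit: "pl_critical \<Phi> v" and W: "critical_pairing \<Phi> v W"
  shows "\<exists>C. {C \<in> lower_star \<Phi> v. \<not> paired W C} = {C} \<and> aff_dim C = int (card lower_pairs)"
proof -
  obtain ps \<sigma> where ps: "set ps = lower_pairs" and \<sigma>: "\<forall>p. \<sigma> p \<in> {-1, 1}" and W: "W = pair_along \<Phi> v \<sigma> ps {}"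
    using W unfolding critical_pairing_def directions_eq lower_pairs_def lower_def by blast
  let ?\<tau> = "\<lambda>p. if p \<in> lower_pairs then - \<sigma> p else 0"
  have neg: "- \<sigma> p \<in> {-1, 1}" for p using \<sigma>[THEN spec, of p] by auto
  then have sv: "sign_vector ?\<tau>" unfolding sign_vector_def by auto
  have low: "star_cell ?\<tau> \<in> lower_star \<Phi> v"
    unfolding star_cell_lower_iff[OF sv] using critical_lower_iff[OF crit _ neg] by auto
  have pr: "paired W (star_cell \<tau>) \<longleftrightarrow> (\<exists>p\<in>lower_pairs. \<tau> p \<noteq> - \<sigma> p)"
    if "sign_vector \<tau>" "star_cell \<tau> \<in> lower_star \<Phi> v" for \<tau>
    using pair_along_paired[of ps \<sigma> "{}" "{}" \<tau>] ps \<sigma> that unfolding W by (simp add: paired_def)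
  have "{C \<in> lower_star \<Phi> v. \<not> paired W C} = {star_cell ?\<tau>}"
  proof (intro Set.set_eqI iffI)
    fix C assume C: "C \<in> {C \<in> lower_star \<Phi> v. \<not> paired W C}"
    then obtain \<tau> where \<tau>: "sign_vector \<tau>" "C = star_cell \<tau>" using lower_star_cell by blast
    have C\<tau>: "star_cell \<tau> \<in> lower_star \<Phi> v" "\<not> paired W (star_cell \<tau>)" using C \<tau>(2) by auto
    have "\<tau> p = ?\<tau> p" if p: "p \<in> Zv" for p
    proof (cases "p \<in> lower_pairs")
      case True
      then show ?thesis using C\<tau>(2) pr[OF \<tau>(1) C\<tau>(1)] by auto
    next
      case False
      have "\<tau> p = 0"
      proof (rule ccontr)
        assume "\<tau> p \<noteq> 0"
        then have "\<tau> p \<in> {-1, 1}" "lower p (\<tau> p)"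
          using \<tau>(1) p C\<tau>(1) unfolding star_cell_lower_iff[OF \<tau>(1)] by (auto simp: sign_vector_def)
        then show False using critical_lower_iff[OF crit p] False by blast
      qed
      then show ?thesis using False by simp
    qed
    then show "C \<in> {star_cell ?\<tau>}" unfolding \<tau>(2) using star_cell_eq_iff[OF \<tau>(1) sv] by blast
  next
    fix C assume "C \<in> {star_cell ?\<tau>}"
    then show "C \<in> {C \<in> lower_star \<Phi> v. \<not> paired W C}" using low pr[OF sv low] by simp
  qed
  moreover have "{p\<in>Zv. ?\<tau> p \<noteq> 0} = lower_pairs"
  proof -
    have "- \<sigma> p \<noteq> 0" for p using neg[of p] by auto
    then show ?thesis by (auto simp: lower_pairs_def)
  qed
  then have "aff_dim (star_cell ?\<tau>) = int (card lower_pairs)" using aff_dim_star_cell[OF sv] by simp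
  ultimately show ?thesis by blast
qed

end

section \<open>Maxima on cells\<close>

context network
begin

lemma finite_cells: "finite (cells \<Phi>)"
proof -
  let ?S = "E m \<rightarrow>\<^sub>E {-1, 0, 1 :: real}"
  have "cells \<Phi> \<subseteq> weak_cell \<Phi> m ` ?S"
  proof
    fix C assume "C \<in> cells \<Phi>"
    then obtain x where x: "C = cell_of \<Phi> m x" unfolding cells_eq by blast
    have "C = weak_cell \<Phi> m (restrict (\<lambda>p. sgn (pre p x)) (E m))"
      unfolding x by (rule weak_cell_cong) simp
    moreover have "restrict (\<lambda>p. sgn (pre p x)) (E m) \<in> ?S"
      by (intro restrict_PiE_iff[THEN iffD2] ballI sgn_cases)
    ultimately show "C \<in> weak_cell \<Phi> m ` ?S" by blast
  qed
  moreover have "finite ?S" by (intro finite_PiE) auto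
  ultimately show ?thesis by (meson finite_imageI finite_subset)
qed

lemma finite_vertices: "finite (vertices \<Phi>)"
proof -
  have "(\<lambda>v. {v}) ` vertices \<Phi> \<subseteq> cells \<Phi>" by (auto simp: vertices_def)
  then have "finite ((\<lambda>v. {v}) ` vertices \<Phi>)" using finite_cells finite_subset by blast
  then show ?thesis by (rule finite_imageD) (simp add: inj_on_def)
qed

lemma cell_props:
  assumes "C \<in> cells \<Phi>"
  shows "C \<subseteq> L0" "closed C" "convex C" "C \<noteq> {}"
proof -
  obtain x where x: "x \<in> L0" "C = cell_of \<Phi> m x" using assms unfolding cells_eq by blast
  show "C \<subseteq> L0" unfolding x(2) weak_cell_def by blast
  show "closed C" "convex C" unfolding x(2) by (intro closed_weak_cell convex_weak_cell order_refl)+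
  show "C \<noteq> {}" using mem_cell_of[OF x(1)] unfolding x(2) by blast
qed

lemma cell_of_subset:
  assumes "C \<in> cells \<Phi>" "y \<in> C" shows "cell_of \<Phi> m y \<subseteq> C" "cell_of \<Phi> m y \<in> cells \<Phi>" "y \<in> cell_of \<Phi> m y"
proof -
  obtain x where x: "x \<in> L0" "C = cell_of \<Phi> m x" using assms unfolding cells_eq by blast
  show "cell_of \<Phi> m y \<subseteq> C" using assms(2) unfolding x(2) by (rule cell_of_mono)
  have "y \<in> L0" using cell_props(1)[OF assms(1)] assms(2) by blast
  then show "cell_of \<Phi> m y \<in> cells \<Phi>" "y \<in> cell_of \<Phi> m y" unfolding cells_eq using mem_cell_of by blast+
qed

lemma net_fun_affine:
  assumes "C \<in> cells \<Phi>" "y \<in> C" "z \<in> C" "0 \<le> t" "t \<le> 1"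
  shows "net_fun \<Phi> ((1 - t) *\<^sub>R y + t *\<^sub>R z) = (1 - t) * net_fun \<Phi> y + t * net_fun \<Phi> z"
proof -
  obtain x where x: "C = cell_of \<Phi> m x" using assms unfolding cells_eq by blast
  show ?thesis using assms(2-) unfolding x by (rule net_fun_affine_on_cell)
qed

text \<open>A point of a cell is a relative interior point of its own cell, so one can go beyond it.\<close>

lemma extend_beyond:
  assumes x: "x \<in> L0" and z: "z \<in> cell_of \<Phi> m x"
  shows "\<exists>e>1. (1 - e) *\<^sub>R z + e *\<^sub>R x \<in> cell_of \<Phi> m x \<and>
     net_fun \<Phi> ((1 - e) *\<^sub>R z + e *\<^sub>R x) = (1 - e) * net_fun \<Phi> z + e * net_fun \<Phi> x"
proof -
  have "x \<in> rel_interior (cell_of \<Phi> m x)"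
    unfolding rel_interior_cell_of[OF order_refl x] by (rule mem_open_cell[OF x])
  then obtain e where e: "e > 1" and w: "(1 - e) *\<^sub>R z + e *\<^sub>R x \<in> cell_of \<Phi> m x" (is "?w \<in> _")
    using convex_rel_interior_iff[OF convex_weak_cell[OF order_refl]] z by blast
  have C: "cell_of \<Phi> m x \<in> cells \<Phi>" using x cells_eq by blast
  have "(1 - 1/e) *\<^sub>R z + (1/e) *\<^sub>R ?w = (1 - 1/e + (1/e) * (1 - e)) *\<^sub>R z + ((1/e) * e) *\<^sub>R x"
    by (simp add: scaleR_add_right scaleR_add_left del: scaleR_right_diff_distrib)
  also have "\<dots> = x" using e by (simp add: field_simps)
  finally have "net_fun \<Phi> x = (1 - 1/e) * net_fun \<Phi> z + (1/e) * net_fun \<Phi> ?w"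
    using net_fun_affine[OF C z w, of "1/e"] e by simp
  then have "e * net_fun \<Phi> x = e * ((1 - 1/e) * net_fun \<Phi> z + (1/e) * net_fun \<Phi> ?w)" by simp
  also have "\<dots> = (e - 1) * net_fun \<Phi> z + net_fun \<Phi> ?w" using e by (simp add: field_simps)
  finally show ?thesis using e w by (intro exI[of _ e]) (simp add: algebra_simps)
qed

end

section \<open>Vertices as maximisers\<close>

locale pl_network = network +
  assumes inj: "inj_on (net_fun \<Phi>) (vertices \<Phi>)"
    and no_flat: "\<forall>C\<in>cells \<Phi>. flat \<Phi> C \<longrightarrow> (\<exists>v. C = {v})"
begin

lemma flat_vertex:
  assumes x: "x \<in> L0" and const: "\<And>z. z \<in> cell_of \<Phi> m x \<Longrightarrow> net_fun \<Phi> z = net_fun \<Phi> x"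
  shows "cell_of \<Phi> m x = {x}" "x \<in> vertices \<Phi>"
proof -
  have C: "cell_of \<Phi> m x \<in> cells \<Phi>" using x cells_eq by blast
  moreover have "flat \<Phi> (cell_of \<Phi> m x)" using const unfolding flat_def by blast
  ultimately obtain v where "cell_of \<Phi> m x = {v}" using no_flat by blast
  then show "cell_of \<Phi> m x = {x}" using mem_cell_of[OF x, of m] by auto
  then show "x \<in> vertices \<Phi>" using x unfolding vertices_eq by blast
qed

text \<open>A smaller value at a point \<open>z\<close> of the cell of \<open>x\<close> would give a
  larger one on the prolongation of the segment from \<open>z\<close> beyond \<open>x\<close>. So
  the network is constant on that cell, and flat cells are points.\<close>

lemma maximizer_vertex:
  assumes C: "C \<in> cells \<Phi>" and x: "x \<in> C" and max: "\<And>z. z \<in> C \<Longrightarrow> net_fun \<Phi> z \<le> net_fun \<Phi> x"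
  shows "cell_of \<Phi> m x = {x}" "x \<in> vertices \<Phi>"
proof -
  have xL: "x \<in> L0" using cell_props(1)[OF C] x by blast
  have "net_fun \<Phi> z = net_fun \<Phi> x" if z: "z \<in> cell_of \<Phi> m x" for z
  proof (rule ccontr)
    assume "net_fun \<Phi> z \<noteq> net_fun \<Phi> x"
    moreover have sub: "cell_of \<Phi> m x \<subseteq> C" by (rule cell_of_subset(1)[OF C x])
    ultimately have less: "net_fun \<Phi> z < net_fun \<Phi> x" using max[of z] z by force
    obtain e where e: "e > 1" "(1 - e) *\<^sub>R z + e *\<^sub>R x \<in> cell_of \<Phi> m x"
       "net_fun \<Phi> ((1 - e) *\<^sub>R z + e *\<^sub>R x) = (1 - e) * net_fun \<Phi> z + e * net_fun \<Phi> x"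
      using extend_beyond[OF xL z] by blast
    have "(1 - e) * net_fun \<Phi> z + e * net_fun \<Phi> x \<le> net_fun \<Phi> x" using max e(2,3) sub by force
    then have "(e - 1) * net_fun \<Phi> x \<le> (e - 1) * net_fun \<Phi> z" by (simp add: algebra_simps)
    then show False using e(1) less by simp
  qed
  then show "cell_of \<Phi> m x = {x}" "x \<in> vertices \<Phi>" using flat_vertex[OF xL] by blast+
qed

text \<open>The midpoint of two maximisers is a maximiser, and its cell contains both of them,
  because no nonzero sign is lost at the midpoint. But the cell of a maximiser is a single
  point.\<close>

lemma unique_maximizer:
  assumes C: "C \<in> cells \<Phi>" and xy: "x \<in> C" "y \<in> C" and max: "\<And>z. z \<in> C \<Longrightarrow> net_fun \<Phi> z \<le> net_fun \<Phi> x"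
    and eq: "net_fun \<Phi> y = net_fun \<Phi> x"
  shows "x = y"
proof -
  let ?w = "(1 - 1/2) *\<^sub>R x + (1/2) *\<^sub>R y"
  have w: "?w \<in> C" using cell_props(3)[OF C] xy by (intro convexD_alt) auto
  have "net_fun \<Phi> ?w = (1 - 1/2) * net_fun \<Phi> x + 1/2 * net_fun \<Phi> y"
    by (rule net_fun_affine[OF C xy]) auto
  then have Fw: "net_fun \<Phi> ?w = net_fun \<Phi> x" unfolding eq by simp
  obtain u where u: "u \<in> L0" "C = cell_of \<Phi> m u" using C unfolding cells_eq by blast
  have sg: "sgn (pre p x) \<in> {0, sgn (pre p ?w)} \<and> sgn (pre p y) \<in> {0, sgn (pre p ?w)}" if p: "p \<in> E m" for p
  proof -
    have px: "sgn (pre p x) \<in> {0, sgn (pre p u)}" and py: "sgn (pre p y) \<in> {0, sgn (pre p u)}"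
      using xy p unfolding u(2) weak_cell_def by blast+
    have pw: "pre p ?w = (1 - 1/2) * pre p x + 1/2 * pre p y"
      using xy E_le[OF p order_refl] unfolding u(2) by (intro pre_combine[OF order_refl]) auto
    show ?thesis
    proof (cases "sgn (pre p x) = 0 \<and> sgn (pre p y) = 0")
      case False
      then have "sgn (pre p x) = sgn (pre p u) \<or> sgn (pre p y) = sgn (pre p u)" using px py by auto
      then have "sgn (pre p ?w) = sgn (pre p u)"
      proof
        assume "sgn (pre p y) = sgn (pre p u)"
        then show ?thesis unfolding pw by (intro sgn_strict_combine px) auto
      next
        assume "sgn (pre p x) = sgn (pre p u)"
        then have "sgn ((1 - 1/2) * pre p y + 1/2 * pre p x) = sgn (pre p u)" by (intro sgn_strict_combine py) auto
        then show ?thesis unfolding pw by (simp add: add.commute)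
      qed
      then show ?thesis using px py by simp
    qed simp
  qed
  have "x \<in> cell_of \<Phi> m ?w" "y \<in> cell_of \<Phi> m ?w"
    using sg cell_props(1)[OF C] xy unfolding weak_cell_def by blast+
  moreover have "cell_of \<Phi> m ?w = {?w}" 
    by (rule maximizer_vertex(1)[OF C w]) (unfold Fw, rule max)
  ultimately show ?thesis by simp
qed

text \<open>Ascent as in linear programming: while the network is not constant on the cell of
  \<open>x\<close>, follow an increasing ray. Boundedness makes the ray leave the cell, and at the
  last point one more neuron vanishes, so the number of nonzero neurons drops.\<close>

lemma vertex_above:
  assumes C: "C \<in> cells \<Phi>" and bdd: "bdd_above (net_fun \<Phi> ` C)"
  shows "x \<in> C \<Longrightarrow> \<exists>w\<in>vertices \<Phi> \<inter> C. net_fun \<Phi> x \<le> net_fun \<Phi> w"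
proof (induction "card {p\<in>E m. pre p x \<noteq> 0}" arbitrary: x rule: less_induct)
  case less
  let ?D = "cell_of \<Phi> m x" and ?F = "net_fun \<Phi>"
  have x: "x \<in> L0" using cell_props(1)[OF C] less.prems by blast
  have sub: "?D \<subseteq> C" and D: "?D \<in> cells \<Phi>" and xD: "x \<in> ?D" using cell_of_subset[OF C less.prems] .
  show ?case
  proof (cases "\<forall>z\<in>?D. ?F z = ?F x")
    case True
    then show ?thesis using flat_vertex(2)[OF x] less.prems by auto
  next
    case False
    then obtain z0 where z0: "z0 \<in> ?D" "?F z0 \<noteq> ?F x" by blast
    have "\<exists>z\<in>?D. ?F x < ?F z"
    proof (cases "?F x < ?F z0")
      case True
      then show ?thesis using z0 by blast
    next
      case F: False
      then have less0: "?F z0 < ?F x" using z0 by simp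
      obtain e where e: "e > 1" "(1 - e) *\<^sub>R z0 + e *\<^sub>R x \<in> ?D"
       "?F ((1 - e) *\<^sub>R z0 + e *\<^sub>R x) = (1 - e) * ?F z0 + e * ?F x"
        using extend_beyond[OF x z0(1)] by blast
      have "0 < (e - 1) * (?F x - ?F z0)" using e less0 by simp
      then have "?F x < ?F ((1 - e) *\<^sub>R z0 + e *\<^sub>R x)" unfolding e(3) by (simp add: algebra_simps)
      then show ?thesis using e(2) by blast
    qed
    then obtain z where z: "z \<in> ?D" "?F x < ?F z" by blast
    obtain B where B: "\<And>y. y \<in> C \<Longrightarrow> ?F y \<le> B" using bdd unfolding bdd_above_def by blast
    let ?y = "\<lambda>t. (1 - t) *\<^sub>R x + t *\<^sub>R z"
    \<comment> \<open>With times at least 1 the point \<open>z\<close> lies between \<open>x\<close>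
      and the moving point, so affineness on the cell gives the value at the latter.\<close>
    define T where "T = {t. 1 \<le> t \<and> ?y t \<in> ?D}"
    have FT: "?F (?y t) = ?F x + t * (?F z - ?F x)" if "t \<in> T" for t
    proof -
      have t: "1 \<le> t" "?y t \<in> ?D" using that by (auto simp: T_def)
      have "(1 - 1/t) *\<^sub>R x + (1/t) *\<^sub>R ?y t = (1 - 1/t + (1/t) * (1 - t)) *\<^sub>R x + ((1/t) * t) *\<^sub>R z"
        by (simp add: scaleR_add_right scaleR_add_left del: scaleR_right_diff_distrib)
      also have "\<dots> = z" using t by (simp add: field_simps)
      finally have "?F z = (1 - 1/t) * ?F x + (1/t) * ?F (?y t)"
        using net_fun_affine[OF D xD t(2), of "1/t"] t(1) by simp
      then have "t * ?F z = t * ((1 - 1/t) * ?F x + (1/t) * ?F (?y t))" by simp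
      also have "\<dots> = (t - 1) * ?F x + ?F (?y t)" using t by (simp add: field_simps)
      finally show ?thesis by (simp add: algebra_simps)
    qed
    have "t \<le> (B - ?F x) / (?F z - ?F x)" if "t \<in> T" for t
    proof -
      have "?y t \<in> C" using that sub by (auto simp: T_def)
      then have "?F x + t * (?F z - ?F x) \<le> B" using FT[OF that] B by metis
      then show ?thesis using z(2) by (simp add: pos_le_divide_eq)
    qed
    then have "bdd_above T" unfolding bdd_above_def by blast
    moreover have "1 \<in> T" using z by (simp add: T_def)
    moreover have "closed T"
    proof -
      have "continuous_on UNIV ?y" by (intro continuous_intros)
      then have "closed (?y -` ?D)" using closed_vimage cell_props(2)[OF D] by blast
      then have "closed ({1..} \<inter> ?y -` ?D)" by (intro closed_Int closed_atLeast)
      moreover have "T = {1..} \<inter> ?y -` ?D" by (auto simp: T_def)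
      ultimately show ?thesis by simp
    qed
    ultimately have s: "Sup T \<in> T" by (intro closed_contains_Sup) auto
    define s where "s = Sup T"
    have sT: "s \<in> T" using s by (simp add: s_def)
    have s1: "1 \<le> s" and ys: "?y s \<in> ?D" using sT by (auto simp: T_def)
    have "0 \<le> s * (?F z - ?F x)" using s1 z(2) by simp
    then have Fs: "?F x \<le> ?F (?y s)" using FT[OF sT] by simp
    let ?N = "\<lambda>y. {p\<in>E m. pre p y \<noteq> 0}"
    have dom: "sgn (pre p (?y s)) \<in> {0, sgn (pre p x)}" if "p \<in> E m" for p
      using ys that unfolding weak_cell_def by blast
    have "?N (?y s) \<subset> ?N x"
    proof
      show "?N (?y s) \<subseteq> ?N x" using dom by (force simp: sgn_zero_iff)
      \<comment> \<open>If no further neuron vanished, the end point would be relatively interior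
        and the ray could be prolonged past the supremum.\<close>
      show "?N (?y s) \<noteq> ?N x"
      proof
        assume N: "?N (?y s) = ?N x"
        have "sgn (pre p (?y s)) = sgn (pre p x)" if p: "p \<in> E m" for p
        proof (cases "pre p x = 0")
          case True
          then show ?thesis using dom[OF p] by auto
        next
          case False
          then have "pre p (?y s) \<noteq> 0" using N p by blast
          then show ?thesis using dom[OF p] by (simp add: sgn_zero_iff)
        qed
        then have "?y s \<in> open_cell \<Phi> m x" using ys unfolding open_cell_def weak_cell_def by blast
        then have "?y s \<in> rel_interior ?D" unfolding rel_interior_cell_of[OF order_refl x] .
        then obtain e where e: "e > 1" "(1 - e) *\<^sub>R x + e *\<^sub>R ?y s \<in> ?D"
          using convex_rel_interior_iff[OF convex_weak_cell[OF order_refl]] xD by blast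
        have "(1 - e) *\<^sub>R x + e *\<^sub>R ?y s = (1 - e + e * (1 - s)) *\<^sub>R x + (e * s) *\<^sub>R z"
          by (simp add: scaleR_add_right scaleR_add_left)
        also have "1 - e + e * (1 - s) = 1 - e * s" by (simp add: algebra_simps)
        finally have "?y (e * s) \<in> ?D" using e(2) by simp
        moreover have "1 < e * s" "s < e * s" using e(1) s1 less_1_mult[of e s] by (cases "s = 1"; simp)+
        moreover have "1 \<le> e * s" using \<open>s < e * s\<close> s1 by linarith
        ultimately have "e * s \<in> T" unfolding T_def by blast
        then have "e * s \<le> s" unfolding s_def using \<open>bdd_above T\<close> by (rule cSup_upper)
        then show False using \<open>s < e * s\<close> by simp
      qed
    qed
    then have "card (?N (?y s)) < card (?N x)" by (intro psubset_card_mono) auto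
    then obtain w where "w \<in> vertices \<Phi> \<inter> C" "?F (?y s) \<le> ?F w"
      using less.hyps[of "?y s"] ys sub by blast
    then show ?thesis using order_trans[OF Fs] by blast
  qed
qed

text \<open>Every value on the cell is bounded by the value at one of its vertices, and there are
  finitely many of these. So each cell of the complex lies in the lower star of its highest
  vertex.\<close>

lemma lower_cell_max:
  assumes "C \<in> lower_cells \<Phi>"
  shows "\<exists>w\<in>vertices \<Phi>. C \<in> lower_star \<Phi> w"
proof -
  have C: "C \<in> cells \<Phi>" "bdd_above (net_fun \<Phi> ` C)" using assms by (auto simp: lower_cells_def)
  let ?V = "vertices \<Phi> \<inter> C"
  have fin: "finite (net_fun \<Phi> ` ?V)" using finite_vertices by simp
  obtain x where "x \<in> C" using cell_props(4)[OF C(1)] by blast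
  then have ne: "net_fun \<Phi> ` ?V \<noteq> {}" using vertex_above[OF C] by blast
  obtain w where w: "w \<in> ?V" "net_fun \<Phi> w = Max (net_fun \<Phi> ` ?V)"
    using Max_in[OF fin ne] by auto
  have "net_fun \<Phi> y \<le> net_fun \<Phi> w" if y: "y \<in> C" for y
  proof -
    obtain u where "u \<in> ?V" "net_fun \<Phi> y \<le> net_fun \<Phi> u" using vertex_above[OF C y] by blast
    moreover have "net_fun \<Phi> u \<le> Max (net_fun \<Phi> ` ?V)" using \<open>u \<in> ?V\<close> fin by simp
    ultimately show ?thesis using w by simp
  qed
  then show ?thesis using w C(1) unfolding lower_star_def by blast
qed

lemma lower_star_lower_cell: "C \<in> lower_star \<Phi> v \<Longrightarrow> C \<in> lower_cells \<Phi>"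
  unfolding lower_star_def lower_cells_def bdd_above_def by blast

text \<open>Both vertices maximise the network on the common cell, and distinct vertices have
  distinct values.\<close>

lemma lower_star_disjoint:
  assumes "v \<in> vertices \<Phi>" "w \<in> vertices \<Phi>" "C \<in> lower_star \<Phi> v" "C \<in> lower_star \<Phi> w"
  shows "v = w"
proof -
  have "net_fun \<Phi> v \<le> net_fun \<Phi> w" "net_fun \<Phi> w \<le> net_fun \<Phi> v"
    using assms(3,4) unfolding lower_star_def by blast+
  then show ?thesis using inj assms(1,2) by (auto dest: inj_onD)
qed

lemma lower_star_strict:
  assumes "C \<in> lower_star \<Phi> v" "x \<in> C" "x \<noteq> v" shows "net_fun \<Phi> x < net_fun \<Phi> v"
proof (rule ccontr)
  assume "\<not> net_fun \<Phi> x < net_fun \<Phi> v"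
  moreover have C: "C \<in> cells \<Phi>" "v \<in> C" "\<And>z. z \<in> C \<Longrightarrow> net_fun \<Phi> z \<le> net_fun \<Phi> v"
    using assms(1) unfolding lower_star_def by blast+
  ultimately have "net_fun \<Phi> x = net_fun \<Phi> v" using assms(2) by force
  then show False using unique_maximizer[OF C(1,2) assms(2) C(3)] assms(3) by simp
qed

end

section \<open>Homology at a vertex\<close>

lemma continuous_on_Max_image:
  fixes f :: "'i \<Rightarrow> 'a::topological_space \<Rightarrow> real"
  assumes "finite P" "\<And>p. p \<in> P \<Longrightarrow> continuous_on S (f p)"
  shows "continuous_on S (\<lambda>x. Max (insert 0 ((\<lambda>p. f p x) ` P)))"
  using assms
proof (induction P)
  case (insert q P)
  have "Max (insert 0 ((\<lambda>p. f p x) ` insert q P)) = max (f q x) (Max (insert 0 ((\<lambda>p. f p x) ` P)))" for x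
    using insert.hyps by (subst Max_insert[symmetric]) (auto simp: insert_commute)
  then show ?case using insert by (auto intro!: continuous_intros)
qed simp

lemma sgn_combine_cases:
  fixes a b :: real
  assumes "0 \<le> t" "t \<le> 1" "(1 - t) * a + t * b \<noteq> 0"
  shows "(a \<noteq> 0 \<and> sgn ((1 - t) * a + t * b) = sgn a) \<or> (b \<noteq> 0 \<and> sgn ((1 - t) * a + t * b) = sgn b)"
proof (cases "(1 - t) * a + t * b > 0")
  case True
  then have "0 < (1 - t) * a \<or> 0 < t * b" by linarith
  then have "0 < a \<or> 0 < b" using assms by (auto simp: zero_less_mult_iff)
  then show ?thesis using True by auto
next
  case False
  then have "(1 - t) * a + t * b < 0" using assms by simp
  then have "(1 - t) * a < 0 \<or> t * b < 0" by linarith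
  then have "a < 0 \<or> b < 0" using assms by (auto simp: mult_less_0_iff)
  then show ?thesis using \<open>(1 - t) * a + t * b < 0\<close> by auto
qed

section \<open>Radial exit from the lower star\<close>

locale pl_vertex = network_vertex \<Phi> v + pl_network \<Phi> for \<Phi> :: "'d::finite relu_net" and v
begin

abbreviation "F \<equiv> net_fun \<Phi>"
definition "star = \<Union>(lower_star \<Phi> v)"
definition "sub_level = \<Union>{C \<in> lower_cells \<Phi>. \<forall>x\<in>C. F x \<le> F v}"
text \<open>A union of whole cells: a point with \<open>F x < F v\<close> whose own cell contains
  \<open>v\<close> does not belong to it. Infinity is left out here and added back when the pair is
  formed.\<close>

definition "sub_prev = \<Union>{C \<in> lower_cells \<Phi>. \<forall>x\<in>C. F x < F v}"

lemma lower_cells_cells: "C \<in> lower_cells \<Phi> \<Longrightarrow> C \<in> cells \<Phi>"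
  by (simp add: lower_cells_def)

lemma closed_Union_lower_cells: "S \<subseteq> lower_cells \<Phi> \<Longrightarrow> closed (\<Union>S)"
  by (intro closed_Union finite_subset[OF _ finite_cells] ballI cell_props(2)) (auto dest: lower_cells_cells)

lemma lower_star_sub: "lower_star \<Phi> v \<subseteq> lower_cells \<Phi>"
  using lower_star_lower_cell by blast

lemma star_L0: "star \<subseteq> L0"
  unfolding star_def lower_star_def using cell_props(1) by blast

lemma v_in_star: "v \<in> star"
proof -
  have "{v} \<in> lower_star \<Phi> v" using vertex by (auto simp: lower_star_def vertices_def)
  then show ?thesis unfolding star_def by blast
qed

lemma level_cell_cases:
  assumes "C \<in> lower_cells \<Phi>" "\<forall>x\<in>C. F x \<le> F v"
  shows "(\<forall>x\<in>C. F x < F v) \<or> C \<in> lower_star \<Phi> v"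
proof -
  obtain w where w: "w \<in> vertices \<Phi>" "C \<in> lower_star \<Phi> w" using lower_cell_max[OF assms(1)] by blast
  have wC: "w \<in> C" "\<And>x. x \<in> C \<Longrightarrow> F x \<le> F w" using w(2) unfolding lower_star_def by blast+
  show ?thesis
  proof (cases "F w = F v")
    case True
    then have "w = v" using inj w(1) vertex by (auto dest: inj_onD)
    then show ?thesis using w by blast
  next
    case False
    then have "F w < F v" using assms(2) wC(1) by force
    then have "\<forall>x\<in>C. F x < F v" using wC(2) le_less_trans by blast
    then show ?thesis by blast
  qed
qed

lemma sub_level_eq: "sub_level = sub_prev \<union> star"
proof
  show "sub_level \<subseteq> sub_prev \<union> star"
    unfolding sub_level_def sub_prev_def star_def using level_cell_cases by blast
  have "\<forall>x\<in>C. F x \<le> F v" if "C \<in> lower_star \<Phi> v" for C using that unfolding lower_star_def by blast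
  then have "star \<subseteq> sub_level" unfolding star_def sub_level_def using lower_star_sub by blast
  moreover have "sub_prev \<subseteq> sub_level" unfolding sub_prev_def sub_level_def by (blast intro: less_imp_le)
  ultimately show "sub_prev \<union> star \<subseteq> sub_level" by blast
qed

lemma v_notin_prev: "v \<notin> sub_prev"
  unfolding sub_prev_def by blast

lemma star_point:
  assumes "x \<in> star"
  obtains \<tau> where "sign_vector \<tau>" "star_cell \<tau> \<in> lower_star \<Phi> v" "x \<in> star_cell \<tau>"
  using assms lower_star_cell unfolding star_def by blast

lemma sgn_on_star:
  assumes x: "x \<in> star" and p: "p \<in> E m - Zv"
  shows "sgn (pre p x) \<in> {0, sgn (pre p v)}"
proof -
  obtain \<tau> where "x \<in> star_cell \<tau>" using star_point[OF x] .
  then have "sgn (pre p x) \<in> {0, full_sign \<tau> p}" using p unfolding weak_cell_def by blast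
  then show ?thesis using p by (simp add: full_sign_def)
qed

lemma pre_v_nz: "p \<in> E m - Zv \<Longrightarrow> pre p v \<noteq> 0"
  by (simp add: zero_set_def)

text \<open>Both sides say that \<open>v\<close> is not in the cell of \<open>x\<close>. If
  \<open>v\<close> is in that cell, no neuron nonzero at \<open>v\<close> can vanish at
  \<open>x\<close>. If it is not, the values on the cell stay strictly below \<open>F v\<close>,
  because a cell of the lower star has its maximum at \<open>v\<close> only.\<close>

lemma prev_iff:
  assumes x: "x \<in> star" and xv: "x \<noteq> v"
  shows "x \<in> sub_prev \<longleftrightarrow> (\<exists>p\<in>E m - Zv. pre p x = 0)"
proof -
  obtain \<tau> where \<tau>: "sign_vector \<tau>" "star_cell \<tau> \<in> lower_star \<Phi> v" "x \<in> star_cell \<tau>" using star_point[OF x] .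
  have C: "star_cell \<tau> \<in> cells \<Phi>" using \<tau>(2) unfolding lower_star_def by blast
  note sub = cell_of_subset[OF C \<tau>(3)]
  have "v \<in> cell_of \<Phi> m x \<longleftrightarrow> \<not> (\<exists>p\<in>E m - Zv. pre p x = 0)"
  proof
    assume v: "v \<in> cell_of \<Phi> m x"
    show "\<not> (\<exists>p\<in>E m - Zv. pre p x = 0)"
    proof
      assume "\<exists>p\<in>E m - Zv. pre p x = 0"
      then obtain p where p: "p \<in> E m - Zv" "pre p x = 0" by blast
      have "sgn (pre p v) \<in> {0, sgn (pre p x)}" using v p(1) unfolding weak_cell_def by blast
      then show False using p pre_v_nz[OF p(1)] by (simp add: sgn_zero_iff)
    qed
  next
    assume nz: "\<not> (\<exists>p\<in>E m - Zv. pre p x = 0)"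
    have "sgn (pre p v) \<in> {0, sgn (pre p x)}" if p: "p \<in> E m" for p
    proof (cases "p \<in> Zv")
      case True
      then show ?thesis by (simp add: zero_set_def)
    next
      case False
      then have "pre p x \<noteq> 0" using nz p by blast
      then show ?thesis using sgn_on_star[OF x, of p] p False by (simp add: sgn_zero_iff)
    qed
    then show "v \<in> cell_of \<Phi> m x" using vL unfolding weak_cell_def by blast
  qed
  moreover have "x \<in> sub_prev \<longleftrightarrow> v \<notin> cell_of \<Phi> m x"
  proof
    assume "x \<in> sub_prev"
    then obtain D where D: "D \<in> lower_cells \<Phi>" "\<forall>y\<in>D. F y < F v" "x \<in> D" unfolding sub_prev_def by blast
    have "cell_of \<Phi> m x \<subseteq> D" by (rule cell_of_subset(1)[OF lower_cells_cells[OF D(1)] D(3)])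
    then show "v \<notin> cell_of \<Phi> m x" using D(2) by blast
  next
    assume v: "v \<notin> cell_of \<Phi> m x"
    have less: "\<forall>y\<in>cell_of \<Phi> m x. F y < F v"
    proof
      fix y assume y: "y \<in> cell_of \<Phi> m x"
      then have "y \<in> star_cell \<tau>" "y \<noteq> v" using sub(1) v by blast+
      then show "F y < F v" by (rule lower_star_strict[OF \<tau>(2)])
    qed
    then have "bdd_above (F ` cell_of \<Phi> m x)" unfolding bdd_above_def by (blast intro: less_imp_le)
    then have "cell_of \<Phi> m x \<in> lower_cells \<Phi>" using sub(2) unfolding lower_cells_def by blast
    then show "x \<in> sub_prev" using less sub(3) unfolding sub_prev_def by blast
  qed
  ultimately show ?thesis by blast
qed

text \<open>At \<open>v + (x - v) /\<^sub>R d\<close> the neuron \<open>p\<close> vanishes for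
  \<open>d = 1 - pre p x / pre p v\<close>. As \<open>d\<close> decreases from 1, the largest of
  these values is met first. The inserted 0 covers rays that never leave the star.\<close>

definition "\<kappa> x = Max (insert 0 ((\<lambda>p. 1 - pre p x / pre p v) ` (E m - Zv)))"

lemma \<kappa>_ge: "p \<in> E m - Zv \<Longrightarrow> 1 - pre p x / pre p v \<le> \<kappa> x" "0 \<le> \<kappa> x"
  unfolding \<kappa>_def by (auto intro: Max_ge)

lemma \<kappa>_attained: "\<kappa> x = 0 \<or> (\<exists>p\<in>E m - Zv. \<kappa> x = 1 - pre p x / pre p v)"
proof -
  have "\<kappa> x \<in> insert 0 ((\<lambda>p. 1 - pre p x / pre p v) ` (E m - Zv))"
    unfolding \<kappa>_def by (rule Max_in) auto
  then show ?thesis by blast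
qed

lemma ratio_nonneg:
  assumes "x \<in> star" "p \<in> E m - Zv" shows "0 \<le> pre p x / pre p v"
  using sgn_on_star[OF assms] pre_v_nz[OF assms(2)]
  by (auto simp: sgn_if zero_le_divide_iff split: if_splits)

lemma \<kappa>_01: "x \<in> star \<Longrightarrow> \<kappa> x \<in> {0..1}"
  using \<kappa>_attained[of x] \<kappa>_ge(2)[of x] ratio_nonneg by fastforce

lemma \<kappa>_prev_iff:
  assumes x: "x \<in> star - {v}" shows "x \<in> sub_prev \<longleftrightarrow> \<kappa> x = 1"
proof -
  have "\<kappa> x = 1 \<longleftrightarrow> (\<exists>p\<in>E m - Zv. pre p x = 0)"
  proof
    assume "\<kappa> x = 1"
    then obtain p where "p \<in> E m - Zv" "1 = 1 - pre p x / pre p v" using \<kappa>_attained[of x] by auto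
    then show "\<exists>p\<in>E m - Zv. pre p x = 0" using pre_v_nz by auto
  next
    assume "\<exists>p\<in>E m - Zv. pre p x = 0"
    then have "1 \<le> \<kappa> x" using \<kappa>_ge(1)[of _ x] by force
    then show "\<kappa> x = 1" using \<kappa>_01[of x] x by auto
  qed
  then show ?thesis using prev_iff[of x] x by blast
qed

lemma continuous_\<kappa>: "continuous_on (star - {v}) \<kappa>"
  unfolding \<kappa>_def
proof (rule continuous_on_Max_image)
  fix p assume p: "p \<in> E m - Zv"
  have "continuous_on (star - {v}) (pre p)"
    using star_L0 p by (intro continuous_on_subset[OF continuous_pre]) auto
  then show "continuous_on (star - {v}) (\<lambda>x. 1 - pre p x / pre p v)"
    using pre_v_nz[OF p] by (intro continuous_intros) auto
qed simp

text \<open>With the pattern frozen, the pre-activations along the ray are known before the ray is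
  known to stay in the cell. Neurons vanishing at \<open>v\<close> are merely rescaled, and the
  others have not changed sign while \<open>d\<close> is at least \<open>\<kappa> x\<close>.\<close>

lemma ray_stays:
  assumes x: "x \<in> star" and d: "\<kappa> x \<le> d" "0 < d"
  shows "v + (x - v) /\<^sub>R d \<in> star \<and> (\<forall>p\<in>E m. pre p (v + (x - v) /\<^sub>R d) = (1 - 1/d) * pre p v + (1/d) * pre p x)"
proof -
  let ?y = "v + (x - v) /\<^sub>R d"
  obtain \<tau> where \<tau>: "sign_vector \<tau>" "star_cell \<tau> \<in> lower_star \<Phi> v" "x \<in> star_cell \<tau>" using star_point[OF x] .
  have vC: "v \<in> star_cell \<tau>" by (rule star_cell_in(2)[OF \<tau>(1)])
  have y_eq: "?y = (1 - 1/d) *\<^sub>R v + (1/d) *\<^sub>R x" by (simp add: algebra_simps divide_inverse)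
  have f: "frozen_pre \<Phi> (full_sign \<tau>) p ?y = (1 - 1/d) * pre p v + (1/d) * pre p x" if p: "p \<in> E m" for p
    using affine_map_combine[OF affine_frozen_pre[OF p], of "full_sign \<tau>" "1/d" v x]
      frozen_pre_on_cell[OF order_refl vC p] frozen_pre_on_cell[OF order_refl \<tau>(3) p] E_le[OF p order_refl]
    unfolding y_eq by simp
  have "sgn (frozen_pre \<Phi> (full_sign \<tau>) p ?y) \<in> {0, full_sign \<tau> p}" if p: "p \<in> E m" for p
  proof (cases "p \<in> Zv")
    case True
    then have "pre p v = 0" by (simp add: zero_set_def)
    then have "sgn (frozen_pre \<Phi> (full_sign \<tau>) p ?y) = sgn (pre p x)"
      unfolding f[OF p] using d(2) by (simp add: sgn_divide)
    moreover have "sgn (pre p x) \<in> {0, full_sign \<tau> p}" using \<tau>(3) p unfolding weak_cell_def by blast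
    ultimately show ?thesis by simp
  next
    case False
    then have p': "p \<in> E m - Zv" using p by blast
    \<comment> \<open>The value at divisor \<open>d\<close> is \<open>?c * pre p v\<close>, and
      \<open>?c\<close> is nonnegative exactly when \<open>d\<close> is at least the term of
      \<open>p\<close> in the maximum defining \<open>\<kappa>\<close>.\<close>
    let ?c = "(d - (1 - pre p x / pre p v)) / d"
    have eq: "frozen_pre \<Phi> (full_sign \<tau>) p ?y = ?c * pre p v"
      unfolding f[OF p] using pre_v_nz[OF p'] d(2) by (simp add: field_simps)
    have "0 \<le> ?c" using \<kappa>_ge(1)[OF p', of x] d by simp
    moreover have "sgn (c * b) \<in> {0, sgn b}" if "0 \<le> c" for b c :: real
      using that by (cases "c = 0") (simp_all add: sgn_mult)
    ultimately have "sgn (frozen_pre \<Phi> (full_sign \<tau>) p ?y) \<in> {0, sgn (pre p v)}" unfolding eq by blast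
    then show ?thesis using False by (simp add: full_sign_def)
  qed
  moreover have "?y \<in> L0"
    using star_L0 x vL by (intro subspace_add subspace_mul subspace_diff subspace_layer_space) auto
  ultimately have yC: "?y \<in> star_cell \<tau>" unfolding weak_cell_frozen[OF order_refl] by blast
  moreover have "pre p ?y = (1 - 1/d) * pre p v + (1/d) * pre p x" if p: "p \<in> E m" for p
    using frozen_pre_on_cell[OF order_refl yC p] E_le[OF p order_refl] f[OF p] by simp
  ultimately show ?thesis using \<tau>(2) unfolding star_def by blast
qed

text \<open>At the divisor \<open>\<kappa> x\<close> the neuron attaining the maximum vanishes, so
  the point is in the previous complex by \<open>prev_iff\<close>.\<close>

lemma ray_exits:
  assumes x: "x \<in> star" and pos: "0 < \<kappa> x"
  shows "v + (x - v) /\<^sub>R \<kappa> x \<in> sub_prev"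
proof -
  let ?y = "v + (x - v) /\<^sub>R \<kappa> x"
  obtain p where p: "p \<in> E m - Zv" "\<kappa> x = 1 - pre p x / pre p v" using \<kappa>_attained[of x] pos by auto
  have y: "?y \<in> star" "pre p ?y = (1 - 1 / \<kappa> x) * pre p v + (1 / \<kappa> x) * pre p x"
    using ray_stays[OF x order_refl pos] p(1) by blast+
  have "pre p x = (1 - \<kappa> x) * pre p v" using p(2) pre_v_nz[OF p(1)] by (simp add: field_simps)
  then have "pre p ?y = 0" unfolding y(2) using pos by (simp add: field_simps)
  moreover from this have "?y \<noteq> v" using pre_v_nz[OF p(1)] by metis
  ultimately show ?thesis using prev_iff[OF y(1)] p(1) by blast
qed

text \<open>The conical model of the star in chart coordinates: the sign of a coordinate tells on
  which of the two edges of its direction the projection lies.\<close>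

definition "fan = {w \<in> L0. \<forall>p\<in>Zv. \<alpha> p w = 0 \<or> lower p (sgn (\<alpha> p w))}"

lemma chart_in_fan:
  assumes y: "y \<in> star" shows "chart y \<in> fan"
proof -
  obtain \<tau> where \<tau>: "sign_vector \<tau>" "star_cell \<tau> \<in> lower_star \<Phi> v" "y \<in> star_cell \<tau>" using star_point[OF y] .
  have "\<alpha> p (chart y) = 0 \<or> lower p (sgn (\<alpha> p (chart y)))" if p: "p \<in> Zv" for p
  proof (cases "pre p y = 0")
    case True
    then show ?thesis using \<alpha>_chart[OF p] by simp
  next
    case False
    have "p \<in> E m" using p by (simp add: zero_set_def)
    then have "sgn (pre p y) \<in> {0, full_sign \<tau> p}" using \<tau>(3) unfolding weak_cell_def by blast
    then have "sgn (pre p y) = \<tau> p" using False p by (simp add: full_sign_def sgn_zero_iff)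
    moreover from this have "lower p (\<tau> p)"
      using \<tau>(2) False p unfolding star_cell_lower_iff[OF \<tau>(1)] by (metis sgn_zero_iff)
    ultimately show ?thesis using \<alpha>_chart[OF p] by simp
  qed
  then show ?thesis using chart_in unfolding fan_def by blast
qed

text \<open>Feeds the radial data of the star into the conical criterion, and then replaces the
  small neighbourhood of \<open>v\<close> by its image under the chart, which is a truncated cone
  with apex 0.\<close>

lemma vertex_pair_homology:
  "\<exists>d>0. relative_homology_group n
       (subtopology (compactification \<Phi>) (insert None (Some ` sub_level))) (insert None (Some ` sub_prev))
     \<cong> relative_homology_group n (top_of_set (fan \<inter> cball 0 d)) (fan \<inter> cball 0 d - {0})"
proof -
  obtain d where d: "0 < d" "\<And>w. norm w \<le> d \<Longrightarrow> w \<in> L0 \<Longrightarrow> (\<forall>p\<in>Zv. pre p (unchart w) = \<alpha> p w) \<and>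
      (\<forall>p\<in>E m - Zv. sgn (pre p (unchart w)) = sgn (pre p v))"
  proof -
    obtain e where e: "0 < e" "\<And>w. dist w 0 < e \<Longrightarrow> w \<in> L0 \<longrightarrow> (\<forall>p\<in>Zv. pre p (unchart w) = \<alpha> p w) \<and>
      (\<forall>p\<in>E m - Zv. sgn (pre p (unchart w)) = sgn (pre p v))"
      using pre_unchart unfolding eventually_nhds_metric by blast
    \<comment> \<open>Halving turns the strict bound into one on a closed ball.\<close>
    show thesis by (rule that[of "e/2"]) (use e in auto)
  qed
  let ?B = "fan \<inter> cball 0 d"
  define N where "N = unchart ` ?B"
  have fanL: "fan \<subseteq> L0" by (auto simp: fan_def)
  have inv: "chart (unchart w) = w" if w: "w \<in> ?B" for w
  proof -
    have "w \<in> L0" "norm w \<le> d" using w fanL by auto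
    then have "chart (unchart w) = (\<Sum>p\<in>Zv. \<alpha> p w *\<^sub>R dual p)" unfolding chart_def using d(2) by (intro sum.cong refl) simp
    then show ?thesis using coordinates[OF \<open>w \<in> L0\<close>] by simp
  qed
  have NK: "N \<subseteq> star"
  proof
    fix y assume "y \<in> N"
    then obtain w where w: "w \<in> ?B" "y = unchart w" unfolding N_def by blast
    have wL: "w \<in> L0" "norm w \<le> d" using w fanL by auto
    let ?\<tau> = "\<lambda>p. sgn (\<alpha> p w)"
    have sv: "sign_vector ?\<tau>" unfolding sign_vector_def using sgn_cases by blast
    have "sgn (pre p y) = full_sign ?\<tau> p" if "p \<in> E m" for p
      using d(2)[OF wL(2,1)] that unfolding w(2) by (cases "p \<in> Zv") (auto simp: full_sign_def)
    then have "star_cell ?\<tau> = cell_of \<Phi> m y" by (intro star_cell_eq ballI)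
    then have "y \<in> star_cell ?\<tau>" using mem_cell_of[OF unchart_in] w(2) by simp
    moreover have "star_cell ?\<tau> \<in> lower_star \<Phi> v"
      unfolding star_cell_lower_iff[OF sv] using w(1) by (auto simp: fan_def sgn_zero_iff)
    ultimately show "y \<in> star" unfolding star_def by blast
  qed
  have closed_prev: "closed sub_prev" unfolding sub_prev_def by (rule closed_Union_lower_cells) blast
  have closed_star: "closed star" unfolding star_def by (rule closed_Union_lower_cells[OF lower_star_sub])
  have "\<forall>\<^sub>F y in nhds v. y \<in> L0 \<longrightarrow> norm (chart y) < d"
  proof -
    have "(chart \<longlongrightarrow> chart v) (at v within L0)" using continuous_chart vL unfolding continuous_on_def by blast
    then have "((\<lambda>y. norm (chart y)) \<longlongrightarrow> norm (chart v)) (at v within L0)" by (rule tendsto_norm)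
    then have "\<forall>\<^sub>F y in at v within L0. norm (chart y) < d" using d(1) by (intro order_tendstoD(2)) auto
    then show ?thesis unfolding eventually_at_filter by (rule eventually_mono) (use d(1) in auto)
  qed
  \<comment> \<open>Since \<open>sub_prev\<close> is closed and misses \<open>v\<close>, near
    \<open>v\<close> the sublevel set consists of points of the star only.\<close>
  moreover have "\<forall>\<^sub>F y in nhds v. y \<notin> sub_prev"
    using eventually_nhds_in_open[of "- sub_prev" v] closed_prev v_notin_prev by (simp add: open_Compl)
  ultimately have "\<forall>\<^sub>F y in nhds v. y \<notin> sub_prev \<and> (y \<in> L0 \<longrightarrow> norm (chart y) < d \<and> unchart (chart y) = y)"
    using unchart_chart by eventually_elim blast
  then obtain U where U: "open U" "v \<in> U"
    "\<And>y. y \<in> U \<Longrightarrow> y \<notin> sub_prev \<and> (y \<in> L0 \<longrightarrow> norm (chart y) < d \<and> unchart (chart y) = y)"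
    unfolding eventually_nhds by blast
  have UN: "U \<inter> sub_level \<subseteq> N"
  proof
    fix y assume "y \<in> U \<inter> sub_level"
    then have y: "y \<in> U" "y \<in> star" using U(3) sub_level_eq by blast+
    then have "norm (chart y) < d" "unchart (chart y) = y" using U(3)[OF y(1)] star_L0 by blast+
    moreover have "chart y \<in> ?B" using chart_in_fan[OF y(2)] \<open>norm (chart y) < d\<close> by simp
    ultimately show "y \<in> N" unfolding N_def by (metis imageI)
  qed
  have comp: "compactification \<Phi> = Alexandroff_compactification (top_of_set (\<Union>(lower_cells \<Phi>)))"
    by (simp add: compactification_def)
  have 1: "relative_homology_group n
       (subtopology (compactification \<Phi>) (insert None (Some ` sub_level))) (insert None (Some ` sub_prev))
     \<cong> relative_homology_group n (top_of_set N) (N - {v})"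
    unfolding comp
  proof (rule conical_pair_homology[where \<kappa> = \<kappa> and K = star and U = U])
    show "closed (\<Union>(lower_cells \<Phi>))" by (rule closed_Union_lower_cells) simp
    show "sub_level \<subseteq> \<Union>(lower_cells \<Phi>)" unfolding sub_level_def by blast
    show "\<And>x. x \<in> star - {v} \<Longrightarrow> \<kappa> x \<in> {0..1}" using \<kappa>_01 by blast
    show "\<And>x d. x \<in> star - {v} \<Longrightarrow> \<kappa> x \<le> d \<Longrightarrow> 0 < d \<Longrightarrow> d \<le> 1 \<Longrightarrow> v + (x - v) /\<^sub>R d \<in> star"
      using ray_stays by blast
    show "\<And>x. x \<in> star - {v} \<Longrightarrow> 0 < \<kappa> x \<Longrightarrow> v + (x - v) /\<^sub>R \<kappa> x \<in> sub_prev" using ray_exits by blast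
  qed (fact closed_prev closed_star sub_level_eq v_in_star v_notin_prev continuous_\<kappa> \<kappa>_prev_iff NK U(1,2) UN)+
  have vN: "v \<in> N"
  proof -
    have "0 \<in> ?B" using d(1) v_in_star chart_in_fan[of v] by simp
    then show ?thesis unfolding N_def using unchart_0 by (metis imageI)
  qed
  have hom: "homeomorphism N ?B chart unchart"
  proof (rule homeomorphismI)
    show "continuous_on N chart" using NK star_L0 by (intro continuous_on_subset[OF continuous_chart]) blast
    show "continuous_on ?B unchart" by (rule continuous_unchart)
    show "chart ` N \<subseteq> ?B"
    proof
      fix z assume "z \<in> chart ` N"
      then obtain w where w: "w \<in> ?B" "z = chart (unchart w)" unfolding N_def by blast
      show "z \<in> ?B" unfolding w(2) inv[OF w(1)] by (rule w(1))
    qed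
    show "unchart ` ?B \<subseteq> N" unfolding N_def ..
    show "unchart (chart y) = y" if y: "y \<in> N" for y
    proof -
      obtain w where w: "w \<in> ?B" "y = unchart w" using y unfolding N_def by blast
      show ?thesis unfolding w(2) inv[OF w(1)] ..
    qed
    show "\<And>w. w \<in> ?B \<Longrightarrow> chart (unchart w) = w" by (rule inv)
  qed
  from relative_homology_homeomorphism[OF this vN, of n] 1 d(1) show ?thesis
    unfolding chart_v by (intro exI[of _ d]) (blast intro: iso_trans)
qed

section \<open>The cone at regular and at critical vertices\<close>

lemma convex_fan: "convex fan"
  unfolding convex_alt
proof (intro ballI allI impI)
  fix x y and t :: real assume xy: "x \<in> fan" "y \<in> fan" and t: "0 \<le> t \<and> t \<le> 1"
  have L: "x \<in> L0" "y \<in> L0" using xy by (auto simp: fan_def)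
  have "\<alpha> p ((1 - t) *\<^sub>R x + t *\<^sub>R y) = 0 \<or> lower p (sgn (\<alpha> p ((1 - t) *\<^sub>R x + t *\<^sub>R y)))" if p: "p \<in> Zv" for p
  proof -
    have eq: "\<alpha> p ((1 - t) *\<^sub>R x + t *\<^sub>R y) = (1 - t) * \<alpha> p x + t * \<alpha> p y"
      by (simp add: linear_add[OF lin[OF p]] linear_scale[OF lin[OF p]])
    have "\<alpha> p x = 0 \<or> lower p (sgn (\<alpha> p x))" "\<alpha> p y = 0 \<or> lower p (sgn (\<alpha> p y))"
      using xy p by (auto simp: fan_def)
    then show ?thesis unfolding eq using sgn_combine_cases[of t "\<alpha> p x" "\<alpha> p y"] t by metis
  qed
  moreover have "(1 - t) *\<^sub>R x + t *\<^sub>R y \<in> L0" by (intro subspace_add subspace_mul subspace_layer_space L)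
  ultimately show "(1 - t) *\<^sub>R x + t *\<^sub>R y \<in> fan" unfolding fan_def by blast
qed

text \<open>The centre is a small multiple of the dual vector pointing along the descending edge. In
  direction \<open>p\<close> every point of the cone has sign \<open>s\<close> or 0, so a segment
  from the centre can reach 0 only at its other end.\<close>

lemma regular_starlike:
  assumes p: "p \<in> Zv" and s: "s \<in> {-1, 1}" and low: "lower p s" "\<not> lower p (- s)" and d: "0 < d"
  shows "starlike (fan \<inter> cball 0 d - {0})"
proof -
  \<comment> \<open>Chosen so that the centre has norm at most \<open>d\<close>; the summand 1 keeps
    the denominator positive.\<close>
  define e where "e = d / (1 + norm (dual p))"
  have e: "0 < e" using d by (simp add: e_def add_pos_nonneg)
  let ?c = "(e * s) *\<^sub>R dual p"
  have \<alpha>c: "\<alpha> q ?c = (if q = p then e * s else 0)" if "q \<in> Zv" for q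
    by (simp add: linear_scale[OF lin[OF that]] dual(2)[OF that])
  have sgnc: "sgn (e * s) = s" using e s by (auto simp: sgn_mult)
  have "?c \<in> L0" by (intro subspace_mul subspace_layer_space dual(1))
  moreover have "\<alpha> q ?c = 0 \<or> lower q (sgn (\<alpha> q ?c))" if "q \<in> Zv" for q
    using \<alpha>c[OF that] low(1) sgnc by (cases "q = p") simp_all
  ultimately have "?c \<in> fan" unfolding fan_def by blast
  moreover have "norm ?c \<le> d"
  proof -
    have "norm ?c = e * norm (dual p)" using e s by (auto simp: abs_mult)
    also have "\<dots> \<le> e * (1 + norm (dual p))" using e by simp
    also have "\<dots> = d" unfolding e_def using norm_ge_zero[of "dual p"] by (simp add: add_nonneg_eq_0_iff)
    finally show ?thesis .
  qed
  moreover have "?c \<noteq> 0"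
    using \<alpha>c[OF p] linear_0[OF lin[OF p]] e s by auto
  ultimately have c: "?c \<in> fan \<inter> cball 0 d - {0}" by simp
  have "closed_segment ?c w \<subseteq> fan \<inter> cball 0 d - {0}" if w: "w \<in> fan \<inter> cball 0 d - {0}" for w
  proof
    fix z assume z: "z \<in> closed_segment ?c w"
    have "convex (fan \<inter> cball 0 d)" by (intro convex_Int convex_fan convex_cball)
    then have "closed_segment ?c w \<subseteq> fan \<inter> cball 0 d" using c w by (intro closed_segment_subset) auto
    moreover have "z \<noteq> 0"
    proof
      assume "z = 0"
      obtain t where t: "0 \<le> t" "t \<le> 1" "z = (1 - t) *\<^sub>R ?c + t *\<^sub>R w" using z by (auto simp: in_segment)
      have "\<alpha> p z = (1 - t) * (e * s) + t * \<alpha> p w"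
        unfolding t(3) using \<alpha>c[OF p] by (simp add: linear_add[OF lin[OF p]] linear_scale[OF lin[OF p]])
      then have 0: "(1 - t) * (e * s) + t * \<alpha> p w = 0" using \<open>z = 0\<close> linear_0[OF lin[OF p]] by simp
      have "\<alpha> p w = 0 \<or> lower p (sgn (\<alpha> p w))" using w p by (auto simp: fan_def)
      then have "0 \<le> s * \<alpha> p w" using low(2) s by (auto simp: sgn_if split: if_splits)
      then have nn: "0 \<le> t * (s * \<alpha> p w)" using t by simp
      \<comment> \<open>Multiplying by \<open>s\<close> makes both summands nonnegative, so a
        vanishing sum makes each of them vanish.\<close>
      have "s * ((1 - t) * (e * s) + t * \<alpha> p w) = (1 - t) * e + t * (s * \<alpha> p w)"
        using s by (auto simp: algebra_simps)
      then have "(1 - t) * e + t * (s * \<alpha> p w) = 0" using 0 by simp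
      moreover have "0 \<le> (1 - t) * e" using t e by simp
      ultimately have "(1 - t) * e = 0" using nn by linarith
      then have "t = 1" using e by simp
      then show False using t(3) \<open>z = 0\<close> w by simp
    qed
    ultimately show "z \<in> fan \<inter> cball 0 d - {0}" using z by blast
  qed
  then show ?thesis unfolding starlike_def using c by blast
qed

lemma regular_homology:
  assumes "regular_pairing \<Phi> v W"
  shows "trivial_group (relative_homology_group n
       (subtopology (compactification \<Phi>) (insert None (Some ` sub_level))) (insert None (Some ` sub_prev)))"
proof -
  obtain p s where p: "p \<in> Zv" "s \<in> {-1, 1}" "lower p s" "\<not> lower p (- s)"
    using regular_pairing_direction[OF assms] .
  obtain d where d: "d > 0" and iso: "relative_homology_group n
       (subtopology (compactification \<Phi>) (insert None (Some ` sub_level))) (insert None (Some ` sub_prev))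
     \<cong> relative_homology_group n (top_of_set (fan \<inter> cball 0 d)) (fan \<inter> cball 0 d - {0})"
    using vertex_pair_homology by blast
  have "trivial_group (relative_homology_group n (top_of_set (fan \<inter> cball 0 d)) (fan \<inter> cball 0 d - {0}))"
    by (intro trivial_homology_starlike_complement convex_Int convex_fan convex_cball regular_starlike[OF p d])
  then show ?thesis using isomorphic_group_triviality[OF iso] by simp
qed

text \<open>At a critical vertex no half-line occurs, so the cone is a linear subspace. Its
  dimension is the number of directions with two descending edges, the index of the vertex.\<close>

lemma critical_homology:
  assumes crit: "pl_critical \<Phi> v"
  shows "if n = int (card lower_pairs)
    then relative_homology_group n
       (subtopology (compactification \<Phi>) (insert None (Some ` sub_level))) (insert None (Some ` sub_prev)) \<cong> integer_group
    else trivial_group (relative_homology_group n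
       (subtopology (compactification \<Phi>) (insert None (Some ` sub_level))) (insert None (Some ` sub_prev)))"
proof -
  let ?K = "{w \<in> L0. \<forall>p\<in>Zv - lower_pairs. \<alpha> p w = 0}"
  have fan: "fan = ?K"
  proof -
    have "(\<alpha> p w = 0 \<or> lower p (sgn (\<alpha> p w))) \<longleftrightarrow> (p \<notin> lower_pairs \<longrightarrow> \<alpha> p w = 0)" if p: "p \<in> Zv" for p w
    proof (cases "\<alpha> p w = 0")
      case False
      then have "sgn (\<alpha> p w) \<in> {-1, 1}" using sgn_cases[of "\<alpha> p w"] by (auto simp: sgn_zero_iff)
      then show ?thesis using critical_lower_iff[OF crit p] False by blast
    qed simp
    then show ?thesis unfolding fan_def by blast
  qed
  have linK: "\<And>p. p \<in> Zv - lower_pairs \<Longrightarrow> linear (\<alpha> p)" using lin by blast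
  then have sub: "subspace ?K"
    using subspace_layer_space[of \<Phi> 0] by (auto simp: subspace_def linear_0 linear_add linear_scale)
  \<comment> \<open>The dual basis realises arbitrary values, so each direction outside
    \<open>lower_pairs\<close> lowers the dimension by exactly one.\<close>
  have "\<forall>r. \<exists>u\<in>L0. \<forall>p\<in>Zv - lower_pairs. \<alpha> p u = r p"
  proof
    fix r
    show "\<exists>u\<in>L0. \<forall>p\<in>Zv - lower_pairs. \<alpha> p u = r p"
      by (rule bexI[OF _ combination_in]) (auto intro: \<alpha>_combination)
  qed
  moreover have "dim L0 = dim ?K + card (Zv - lower_pairs) \<longleftrightarrow> (\<forall>r. \<exists>u\<in>L0. \<forall>p\<in>Zv - lower_pairs. \<alpha> p u = r p)"
    by (rule dim_common_kernel[THEN conjunct2]) (simp, rule subspace_layer_space, rule linK)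
  ultimately have "dim L0 = dim ?K + card (Zv - lower_pairs)" by (rule iffD2[rotated])
  moreover have "card (Zv - lower_pairs) = card Zv - card lower_pairs" "card lower_pairs \<le> card Zv"
    by (auto intro!: card_Diff_subset card_mono simp: lower_pairs_def)
  ultimately have dim: "dim fan = card lower_pairs" unfolding fan using card_Zv by linarith
  obtain d where d: "d > 0" and iso: "relative_homology_group n
       (subtopology (compactification \<Phi>) (insert None (Some ` sub_level))) (insert None (Some ` sub_prev))
     \<cong> relative_homology_group n (top_of_set (fan \<inter> cball 0 d)) (fan \<inter> cball 0 d - {0})" (is "?G \<cong> ?H")
    using vertex_pair_homology by blast
  have "subspace fan" unfolding fan by (rule sub)
  from homology_punctured_disc[OF this d, of n]
  have H: "if n = int (card lower_pairs) then ?H \<cong> integer_group else trivial_group ?H" unfolding dim .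
  show ?thesis
  proof (cases "n = int (card lower_pairs)")
    case True
    then have "?H \<cong> integer_group" using H by simp
    then show ?thesis using True iso_trans[OF iso] by simp
  next
    case False
    then show ?thesis using H isomorphic_group_triviality[OF iso] by simp
  qed
qed

end

section \<open>The global vector field\<close>

lemma vimage_compact_cell [simp]: "Some -` compact_cell C = C"
  by (auto simp: compact_cell_def)

lemma inj_compact_cell: "inj compact_cell"
  by (rule injI) (metis vimage_compact_cell)

lemma compact_cell_eq_iff: "compact_cell C = compact_cell D \<longleftrightarrow> C = D"
  by (rule inj_eq[OF inj_compact_cell])

text \<open>A subset of a bounded cell is bounded, so a face never acquires infinity without the
  larger cell doing so. Thus compactification preserves the face relation.\<close>

lemma compact_cell_subset_iff: "compact_cell C \<subseteq> compact_cell D \<longleftrightarrow> C \<subseteq> D"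
proof
  assume "compact_cell C \<subseteq> compact_cell D"
  then have "Some -` compact_cell C \<subseteq> Some -` compact_cell D" by (rule vimage_mono)
  then show "C \<subseteq> D" by simp
next
  assume "C \<subseteq> D"
  then show "compact_cell C \<subseteq> compact_cell D"
    using bounded_subset[of D C] by (auto simp: compact_cell_def)
qed

lemma compact_cell_psubset_iff: "compact_cell C \<subset> compact_cell D \<longleftrightarrow> C \<subset> D"
  unfolding psubset_eq compact_cell_subset_iff compact_cell_eq_iff ..

lemma compact_cell_ne_None:
  assumes "C \<noteq> {}" shows "compact_cell C \<noteq> {None}"
proof
  assume "compact_cell C = {None}"
  then have "Some -` compact_cell C = Some -` {None}" by simp
  then show False using assms by auto
qed

lemma compact_dim_compact_cell:
  assumes "C \<noteq> {}" shows "compact_dim (compact_cell C) = aff_dim C"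
  using compact_cell_ne_None[OF assms] by (simp add: compact_dim_def)

lemma Union_compact_cells: "\<Union>(insert {None} (compact_cell ` S)) = insert None (Some ` \<Union>S)"
  by (auto simp: compact_cell_def split: if_splits)

lemma compact_cell_sublevel_iff:
  "(\<forall>z\<in>compact_cell C. compact_fun \<Phi> z \<le> l) \<longleftrightarrow> (\<forall>x\<in>C. ereal (net_fun \<Phi> x) \<le> l)"
  by (auto simp: compact_cell_def compact_fun_def)

lemma group_rank_eq_one_zero:
  assumes "comm_group G" "if b then G \<cong> integer_group else trivial_group G"
  shows "group_rank G = (if b then 1 else 0)"
  using assms group_rank_integer[OF assms(1)] group_rank_trivial[OF assms(1)] by (auto split: if_splits)

locale morse_network = transversal_network \<Phi> + pl_network \<Phi> for \<Phi> :: "'d::finite relu_net" +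
  fixes V :: "real^'d \<Rightarrow> ((real^'d) set \<times> (real^'d) set) set"
  assumes local_field: "\<forall>v\<in>vertices \<Phi>. local_pairing \<Phi> v (V v) \<and>
           discrete_gradient_field (lower_star \<Phi> v) aff_dim (V v)"
begin

abbreviation "W \<equiv> map_prod compact_cell compact_cell ` (\<Union>v\<in>vertices \<Phi>. V v)"

lemma pl_vertexI: "v \<in> vertices \<Phi> \<Longrightarrow> pl_vertex \<Phi> v"
  by unfold_locales

lemma local_pair:
  assumes "v \<in> vertices \<Phi>" "(C, D) \<in> V v"
  shows "C \<in> lower_star \<Phi> v" "D \<in> lower_star \<Phi> v" "C \<subset> D" "aff_dim C = aff_dim D - 1"
proof -
  have *: "V v \<subseteq> lower_star \<Phi> v \<times> lower_star \<Phi> v" "\<forall>(C, D)\<in>V v. C \<subset> D \<and> aff_dim C = aff_dim D - 1"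
    using local_field assms(1) unfolding discrete_gradient_field_def discrete_vector_field_def by blast+
  show "C \<in> lower_star \<Phi> v" "D \<in> lower_star \<Phi> v" using *(1) assms(2) by blast+
  show "C \<subset> D" "aff_dim C = aff_dim D - 1" using *(2) assms(2) by blast+
qed

lemma lower_star_nonempty: "C \<in> lower_star \<Phi> v \<Longrightarrow> C \<noteq> {}"
  unfolding lower_star_def by blast

lemma compact_cell_in: "C \<in> lower_star \<Phi> v \<Longrightarrow> compact_cell C \<in> compact_cells \<Phi>"
  using lower_star_lower_cell unfolding compact_cells_def by blast

lemma W_E:
  assumes "P \<in> W"
  obtains v C D where "v \<in> vertices \<Phi>" "(C, D) \<in> V v" "P = (compact_cell C, compact_cell D)"
  using assms by (auto simp: map_prod_def)

text \<open>Lower stars of distinct vertices are disjoint, so a clash of pairs could only arise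
  inside one local field.\<close>

lemma V_disjoint:
  assumes v: "v \<in> vertices \<Phi>" and w: "w \<in> vertices \<Phi>" and CD: "(C, D) \<in> V v" and CD': "(C', D') \<in> V w"
    and ne: "{C, D} \<inter> {C', D'} \<noteq> {}"
  shows "C = C' \<and> D = D'"
proof -
  obtain X where X: "X \<in> {C, D}" "X \<in> {C', D'}" using ne by blast
  have "X \<in> lower_star \<Phi> v" "X \<in> lower_star \<Phi> w"
    using X local_pair(1,2)[OF v CD] local_pair(1,2)[OF w CD'] by blast+
  then have "v = w" by (rule lower_star_disjoint[OF v w])
  moreover have "\<forall>P\<in>V v. \<forall>Q\<in>V v. P \<noteq> Q \<longrightarrow> {fst P, snd P} \<inter> {fst Q, snd Q} = {}"
    using local_field v unfolding discrete_gradient_field_def discrete_vector_field_def by blast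
  ultimately show ?thesis using CD CD' ne by fastforce
qed

lemma global_vector_field: "discrete_vector_field (compact_cells \<Phi>) compact_dim W"
  unfolding discrete_vector_field_def
proof (intro conjI)
  show "W \<subseteq> compact_cells \<Phi> \<times> compact_cells \<Phi>"
  proof
    fix P assume "P \<in> W"
    then obtain v C D where vCD: "v \<in> vertices \<Phi>" "(C, D) \<in> V v" and P: "P = (compact_cell C, compact_cell D)" by (rule W_E)
    show "P \<in> compact_cells \<Phi> \<times> compact_cells \<Phi>"
      unfolding P using local_pair(1,2)[OF vCD] compact_cell_in by blast
  qed
  have face: "fst P \<subset> snd P \<and> compact_dim (fst P) = compact_dim (snd P) - 1" if "P \<in> W" for P
  proof -
    obtain v C D where vCD: "v \<in> vertices \<Phi>" "(C, D) \<in> V v" and P: "P = (compact_cell C, compact_cell D)" using \<open>P \<in> W\<close> by (rule W_E)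
    note pair = local_pair[OF vCD]
    show ?thesis
      unfolding P fst_conv snd_conv compact_cell_psubset_iff compact_dim_compact_cell[OF lower_star_nonempty[OF pair(1)]]
        compact_dim_compact_cell[OF lower_star_nonempty[OF pair(2)]]
      using pair(3,4) by blast
  qed
  show "\<forall>(C, D)\<in>W. C \<subset> D \<and> compact_dim C = compact_dim D - 1"
  proof
    fix P assume "P \<in> W"
    from face[OF this] show "case P of (C, D) \<Rightarrow> C \<subset> D \<and> compact_dim C = compact_dim D - 1"
      by (simp add: case_prod_beta)
  qed
  show "\<forall>P\<in>W. \<forall>Q\<in>W. P \<noteq> Q \<longrightarrow> {fst P, snd P} \<inter> {fst Q, snd Q} = {}"
  proof (intro ballI impI)
    fix P Q assume PW: "P \<in> W" and QW: "Q \<in> W" and ne: "P \<noteq> Q"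
    obtain v C D where v: "v \<in> vertices \<Phi>" "(C, D) \<in> V v" and P: "P = (compact_cell C, compact_cell D)" using PW by (rule W_E)
    obtain w C' D' where w: "w \<in> vertices \<Phi>" "(C', D') \<in> V w" and Q: "Q = (compact_cell C', compact_cell D')" using QW by (rule W_E)
    have "{C, D} \<inter> {C', D'} = {}" using V_disjoint[OF v(1) w(1) v(2) w(2)] ne unfolding P Q by blast
    then show "{fst P, snd P} \<inter> {fst Q, snd Q} = {}" unfolding P Q by (auto simp: compact_cell_eq_iff)
  qed
qed

text \<open>Along a path the maximum of \<open>F\<close> does not increase, so a closed path stays in one lower star.\<close>

lemma global_acyclic: "acyclic_field W"
  unfolding acyclic_field_def
proof
  assume "\<exists>r C D. 0 < r \<and> V_path W r C D \<and> C r = C 0"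
  then obtain r C D where r: "0 < r" and path: "V_path W r C D" and closed: "C r = C 0" by blast
  have "\<forall>i. \<exists>q. i \<le> r \<longrightarrow> fst q \<in> vertices \<Phi> \<and> snd q \<in> V (fst q) \<and>
      C i = compact_cell (fst (snd q)) \<and> D i = compact_cell (snd (snd q))"
  proof
    fix i
    show "\<exists>q. i \<le> r \<longrightarrow> fst q \<in> vertices \<Phi> \<and> snd q \<in> V (fst q) \<and>
      C i = compact_cell (fst (snd q)) \<and> D i = compact_cell (snd (snd q))"
    proof (cases "i \<le> r")
      case True
      then have "(C i, D i) \<in> W" using path unfolding V_path_def by blast
      then obtain v A B where "v \<in> vertices \<Phi>" "(A, B) \<in> V v" "(C i, D i) = (compact_cell A, compact_cell B)" by (rule W_E)
      then show ?thesis by (intro exI[of _ "(v, A, B)"]) simp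
    qed simp
  qed
  from choice[OF this] obtain q where q: "\<forall>i. i \<le> r \<longrightarrow> fst (q i) \<in> vertices \<Phi> \<and> snd (q i) \<in> V (fst (q i)) \<and>
      C i = compact_cell (fst (snd (q i))) \<and> D i = compact_cell (snd (snd (q i)))" by blast
  define w A B where "w i = fst (q i)" and "A i = fst (snd (q i))" and "B i = snd (snd (q i))" for i
  have w: "w i \<in> vertices \<Phi>" and AB: "(A i, B i) \<in> V (w i)" and CA: "C i = compact_cell (A i)" and DB: "D i = compact_cell (B i)"
    if "i \<le> r" for i using q[THEN spec, THEN mp, OF that] by (simp_all add: w_def A_def B_def)
  have step: "A (Suc i) \<subset> B i" "A (Suc i) \<noteq> A i" if "i < r" for i
  proof -
    have i: "i \<le> r" "Suc i \<le> r" using that by auto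
    have "C (Suc i) \<subset> D i" "C (Suc i) \<noteq> C i" using path that unfolding V_path_def by blast+
    then show "A (Suc i) \<subset> B i" "A (Suc i) \<noteq> A i"
      unfolding CA[OF i(1)] CA[OF i(2)] DB[OF i(1)] compact_cell_psubset_iff compact_cell_eq_iff by blast+
  qed
  \<comment> \<open>The vertex \<open>w (Suc i)\<close> lies in \<open>A (Suc i)\<close>, a face of
    \<open>B i\<close>, and \<open>w i\<close> maximises the network on \<open>B i\<close>.\<close>
  have dec: "net_fun \<Phi> (w (Suc i)) \<le> net_fun \<Phi> (w i)" if "i < r" for i
  proof -
    have i: "i \<le> r" "Suc i \<le> r" using that by auto
    have "w (Suc i) \<in> A (Suc i)" using local_pair(1)[OF w AB, OF i(2) i(2)] unfolding lower_star_def by blast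
    then have "w (Suc i) \<in> B i" using step(1)[OF that] by blast
    then show ?thesis using local_pair(2)[OF w AB, OF i(1) i(1)] unfolding lower_star_def by blast
  qed
  have mono: "net_fun \<Phi> (w j) \<le> net_fun \<Phi> (w i)" if "i \<le> j" "j \<le> r" for i j
    using that
  proof (induction j rule: dec_induct)
    case (step n)
    then show ?case using dec[of n] by simp
  qed simp
  have "compact_cell (A r) = compact_cell (A 0)" using closed CA[of r] CA[of 0] by simp
  then have "A r = A 0" by (rule compact_cell_eq_iff[THEN iffD1])
  then have "w r = w 0"
    using local_pair(1)[OF w AB, of r] local_pair(1)[OF w AB, of 0] w lower_star_disjoint[of "w r" "w 0" "A 0"] by simp
  have same: "w i = w 0" if "i \<le> r" for i
  proof -
    have "net_fun \<Phi> (w i) = net_fun \<Phi> (w 0)" using mono[of 0 i] mono[of i r] that \<open>w r = w 0\<close> by simp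
    then show ?thesis using inj w[OF that] w[of 0] by (auto dest: inj_onD)
  qed
  have "V_path (V (w 0)) r A B"
    unfolding V_path_def using AB same step by metis
  moreover have "acyclic_field (V (w 0))"
    using local_field w[of 0] unfolding discrete_gradient_field_def by simp
  ultimately show False unfolding acyclic_field_def using r \<open>A r = A 0\<close> by blast
qed

lemma compact_cells_cases:
  assumes "X \<in> compact_cells \<Phi>" "X \<noteq> {None}"
  obtains C where "C \<in> lower_cells \<Phi>" "X = compact_cell C"
  using assms unfolding compact_cells_def by blast

lemma lower_cell_nonempty: "C \<in> lower_cells \<Phi> \<Longrightarrow> C \<noteq> {}"
  using cell_props(4) by (simp add: lower_cells_def)

lemma unpaired_None: "\<not> paired W {None}"
proof
  assume "paired W {None}"
  then obtain P where PW: "P \<in> W" and P: "{None} = fst P \<or> {None} = snd P" unfolding paired_def by blast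
  obtain v C D where v: "v \<in> vertices \<Phi>" "(C, D) \<in> V v" and eq: "P = (compact_cell C, compact_cell D)" using PW by (rule W_E)
  show False using P lower_star_nonempty[OF local_pair(1)[OF v]] lower_star_nonempty[OF local_pair(2)[OF v]]
    compact_cell_ne_None unfolding eq fst_conv snd_conv by metis
qed

lemma paired_iff:
  assumes v: "v \<in> vertices \<Phi>" and C: "C \<in> lower_star \<Phi> v"
  shows "paired W (compact_cell C) \<longleftrightarrow> paired (V v) C"
proof
  assume "paired W (compact_cell C)"
  then obtain P where PW: "P \<in> W" and P: "compact_cell C = fst P \<or> compact_cell C = snd P" unfolding paired_def by blast
  obtain w A B where w: "w \<in> vertices \<Phi>" "(A, B) \<in> V w" and eq: "P = (compact_cell A, compact_cell B)" using PW by (rule W_E)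
  have AB: "C = A \<or> C = B" using P unfolding eq fst_conv snd_conv compact_cell_eq_iff .
  then have "C \<in> lower_star \<Phi> w" using local_pair(1,2)[OF w] by blast
  then have "v = w" by (rule lower_star_disjoint[OF v w(1) C])
  then show "paired (V v) C" using AB w(2) unfolding paired_def by force
next
  assume "paired (V v) C"
  then obtain A B where AB: "(A, B) \<in> V v" "C = A \<or> C = B" unfolding paired_def by auto
  then have "map_prod compact_cell compact_cell (A, B) \<in> W" using v by blast
  then show "paired W (compact_cell C)" unfolding paired_def
    by (rule bexI[rotated]) (use AB(2) in auto)
qed

section \<open>Levels, sublevel complexes and relative perfectness\<close>

lemma levels_eq: "levels \<Phi> = insert (- \<infinity>) ((\<lambda>v. ereal (net_fun \<Phi> v)) ` vertices \<Phi>)"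
proof (intro Set.set_eqI iffI)
  fix l assume "l \<in> levels \<Phi>"
  then obtain z where z: "l = compact_fun \<Phi> z" "{z} \<in> compact_cells \<Phi>" unfolding levels_def by blast
  show "l \<in> insert (- \<infinity>) ((\<lambda>v. ereal (net_fun \<Phi> v)) ` vertices \<Phi>)"
  proof (cases z)
    case None
    then show ?thesis using z by (simp add: compact_fun_def)
  next
    case (Some x)
    obtain C where C: "C \<in> lower_cells \<Phi>" "{z} = compact_cell C"
      by (rule compact_cells_cases[OF z(2)]) (use Some in auto)
    have "Some -` {z} = C" unfolding C(2) by simp
    then have "C = {x}" using Some by auto
    then have "x \<in> vertices \<Phi>" using C(1) by (simp add: vertices_def lower_cells_def)
    then show ?thesis using z(1) Some by (simp add: compact_fun_def)
  qed
next
  fix l assume "l \<in> insert (- \<infinity>) ((\<lambda>v. ereal (net_fun \<Phi> v)) ` vertices \<Phi>)"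
  then consider "l = - \<infinity>" | v where "v \<in> vertices \<Phi>" "l = ereal (net_fun \<Phi> v)" by blast
  then show "l \<in> levels \<Phi>"
  proof cases
    case 1
    then have "l = compact_fun \<Phi> None" "{None} \<in> compact_cells \<Phi>" by (simp_all add: compact_fun_def compact_cells_def)
    then show ?thesis unfolding levels_def by blast
  next
    case 2
    have "{v} \<in> lower_cells \<Phi>" using 2(1) by (simp add: vertices_def lower_cells_def)
    moreover have "compact_cell {v} = {Some v}" by (simp add: compact_cell_def)
    ultimately have "{Some v} \<in> compact_cells \<Phi>" unfolding compact_cells_def by (metis imageI insertI2)
    moreover have "l = compact_fun \<Phi> (Some v)" using 2 by (simp add: compact_fun_def)
    ultimately show ?thesis unfolding levels_def by blast
  qed
qed

lemma None_in_compact_cells: "{None} \<in> compact_cells \<Phi>" by (simp add: compact_cells_def)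

lemma sublevel_eq: "sublevel \<Phi> l = insert {None} (compact_cell ` {C \<in> lower_cells \<Phi>. \<forall>x\<in>C. ereal (net_fun \<Phi> x) \<le> l})"
proof (intro Set.set_eqI iffI)
  fix X assume X: "X \<in> sublevel \<Phi> l"
  show "X \<in> insert {None} (compact_cell ` {C \<in> lower_cells \<Phi>. \<forall>x\<in>C. ereal (net_fun \<Phi> x) \<le> l})"
  proof (cases "X = {None}")
    case False
    then obtain C where C: "C \<in> lower_cells \<Phi>" "X = compact_cell C"
      using X unfolding sublevel_def by (blast elim: compact_cells_cases)
    then have "\<forall>x\<in>C. ereal (net_fun \<Phi> x) \<le> l"
      using X unfolding sublevel_def C(2) by (simp add: compact_cell_sublevel_iff)
    then show ?thesis using C by blast
  qed simp
next
  fix X assume "X \<in> insert {None} (compact_cell ` {C \<in> lower_cells \<Phi>. \<forall>x\<in>C. ereal (net_fun \<Phi> x) \<le> l})"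
  then consider "X = {None}" | C where "C \<in> lower_cells \<Phi>" "\<forall>x\<in>C. ereal (net_fun \<Phi> x) \<le> l" "X = compact_cell C" by blast
  then show "X \<in> sublevel \<Phi> l"
  proof cases
    case 1
    then show ?thesis using None_in_compact_cells by (simp add: sublevel_def compact_fun_def)
  next
    case 2
    then show ?thesis unfolding sublevel_def compact_cells_def by (simp add: compact_cell_sublevel_iff)
  qed
qed

text \<open>A cell of the complex attains its maximum at a vertex, so values strictly below that of
  \<open>v\<close> are already bounded by the preceding level. The level of infinity keeps the set
  of lower levels nonempty, so its maximum exists.\<close>

lemma previous_sublevel_vertex:
  assumes v: "v \<in> vertices \<Phi>"
  shows "previous_sublevel \<Phi> (ereal (net_fun \<Phi> v)) =
    insert {None} (compact_cell ` {C \<in> lower_cells \<Phi>. \<forall>x\<in>C. net_fun \<Phi> x < net_fun \<Phi> v})"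
proof -
  let ?M = "{l' \<in> levels \<Phi>. l' < ereal (net_fun \<Phi> v)}"
  have fin: "finite ?M" unfolding levels_eq using finite_vertices by simp
  have inf: "- \<infinity> \<in> ?M" by (simp add: levels_eq)
  then have ne: "?M \<noteq> {}" by blast
  have max: "Max ?M < ereal (net_fun \<Phi> v)" using Max_in[OF fin ne] by blast
  have "(\<forall>x\<in>C. ereal (net_fun \<Phi> x) \<le> Max ?M) \<longleftrightarrow> (\<forall>x\<in>C. net_fun \<Phi> x < net_fun \<Phi> v)"
    if C: "C \<in> lower_cells \<Phi>" for C
  proof
    assume "\<forall>x\<in>C. ereal (net_fun \<Phi> x) \<le> Max ?M"
    then have "\<forall>x\<in>C. ereal (net_fun \<Phi> x) < ereal (net_fun \<Phi> v)" using max le_less_trans by blast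
    then show "\<forall>x\<in>C. net_fun \<Phi> x < net_fun \<Phi> v" by simp
  next
    assume less: "\<forall>x\<in>C. net_fun \<Phi> x < net_fun \<Phi> v"
    obtain w where w: "w \<in> vertices \<Phi>" "C \<in> lower_star \<Phi> w" using lower_cell_max[OF C] by blast
    have wC: "w \<in> C" "\<And>x. x \<in> C \<Longrightarrow> net_fun \<Phi> x \<le> net_fun \<Phi> w" using w(2) unfolding lower_star_def by blast+
    have "ereal (net_fun \<Phi> w) \<in> ?M" using w(1) less wC(1) by (simp add: levels_eq)
    then have "ereal (net_fun \<Phi> w) \<le> Max ?M" by (rule Max_ge[OF fin])
    then show "\<forall>x\<in>C. ereal (net_fun \<Phi> x) \<le> Max ?M" using wC(2) by (meson ereal_less_eq(3) order_trans)
  qed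
  then have "{C \<in> lower_cells \<Phi>. \<forall>x\<in>C. ereal (net_fun \<Phi> x) \<le> Max ?M} = {C \<in> lower_cells \<Phi>. \<forall>x\<in>C. net_fun \<Phi> x < net_fun \<Phi> v}"
    by blast
  moreover have "\<exists>l'\<in>levels \<Phi>. l' < ereal (net_fun \<Phi> v)" using inf by blast
  ultimately show ?thesis unfolding previous_sublevel_def sublevel_eq by simp
qed

text \<open>The cell \<open>{None}\<close> belongs to both sublevels and drops out of the
  difference. On the remaining cells, those of the lower star, being paired globally and being
  paired locally agree.\<close>

lemma critical_cells_at_vertex:
  assumes v: "v \<in> vertices \<Phi>"
  shows "critical_cells (compact_cells \<Phi>) compact_dim W i \<inter>
      (sublevel \<Phi> (ereal (net_fun \<Phi> v)) - previous_sublevel \<Phi> (ereal (net_fun \<Phi> v))) =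
    compact_cell ` {C \<in> lower_star \<Phi> v. aff_dim C = int i \<and> \<not> paired (V v) C}"
proof -
  interpret pl_vertex \<Phi> v by (rule pl_vertexI[OF v])
  let ?S = "{C \<in> lower_cells \<Phi>. \<forall>x\<in>C. ereal (F x) \<le> ereal (F v)}"
  let ?S' = "{C \<in> lower_cells \<Phi>. \<forall>x\<in>C. F x < F v}"
  have "?S - ?S' = lower_star \<Phi> v"
  proof
    show "?S - ?S' \<subseteq> lower_star \<Phi> v" using level_cell_cases by auto
    have "C \<in> ?S - ?S'" if C: "C \<in> lower_star \<Phi> v" for C
      using lower_star_lower_cell[OF C] C unfolding lower_star_def by auto
    then show "lower_star \<Phi> v \<subseteq> ?S - ?S'" by blast
  qed
  then have img: "compact_cell ` ?S - compact_cell ` ?S' = compact_cell ` lower_star \<Phi> v"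
    using image_set_diff[OF inj_compact_cell, of ?S ?S'] by (simp only:)
  have notin: "{None} \<notin> compact_cell ` lower_star \<Phi> v"
  proof
    assume "{None} \<in> compact_cell ` lower_star \<Phi> v"
    then obtain C where "C \<in> lower_star \<Phi> v" "{None} = compact_cell C" by (rule imageE)
    then show False using compact_cell_ne_None[OF lower_star_nonempty] by metis
  qed
  have insert_diff: "insert n A - insert n B = D" if "A - B = D" "n \<notin> D" for n and A B D :: "(real^'d) option set set"
    using that by blast
  have diff: "sublevel \<Phi> (ereal (F v)) - previous_sublevel \<Phi> (ereal (F v)) = compact_cell ` lower_star \<Phi> v"
    unfolding sublevel_eq previous_sublevel_vertex[OF v] by (rule insert_diff[OF img notin])
  have "compact_cell C \<in> critical_cells (compact_cells \<Phi>) compact_dim W i \<longleftrightarrow> aff_dim C = int i \<and> \<not> paired (V v) C"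
    if C: "C \<in> lower_star \<Phi> v" for C
    unfolding critical_cells_def mem_Collect_eq paired_iff[OF v C] compact_dim_compact_cell[OF lower_star_nonempty[OF C]]
    using compact_cell_in[OF C] by blast
  then show ?thesis unfolding diff by blast
qed

text \<open>The lowest sublevel is the point at infinity and has an empty predecessor, so the
  relative group is the homology of a point, matched by the critical cell
  \<open>{None}\<close>.\<close>

lemma relatively_perfect_bottom:
  "enat (card (critical_cells (compact_cells \<Phi>) compact_dim W i \<inter> (sublevel \<Phi> (- \<infinity>) - previous_sublevel \<Phi> (- \<infinity>)))) =
   group_rank (relative_homology_group (int i)
     (subtopology (compactification \<Phi>) (\<Union>(sublevel \<Phi> (- \<infinity>)))) (\<Union>(previous_sublevel \<Phi> (- \<infinity>))))"
proof -
  have "{C \<in> lower_cells \<Phi>. \<forall>x\<in>C. ereal (net_fun \<Phi> x) \<le> - \<infinity>} = {}" using lower_cell_nonempty by auto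
  then have sub: "sublevel \<Phi> (- \<infinity>) = {{None}}" unfolding sublevel_eq by (simp only: image_empty)
  have prev: "previous_sublevel \<Phi> (- \<infinity>) = {}" by (simp add: previous_sublevel_def)
  have dim: "compact_dim {None} = 0" by (simp add: compact_dim_def)
  have crit: "critical_cells (compact_cells \<Phi>) compact_dim W i \<inter> ({{None}} - {}) = (if i = 0 then {{None}} else {})"
    using unpaired_None None_in_compact_cells dim by (auto simp: critical_cells_def)
  let ?T = "subtopology (compactification \<Phi>) {None}"
  have "topspace ?T = {None}" by (auto simp: compactification_def)
  then have "if i = 0 then homology_group (int i) ?T \<cong> integer_group else trivial_group (homology_group (int i) ?T)"
    using homology_coefficients homology_dimension_axiom by (metis of_nat_0 of_nat_eq_0_iff)
  then have "group_rank (homology_group (int i) ?T) = (if i = 0 then 1 else 0)"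
    by (intro group_rank_eq_one_zero abelian_homology_group)
  then show ?thesis unfolding sub prev crit by (simp add: one_enat_def zero_enat_def)
qed

text \<open>At a critical vertex both sides are 1 in the degree given by the index and 0 in the
  others; at a regular vertex both are 0 in every degree.\<close>

lemma relatively_perfect_vertex:
  assumes v: "v \<in> vertices \<Phi>"
  shows "enat (card (critical_cells (compact_cells \<Phi>) compact_dim W i \<inter>
      (sublevel \<Phi> (ereal (net_fun \<Phi> v)) - previous_sublevel \<Phi> (ereal (net_fun \<Phi> v))))) =
   group_rank (relative_homology_group (int i)
     (subtopology (compactification \<Phi>) (\<Union>(sublevel \<Phi> (ereal (net_fun \<Phi> v)))))
     (\<Union>(previous_sublevel \<Phi> (ereal (net_fun \<Phi> v)))))"
proof -
  interpret pl_vertex \<Phi> v by (rule pl_vertexI[OF v])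
  let ?G = "relative_homology_group (int i)
       (subtopology (compactification \<Phi>) (insert None (Some ` sub_level))) (insert None (Some ` sub_prev))"
  have U: "\<Union>(sublevel \<Phi> (ereal (F v))) = insert None (Some ` sub_level)"
    unfolding sublevel_eq Union_compact_cells sub_level_def by simp
  have U': "\<Union>(previous_sublevel \<Phi> (ereal (F v))) = insert None (Some ` sub_prev)"
    unfolding previous_sublevel_vertex[OF v] Union_compact_cells sub_prev_def ..
  let ?C = "{C \<in> lower_star \<Phi> v. aff_dim C = int i \<and> \<not> paired (V v) C}"
  have card: "card (compact_cell ` ?C) = card ?C"
    by (rule card_image[OF inj_on_subset[OF inj_compact_cell subset_UNIV]])
  have lp: "local_pairing \<Phi> v (V v)" using local_field v by blast
  have "enat (card ?C) = group_rank ?G"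
  proof (cases "pl_critical \<Phi> v")
    case True
    then have "critical_pairing \<Phi> v (V v)" using lp by (simp add: local_pairing_def)
    from critical_unpaired[OF True this] obtain C where C: "{C \<in> lower_star \<Phi> v. \<not> paired (V v) C} = {C}"
      "aff_dim C = int (card lower_pairs)" by blast
    have "?C = (if i = card lower_pairs then {C} else {})"
    proof -
      have "?C = {D \<in> {C \<in> lower_star \<Phi> v. \<not> paired (V v) C}. aff_dim D = int i}" by blast
      also have "\<dots> = {D \<in> {C}. aff_dim D = int i}" unfolding C(1) ..
      finally show ?thesis using C(2) by auto
    qed
    then have "card ?C = (if i = card lower_pairs then 1 else 0)" by simp
    moreover have "if i = card lower_pairs then ?G \<cong> integer_group else trivial_group ?G"
      using critical_homology[OF True, of "int i"] unfolding of_nat_eq_iff .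
    then have "group_rank ?G = (if i = card lower_pairs then 1 else 0)"
      by (intro group_rank_eq_one_zero abelian_relative_homology_group)
    ultimately show ?thesis by (simp add: one_enat_def zero_enat_def)
  next
    case False
    then have reg: "regular_pairing \<Phi> v (V v)" using lp by (simp add: local_pairing_def)
    have "?C = {}" using regular_all_paired[OF reg] by blast
    then have "card ?C = 0" by (simp only: card.empty)
    moreover have "group_rank ?G = 0"
      by (intro group_rank_trivial abelian_relative_homology_group regular_homology[OF reg])
    ultimately show ?thesis by (simp add: zero_enat_def)
  qed
  then show ?thesis unfolding critical_cells_at_vertex[OF v] card U U' .
qed

lemma relatively_perfect: "relatively_perfect \<Phi> W"
  unfolding relatively_perfect_def levels_eq
  using relatively_perfect_bottom relatively_perfect_vertex by blast

lemma None_critical: "{None} \<in> critical_cells (compact_cells \<Phi>) compact_dim W 0"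
  unfolding critical_cells_def using None_in_compact_cells unpaired_None by (simp add: compact_dim_def)

end

theorem theorem3:
  fixes \<Phi> :: "'d::finite relu_net"
    and V :: "real^'d \<Rightarrow> ((real^'d) set \<times> (real^'d) set) set"
  assumes "relu_network \<Phi>"
    and "supertransversal \<Phi>"
    and "generic \<Phi>"
    and "inj_on (net_fun \<Phi>) (vertices \<Phi>)"
    and "\<forall>C\<in>cells \<Phi>. flat \<Phi> C \<longrightarrow> (\<exists>v. C = {v})"
    and "\<forall>v\<in>vertices \<Phi>. local_pairing \<Phi> v (V v) \<and>
           discrete_gradient_field (lower_star \<Phi> v) aff_dim (V v)"
  shows "let W = map_prod compact_cell compact_cell ` (\<Union>v\<in>vertices \<Phi>. V v) in
           discrete_gradient_field (compact_cells \<Phi>) compact_dim W \<and>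
           relatively_perfect \<Phi> W \<and>
           {None} \<in> critical_cells (compact_cells \<Phi>) compact_dim W 0"
proof -
  interpret morse_network \<Phi> V
    using assms by unfold_locales
  show ?thesis
    unfolding Let_def discrete_gradient_field_def
    using global_vector_field global_acyclic relatively_perfect None_critical by blast
qed

end
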